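(* Let $\alpha$ be a positive root of $\Phi$ with depth growth rate $t$, and let $\chi_n(q)$ be the characteristic polynomial of the arrangement of fractures of $\mathrm{st}_n(\alpha)^\perp$ (an arrangement of hyperplanes in the space $\mathrm{st}_n(\alpha)^\perp$). Then there exist polynomials $p_0(q),\dots,p_t(q)$ and an integer $e$ such that for all sufficiently large $n$, $$\chi_n(q)=\sum_{k=0}^{t}p_k(q)(q-k)^{n-e}.$$
   Context: $\Phi$ is the root system of a crystallographic Cartan matrix $A$ for a Coxeter group with diagram $G$ (simple roots $\alpha_i$ indexed by vertices, $s_i(\beta)=\beta-(\alpha_i,\beta)\alpha_i$ with $(\alpha_i,\alpha_j)=A_{ij}$); roots are identified with integer-valued functions on vertices. Depth: $1+$ minimal $\ell$ in $\gamma=s_{y_\ell}\cdots s_{y_1}(\alpha_{y_0})$. Elastic data $(x,L_x,R_x)$: a vertex and partition of its neighbors. $\mathrm{st}_n(G)$ replaces $x$ by a path $x_0-\cdots-x_n$ of unlabeled edges, $x_0$ joined to $L_x$ and $x_n$ to $R_x$ by the original labeled edges; $\mathrm{st}_n(A)$ has entries $A_{yz}$ off the path, $A_{xz}$ at $(x_0,z)$ for $z\in L_x$ and $(x_n,z)$ for $z\in R_x$, $A_{yx}$ at $(y,x_0)$ for $y\in L_x$ and $(y,x_n)$ for $y\in R_x$, $2$ at $(x_i,x_i)$, $-1$ at $(x_i,x_{i\pm1})$, $0$ otherwise; $\mathrm{st}_n(\Phi)\subset V_n$ is its root system; $\mathrm{st}_n(\alpha)$ takes value $\alpha(x)$ at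 each $x_i$, agreeing with $\alpha$ elsewhere. Depth growth rate: the integer $t$ with $\mathrm{depth}(\mathrm{st}_n(\alpha))=tn+\mathrm{depth}(\alpha)$ for all $n$. Fractures: in $V_n^*$, $v^\perp=\{f:f(v)=0\}$; base region $D=\{f: f(\alpha_y)>0\ \forall y\}$. For distinct root hyperplanes $H_1,H_2$, their rank 2 subarrangement is the set of root hyperplanes containing $H_1\cap H_2$; the region containing $D$ is bounded by two basic hyperplanes. $H_1$ cuts $H_2$ if $H_1$ is basic and $H_2$ is not; then $H_1\cap H_2$ is a fracture of $H_2$. The characteristic polynomial of a finite arrangement of hyperplanes in a real vector space $E$ is $\chi(q)=\sum_X\mu(E,X)q^{\dim X}$, summed over the intersection lattice (intersections of subfamilies, including $E$), with $\mu$ its Möbius function. *)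

theory Defs
  imports "HOL-Analysis.Analysis" "HOL-Analysis.Finite_Function_Topology"
    "HOL-Computational_Algebra.Polynomial" "HOL-Library.Extended_Nat"
begin

section \<open>Coxeter diagrams and Cartan matrices\<close>

text \<open>
  A Coxeter diagram on a finite vertex set is given by its matrix of labels:
  vertices \<open>y \<noteq> z\<close> are joined by an edge iff \<open>m y z \<ge> 3\<close>, and an unlabeled edge means \<open>m y z = 3\<close>.
\<close>

definition coxeter_diagram :: "'v set \<Rightarrow> ('v \<Rightarrow> 'v \<Rightarrow> enat) \<Rightarrow> bool" where
  "coxeter_diagram V m \<longleftrightarrow> finite V \<and>
     (\<forall>y\<in>V. m y y = 1) \<and>
     (\<forall>y\<in>V. \<forall>z\<in>V. m y z = m z y \<and> (y \<noteq> z \<longrightarrow> 2 \<le> m y z))"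

definition neighbors :: "'v set \<Rightarrow> ('v \<Rightarrow> 'v \<Rightarrow> enat) \<Rightarrow> 'v \<Rightarrow> 'v set" where
  "neighbors V m x = {y \<in> V. y \<noteq> x \<and> 3 \<le> m x y}"

text \<open>Crystallographic means integer entries, which is built into the type of \<open>A\<close>.\<close>

definition crystallographic_cartan_matrix ::
    "'v set \<Rightarrow> ('v \<Rightarrow> 'v \<Rightarrow> enat) \<Rightarrow> ('v \<Rightarrow> 'v \<Rightarrow> int) \<Rightarrow> bool" where
  "crystallographic_cartan_matrix V m A \<longleftrightarrow>
     (\<forall>y\<in>V. A y y = 2) \<and>
     (\<forall>y\<in>V. \<forall>z\<in>V. y \<noteq> z \<longrightarrow>
        A y z \<le> 0 \<and> (A y z = 0 \<longleftrightarrow> A z y = 0) \<and>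
        (case m y z of
           enat k \<Rightarrow> real_of_int (A y z * A z y) = 4 * (cos (pi / real k))\<^sup>2
         | \<infinity> \<Rightarrow> 4 \<le> A y z * A z y))"


section \<open>Roots and depth\<close>

text \<open>
  Vectors in the root lattice are integer-valued functions that vanish outside \<open>V\<close>.
\<close>

definition simple_root :: "'v \<Rightarrow> 'v \<Rightarrow> int" where
  "simple_root y = (\<lambda>z. if z = y then 1 else 0)"

text \<open>The bilinear form with matrix \<open>A\<close>; it need not be symmetric.\<close>

definition cartan_form ::
    "'v set \<Rightarrow> ('v \<Rightarrow> 'v \<Rightarrow> int) \<Rightarrow> ('v \<Rightarrow> int) \<Rightarrow> ('v \<Rightarrow> int) \<Rightarrow> int" where
  "cartan_form V A \<beta> \<gamma> = (\<Sum>y\<in>V. \<Sum>z\<in>V. \<beta> y * A y z * \<gamma> z)"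

definition simple_reflection ::
    "'v set \<Rightarrow> ('v \<Rightarrow> 'v \<Rightarrow> int) \<Rightarrow> 'v \<Rightarrow> ('v \<Rightarrow> int) \<Rightarrow> ('v \<Rightarrow> int)" where
  "simple_reflection V A y \<beta> =
     (\<lambda>z. \<beta> z - cartan_form V A (simple_root y) \<beta> * simple_root y z)"

inductive_set root_system :: "'v set \<Rightarrow> ('v \<Rightarrow> 'v \<Rightarrow> int) \<Rightarrow> ('v \<Rightarrow> int) set"
  for V :: "'v set" and A :: "'v \<Rightarrow> 'v \<Rightarrow> int" where
  simple: "y \<in> V \<Longrightarrow> simple_root y \<in> root_system V A"
| reflect: "\<beta> \<in> root_system V A \<Longrightarrow> y \<in> V \<Longrightarrow> simple_reflection V A y \<beta> \<in> root_system V A"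

definition positive_roots :: "'v set \<Rightarrow> ('v \<Rightarrow> 'v \<Rightarrow> int) \<Rightarrow> ('v \<Rightarrow> int) set" where
  "positive_roots V A = {\<beta> \<in> root_system V A. \<forall>y\<in>V. 0 \<le> \<beta> y}"

text \<open>The list \<open>ys\<close> is \<open>[y\<^sub>l, \<dots>, y\<^sub>1]\<close>, so that the last entry acts first.\<close>

definition depth :: "'v set \<Rightarrow> ('v \<Rightarrow> 'v \<Rightarrow> int) \<Rightarrow> ('v \<Rightarrow> int) \<Rightarrow> nat" where
  "depth V A \<gamma> = 1 + (LEAST l. \<exists>ys y0. length ys = l \<and> set ys \<subseteq> V \<and> y0 \<in> V \<and>
     \<gamma> = foldr (simple_reflection V A) ys (simple_root y0))"


section \<open>Stretching\<close>

text \<open>\<open>L\<close> or \<open>R\<close> may be empty.\<close>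

definition elastic_data ::
    "'v set \<Rightarrow> ('v \<Rightarrow> 'v \<Rightarrow> enat) \<Rightarrow> 'v \<Rightarrow> 'v set \<Rightarrow> 'v set \<Rightarrow> bool" where
  "elastic_data V m x L R \<longleftrightarrow> x \<in> V \<and> L \<union> R = neighbors V m x \<and> L \<inter> R = {}"

datatype 'v stretched = Old 'v | Path nat

definition st_vertices :: "'v set \<Rightarrow> 'v \<Rightarrow> nat \<Rightarrow> 'v stretched set" where
  "st_vertices V x n = Old ` (V - {x}) \<union> Path ` {0..n}"

text \<open>Only the entries indexed by \<open>st_vertices V x n\<close> are meaningful.\<close>

fun st_cartan :: "('v \<Rightarrow> 'v \<Rightarrow> int) \<Rightarrow> 'v \<Rightarrow> 'v set \<Rightarrow> 'v set \<Rightarrow> nat \<Rightarrow>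
    'v stretched \<Rightarrow> 'v stretched \<Rightarrow> int" where
  "st_cartan A x L R n (Old y) (Old z) = A y z"
| "st_cartan A x L R n (Path i) (Old z) =
     (if (i = 0 \<and> z \<in> L) \<or> (i = n \<and> z \<in> R) then A x z else 0)"
| "st_cartan A x L R n (Old y) (Path j) =
     (if (j = 0 \<and> y \<in> L) \<or> (j = n \<and> y \<in> R) then A y x else 0)"
| "st_cartan A x L R n (Path i) (Path j) =
     (if i = j then 2 else if i = Suc j \<or> j = Suc i then - 1 else 0)"

fun st_vector :: "'v \<Rightarrow> nat \<Rightarrow> ('v \<Rightarrow> int) \<Rightarrow> 'v stretched \<Rightarrow> int" where
  "st_vector x n \<alpha> (Old y) = (if y = x then 0 else \<alpha> y)"
| "st_vector x n \<alpha> (Path i) = (if i \<le> n then \<alpha> x else 0)"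

text \<open>
  Depths are positive, so an integer satisfying this equation for all \<open>n\<close> is necessarily
  nonnegative.
\<close>

definition has_depth_growth_rate ::
    "'v set \<Rightarrow> ('v \<Rightarrow> 'v \<Rightarrow> int) \<Rightarrow> 'v \<Rightarrow> 'v set \<Rightarrow> 'v set \<Rightarrow> ('v \<Rightarrow> int) \<Rightarrow> nat \<Rightarrow> bool" where
  "has_depth_growth_rate V A x L R \<alpha> t \<longleftrightarrow>
     (\<forall>n. depth (st_vertices V x n) (st_cartan A x L R n) (st_vector x n \<alpha>) = t * n + depth V A \<alpha>)"


section \<open>Root hyperplanes and fractures\<close>

text \<open>
  The dual space of the real vector space with basis \<open>V\<close> consists of the finitely supported
  functions with support in \<open>V\<close>: the functional \<open>f\<close> takes the value \<open>lookup f y\<close> on the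
  simple root of \<open>y\<close>. This makes the dual space a subspace of a real normed vector space, even
  though its dimension is not encoded in the type.
\<close>

type_synonym 'v functional = "('v, real) poly_mapping"

definition dual_space :: "'v set \<Rightarrow> 'v functional set" where
  "dual_space V = {f. Poly_Mapping.keys f \<subseteq> V}"

definition pairing :: "'v set \<Rightarrow> 'v functional \<Rightarrow> ('v \<Rightarrow> int) \<Rightarrow> real" where
  "pairing V f \<beta> = (\<Sum>y\<in>V. Poly_Mapping.lookup f y * of_int (\<beta> y))"

definition perp :: "'v set \<Rightarrow> ('v \<Rightarrow> int) \<Rightarrow> 'v functional set" where
  "perp V \<beta> = {f \<in> dual_space V. pairing V f \<beta> = 0}"

definition base_region :: "'v set \<Rightarrow> 'v functional set" where
  "base_region V = {f \<in> dual_space V. \<forall>y\<in>V. 0 < pairing V f (simple_root y)}"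

definition root_hyperplanes :: "'v set \<Rightarrow> ('v \<Rightarrow> 'v \<Rightarrow> int) \<Rightarrow> 'v functional set set" where
  "root_hyperplanes V A = perp V ` root_system V A"

definition rank2_subarrangement :: "'v set \<Rightarrow> ('v \<Rightarrow> 'v \<Rightarrow> int) \<Rightarrow>
    'v functional set \<Rightarrow> 'v functional set \<Rightarrow> 'v functional set set" where
  "rank2_subarrangement V A H1 H2 = {H \<in> root_hyperplanes V A. H1 \<inter> H2 \<subseteq> H}"

text \<open>
  The region of an arrangement that contains the base region: the connected component
  of the complement of the arrangement in the dual space.
\<close>

definition region_containing_base ::
    "'v set \<Rightarrow> 'v functional set set \<Rightarrow> 'v functional set" where
  "region_containing_base V \<H> =
     (\<Union>f\<in>base_region V. connected_component_set (dual_space V - \<Union>\<H>) f)"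

text \<open>A hyperplane bounds a region if it is spanned by a face of the closed region.\<close>

definition basic_hyperplanes ::
    "'v set \<Rightarrow> 'v functional set set \<Rightarrow> 'v functional set set" where
  "basic_hyperplanes V \<H> = {H \<in> \<H>. span (H \<inter> closure (region_containing_base V \<H>)) = H}"

definition cuts :: "'v set \<Rightarrow> ('v \<Rightarrow> 'v \<Rightarrow> int) \<Rightarrow>
    'v functional set \<Rightarrow> 'v functional set \<Rightarrow> bool" where
  "cuts V A H1 H2 \<longleftrightarrow>
     H1 \<in> root_hyperplanes V A \<and> H2 \<in> root_hyperplanes V A \<and> H1 \<noteq> H2 \<and>
     H1 \<in> basic_hyperplanes V (rank2_subarrangement V A H1 H2) \<and>
     H2 \<notin> basic_hyperplanes V (rank2_subarrangement V A H1 H2)"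

definition fractures :: "'v set \<Rightarrow> ('v \<Rightarrow> 'v \<Rightarrow> int) \<Rightarrow>
    'v functional set \<Rightarrow> 'v functional set set" where
  "fractures V A H2 = {H1 \<inter> H2 | H1. cuts V A H1 H2}"


section \<open>Characteristic polynomials\<close>

definition intersection_lattice :: "'a set \<Rightarrow> 'a set set \<Rightarrow> 'a set set" where
  "intersection_lattice E \<A> = {E \<inter> \<Inter>\<B> | \<B>. \<B> \<subseteq> \<A>}"

text \<open>The Moebius function \<open>\<mu>(X, Y)\<close> of a finite family of sets ordered by reverse inclusion.\<close>

function moebius :: "'a set set \<Rightarrow> 'a set \<Rightarrow> 'a set \<Rightarrow> int" where
  "moebius \<L> X Y =
     (if Y = X then 1
      else if finite \<L> \<and> Y \<subset> X then - (\<Sum>Z | Z \<in> \<L> \<and> Y \<subset> Z \<and> Z \<subseteq> X. moebius \<L> X Z)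
      else 0)"
  by pat_completeness auto
termination
proof (relation "Wellfounded.measure (\<lambda>(\<L>, X, Y). card {Z \<in> \<L>. Y \<subset> Z})", goal_cases)
  case 1
  show ?case by simp
next
  case (2 \<L> X Y Z)
  then have "{W \<in> \<L>. Z \<subset> W} \<subset> {W \<in> \<L>. Y \<subset> W}" by auto
  with 2 show ?case by (simp add: psubset_card_mono)
qed

declare moebius.simps [simp del]

definition characteristic_polynomial :: "'a::real_vector set \<Rightarrow> 'a set set \<Rightarrow> real poly" where
  "characteristic_polynomial E \<A> =
     (\<Sum>X\<in>intersection_lattice E \<A>.
        monom (of_int (moebius (intersection_lattice E \<A>) E X)) (dim X))"

definition fracture_polynomial :: "'v set \<Rightarrow> ('v \<Rightarrow> 'v \<Rightarrow> int) \<Rightarrow> ('v \<Rightarrow> int) \<Rightarrow> real poly" where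
  "fracture_polynomial V A \<beta> =
     characteristic_polynomial (perp V \<beta>) (fractures V A (perp V \<beta>))"

end

theory Submission
  imports Defs "HOL-Library.FuncSet"
begin

text \<open>
  Every root is positive or negative, so a positive root \<open>\<beta>\<close> is not basic in a rank 2 subsystem exactly
  if that subsystem contains an inversion of the reflection \<open>t\<^sub>\<beta>\<close>: a positive root \<open>\<gamma> \<noteq> \<beta>\<close> with
  \<open>t\<^sub>\<beta> \<gamma>\<close> negative. Hence the fractures of \<open>\<beta>\<^sup>\<bottom>\<close> are the intersections \<open>\<gamma>\<^sup>\<bottom> \<inter> \<beta>\<^sup>\<bottom>\<close> with \<open>\<gamma>\<close> an
  inversion, and there are at most \<open>2 (depth \<beta> - 1)\<close> inversions. Stretching replaces the letter \<open>x\<close> of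
  a word by \<open>x\<^sub>0 \<dots> x\<^sub>n \<dots> x\<^sub>0\<close>; following the inversions through such a word shows that for \<open>n \<ge> 1\<close> the
  inversions of \<open>st\<^sub>n \<alpha>\<close> arise from those of \<open>st\<^sub>1 \<alpha>\<close> by repeating the value at \<open>x\<^sub>0\<close> on
  \<open>x\<^sub>0, \<dots>, x\<^sub>j\<^sub>-\<^sub>1\<close> and the value at \<open>x\<^sub>1\<close> on \<open>x\<^sub>j, \<dots>, x\<^sub>n\<close>, where \<open>1 \<le> j \<le> n\<close>. In the coordinates
  \<open>y\<^sub>j = f (x\<^sub>j) + \<dots> + f (x\<^sub>n)\<close> such a fracture is the graph of a linear function of the remaining
  coordinates and does not involve the other \<open>y\<^sub>i\<close>, so over a stratum of the base on which \<open>k\<close> of these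
  functions are distinct every \<open>y\<^sub>j\<close> contributes a factor \<open>q - k\<close>. Comparing the number of inversions
  with the depth, and pairing \<open>\<gamma>\<close> with \<open>- t\<^sub>\<beta> \<gamma>\<close>, gives \<open>k \<le> t\<close>.
\<close>

section \<open>Signs of roots\<close>

text \<open>The matrix \<open>A\<close> need not be symmetrizable, so there is no invariant
  symmetric form from which a reflection could be read off, and group elements occur only as words
  compared through their action. The reflection in a root is conjugated from a simple one along a
  word; that it does not depend on the word is itself a consequence of the sign theorem. Rank 2
  subarrangements can be infinite, which is why basic hyperplanes are recognized by inversions
  instead of by listing roots. The comparison system has two path vertices because a root of the
  stretched system may take different values on the two sides of a cut of the path; a cut exists
  only for n \<ge> 1. The bound on the number of factors combines two factors 2: a root of depth d
  has at most 2(d - 1) inversions, so letting n grow leaves at most 2t inversions per cut that feel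
  the cut, and since an inversion and its partner define the same fracture, these account for at
  most t values.\<close>

definition cform :: "'v set \<Rightarrow> ('v \<Rightarrow> 'v \<Rightarrow> int) \<Rightarrow> 'v \<Rightarrow> ('v \<Rightarrow> int) \<Rightarrow> int" where
  "cform V A y f = (\<Sum>z\<in>V. A y z * f z)"

abbreviation act :: "'v set \<Rightarrow> ('v \<Rightarrow> 'v \<Rightarrow> int) \<Rightarrow> 'v list \<Rightarrow> ('v \<Rightarrow> int) \<Rightarrow> 'v \<Rightarrow> int" where
  "act V A \<equiv> foldr (simple_reflection V A)"

definition nonneg :: "('v \<Rightarrow> int) \<Rightarrow> bool" where
  "nonneg f \<longleftrightarrow> (\<forall>z. 0 \<le> f z)"

definition nonpos :: "('v \<Rightarrow> int) \<Rightarrow> bool" where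
  "nonpos f \<longleftrightarrow> (\<forall>z. f z \<le> 0)"

text \<open>Words act from the right, so the fixed last letter \<open>t\<close> is the reflection
  applied first. Among the words in \<open>s\<close> and \<open>t\<close> without adjacent equal
  letters, these are the ones that do not begin by negating \<open>simple_root s\<close>.\<close>

fun alternating :: "'v \<Rightarrow> 'v \<Rightarrow> nat \<Rightarrow> 'v list" where
  "alternating s t 0 = []"
| "alternating s t (Suc k) = alternating t s k @ [t]"

lemma length_alternating [simp]: "length (alternating s t k) = k"
  by (induction s t k rule: alternating.induct) auto

lemma set_alternating: "set (alternating s t k) \<subseteq> {s, t}"
  by (induction s t k rule: alternating.induct) auto

lemma alternating_suffix:
  "j \<le> k \<Longrightarrow> \<exists>w. alternating s t k = w @ alternating s t j \<and> set w \<subseteq> {s, t} \<and> length w = k - j"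
proof (induction s t k arbitrary: j rule: alternating.induct)
  case (2 s t k)
  show ?case
  proof (cases j)
    case 0
    then show ?thesis using set_alternating[of t s k]
      by (intro exI[of _ "alternating s t (Suc k)"]) auto
  next
    case (Suc i)
    with "2.IH"[of i] "2.prems" show ?thesis by fastforce
  qed
qed simp

lemma alternating_eqI:
  assumes "set u \<subseteq> {s, t}" "u \<noteq> [] \<Longrightarrow> last u = t"
    and "\<And>a b c. u \<noteq> a @ [c, c] @ b"
  shows "u = alternating s t (length u)"
  using assms
proof (induction u arbitrary: s t rule: rev_induct)
  case (snoc r u)
  have r: "r = t" using snoc.prems(2) by simp
  have "u = alternating t s (length u)"
  proof (rule snoc.IH)
    show "set u \<subseteq> {t, s}" using snoc.prems(1) by auto
    show "last u = s" if "u \<noteq> []"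
    proof (rule ccontr)
      assume "last u \<noteq> s"
      then have "last u = t" using snoc.prems(1) last_in_set[OF that] by fastforce
      then have "u @ [r] = butlast u @ [t, t] @ []"
        using that r append_butlast_last_id[OF that] by (metis append.assoc append_Cons append_Nil append_Nil2)
      then show False using snoc.prems(3) by blast
    qed
    show "u \<noteq> a @ [c, c] @ b" for a b c
      using snoc.prems(3)[of a c "b @ [r]"] by auto
  qed
  then show ?case using r by simp
qed simp

text \<open>Generalized Cartan matrices: the Coxeter labels play no role beyond this.\<close>

locale gcm =
  fixes V :: "'v set" and A :: "'v \<Rightarrow> 'v \<Rightarrow> int"
  assumes finite_V [simp]: "finite V"
    and diag: "y \<in> V \<Longrightarrow> A y y = 2"
    and offdiag: "y \<in> V \<Longrightarrow> z \<in> V \<Longrightarrow> y \<noteq> z \<Longrightarrow> A y z \<le> 0"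
    and zero_sym: "y \<in> V \<Longrightarrow> z \<in> V \<Longrightarrow> A y z = 0 \<Longrightarrow> A z y = 0"
begin

abbreviation "\<phi> \<equiv> cform V A"
abbreviation "\<Phi> \<equiv> root_system V A"

section \<open>Linearity and invertibility of the action of words on vectors\<close>

lemma cform_simple: "z \<in> V \<Longrightarrow> \<phi> y (simple_root z) = A y z"
  unfolding cform_def simple_root_def by (simp add: if_distrib sum.delta cong: if_cong)

lemma cform_lincomb: "\<phi> y (\<lambda>z. p * f z + q * g z) = p * \<phi> y f + q * \<phi> y g"
  unfolding cform_def by (simp add: sum_distrib_left sum.distrib algebra_simps)

lemma cform_sub: "\<phi> y (\<lambda>z. f z - c * g z) = \<phi> y f - c * \<phi> y g"
  unfolding cform_def by (simp add: sum_distrib_left sum_subtractf algebra_simps)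

lemma refl_eq:
  assumes "y \<in> V"
  shows "simple_reflection V A y f = (\<lambda>z. f z - \<phi> y f * simple_root y z)"
proof -
  have "cartan_form V A (simple_root y) f = (\<Sum>w\<in>V. simple_root y w * \<phi> w f)"
    unfolding cartan_form_def cform_def by (simp add: sum_distrib_left mult.assoc)
  also have "\<dots> = (\<Sum>w\<in>V. if w = y then \<phi> w f else 0)"
    by (rule sum.cong) (auto simp: simple_root_def)
  also have "\<dots> = \<phi> y f" using assms by simp
  finally show ?thesis unfolding simple_reflection_def by simp
qed

lemma refl_refl [simp]:
  assumes "y \<in> V"
  shows "simple_reflection V A y (simple_reflection V A y f) = f"
  using assms by (simp add: refl_eq cform_sub cform_simple diag)

lemma refl_simple: "y \<in> V \<Longrightarrow> simple_reflection V A y (simple_root y) = (\<lambda>z. - simple_root y z)"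
  by (simp add: refl_eq cform_simple diag)

lemma refl_lincomb:
  assumes "y \<in> V"
  shows "simple_reflection V A y (\<lambda>z. p * f z + q * g z) =
    (\<lambda>z. p * simple_reflection V A y f z + q * simple_reflection V A y g z)"
  using assms by (simp add: refl_eq cform_lincomb algebra_simps)

lemma act_lincomb:
  "set ys \<subseteq> V \<Longrightarrow> act V A ys (\<lambda>z. p * f z + q * g z) = (\<lambda>z. p * act V A ys f z + q * act V A ys g z)"
  by (induction ys) (auto simp: refl_lincomb)

lemma act_uminus: "set ys \<subseteq> V \<Longrightarrow> act V A ys (\<lambda>z. - f z) = (\<lambda>z. - act V A ys f z)"
  using act_lincomb[of ys "-1" f 0 f] by simp

lemma act_sub: "set ys \<subseteq> V \<Longrightarrow> act V A ys (\<lambda>z. f z - c * g z) = (\<lambda>z. act V A ys f z - c * act V A ys g z)"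
  using act_lincomb[of ys 1 f "-c" g] by simp

lemma act_rev [simp]: "set ys \<subseteq> V \<Longrightarrow> act V A (rev ys) (act V A ys f) = f"
  by (induction ys arbitrary: f) auto

lemma act_rev' [simp]: "set ys \<subseteq> V \<Longrightarrow> act V A ys (act V A (rev ys) f) = f"
  using act_rev[of "rev ys"] by simp

lemma act_root: "set ys \<subseteq> V \<Longrightarrow> \<beta> \<in> \<Phi> \<Longrightarrow> act V A ys \<beta> \<in> \<Phi>"
  by (induction ys) (auto intro: root_system.reflect)

lemma root_word:
  assumes "\<beta> \<in> \<Phi>"
  obtains ys y where "set ys \<subseteq> V" "y \<in> V" "\<beta> = act V A ys (simple_root y)"
proof -
  have "\<exists>ys y. set ys \<subseteq> V \<and> y \<in> V \<and> \<beta> = act V A ys (simple_root y)"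
    using assms
  proof induction
    case (simple y)
    then show ?case by (intro exI[of _ "[]"]) auto
  next
    case (reflect \<beta> y)
    then obtain ys z where "set ys \<subseteq> V" "z \<in> V" "\<beta> = act V A ys (simple_root z)" by blast
    with reflect.hyps show ?case by (intro exI[of _ "y # ys"] exI[of _ z]) auto
  qed
  with that show thesis by blast
qed

lemma root_support: "\<beta> \<in> \<Phi> \<Longrightarrow> z \<notin> V \<Longrightarrow> \<beta> z = 0"
  by (induction rule: root_system.induct) (auto simp: refl_eq simple_root_def)

lemma root_uminus:
  assumes "\<beta> \<in> \<Phi>"
  shows "(\<lambda>z. - \<beta> z) \<in> \<Phi>"
proof -
  obtain ys y where w: "set ys \<subseteq> V" "y \<in> V" "\<beta> = act V A ys (simple_root y)"
    using root_word[OF assms] .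
  have "(\<lambda>z. - simple_root y z) \<in> \<Phi>"
    using root_system.reflect[OF root_system.simple[OF w(2)] w(2), of A] refl_simple[OF w(2)] by simp
  then show ?thesis using act_root[OF w(1)] act_uminus[OF w(1)] w(3) by metis
qed

lemma root_nonzero:
  assumes "\<beta> \<in> \<Phi>"
  shows "\<exists>z\<in>V. \<beta> z \<noteq> 0"
proof (rule ccontr)
  assume "\<not> ?thesis"
  with root_support[OF assms] have 0: "\<beta> = (\<lambda>z. 0)" by blast
  obtain ys y where w: "set ys \<subseteq> V" "y \<in> V" "\<beta> = act V A ys (simple_root y)"
    using root_word[OF assms] .
  have "simple_root y = act V A (rev ys) \<beta>" using w by simp
  also have "\<dots> = (\<lambda>z. 0)"
    using act_lincomb[of "rev ys" 0 \<beta> 0 \<beta>] w(1) unfolding 0 by simp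
  finally have "simple_root y y = (0::int)" by metis
  then show False by (simp add: simple_root_def)
qed

text \<open>Applying the first letter \<open>t\<close> gives \<alpha>_s - \<open>A t s\<close>
  \<alpha>_t, and on \<alpha>_s the next letter \<open>s\<close> only produces a sign, which
  shortens the word by two. The roles of \<open>s\<close> and \<open>t\<close> alternate, so the
  recurrence couples the sequences that start from \<alpha>_s and from \<alpha>_t.\<close>

lemma dihedral_recurrence:
  assumes st: "s \<in> V" "t \<in> V"
  shows "act V A (alternating s t (Suc (Suc k))) (simple_root s) z =
    - A t s * act V A (alternating t s (Suc k)) (simple_root t) z - act V A (alternating s t k) (simple_root s) z"
proof -
  have sub: "set (alternating t s (Suc k)) \<subseteq> V" "set (alternating s t k) \<subseteq> V"
    using set_alternating[of t s "Suc k"] set_alternating[of s t k] st by blast+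
  have "act V A (alternating s t (Suc (Suc k))) (simple_root s) =
    act V A (alternating t s (Suc k)) (simple_reflection V A t (simple_root s))" by simp
  also have "simple_reflection V A t (simple_root s) = (\<lambda>z. - A t s * simple_root t z + 1 * simple_root s z)"
    using st by (simp add: refl_eq cform_simple algebra_simps)
  also have "act V A (alternating t s (Suc k)) \<dots> =
     (\<lambda>z. - A t s * act V A (alternating t s (Suc k)) (simple_root t) z
        + 1 * act V A (alternating t s (Suc k)) (simple_root s) z)"
    by (rule act_lincomb[OF sub(1)])
  also have "act V A (alternating t s (Suc k)) (simple_root s) = act V A (alternating s t k) (\<lambda>z. - simple_root s z)"
    by (simp add: refl_simple[OF st(1)])
  also have "\<dots> = (\<lambda>z. - act V A (alternating s t k) (simple_root s) z)"
    by (rule act_uminus[OF sub(2)])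
  finally show ?thesis by (simp only: mult_1 diff_conv_add_uminus)
qed

lemma dihedral_Suc_0:
  assumes st: "s \<in> V" "t \<in> V"
  shows "act V A (alternating s t (Suc 0)) (simple_root s) z = simple_root s z - A t s * simple_root t z"
  using st by (simp add: refl_eq cform_simple)

lemma dihedral_support:
  assumes st: "s \<in> V" "t \<in> V" "s \<noteq> t"
  shows "act V A (alternating s t k) (simple_root s) =
    (\<lambda>z. act V A (alternating s t k) (simple_root s) s * simple_root s z
       + act V A (alternating s t k) (simple_root s) t * simple_root t z)"
proof -
  have "set w \<subseteq> {s, t} \<Longrightarrow> z \<notin> {s, t} \<Longrightarrow> act V A w (simple_root s) z = 0" for w z
    using st by (induction w) (auto simp: refl_eq simple_root_def)
  from this[OF set_alternating] st(3) show ?thesis by (auto simp: simple_root_def fun_eq_iff)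
qed

lemma dihedral_infinite:
  assumes st: "s \<in> V" "t \<in> V" "s \<noteq> t" and 4: "A s t * A t s \<ge> 4"
  shows "nonneg (act V A (alternating s t k) (simple_root s))"
proof -
  define R where "R k = act V A (alternating s t k) (simple_root s)" for k
  define R' where "R' k = act V A (alternating t s k) (simple_root t)" for k
  define a where "a = - A s t"
  define b where "b = - A t s"
  have a: "0 \<le> a" and b: "0 \<le> b" and ab: "4 \<le> a * b" using st offdiag 4 by (auto simp: a_def b_def)
  have R: "R (Suc (Suc k)) z = b * R' (Suc k) z - R k z" for k z
    unfolding R_def R'_def b_def by (rule dihedral_recurrence[OF st(1,2)])
  have R': "R' (Suc (Suc k)) z = a * R (Suc k) z - R' k z" for k z
    unfolding R_def R'_def a_def by (rule dihedral_recurrence[OF st(2,1)])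
  have R1: "R (Suc 0) z = simple_root s z + b * simple_root t z"
    and R1': "R' (Suc 0) z = simple_root t z + a * simple_root s z" for z
    using dihedral_Suc_0[OF st(1,2)] dihedral_Suc_0[OF st(2,1)] by (auto simp: R_def R'_def a_def b_def)
  have sr: "0 \<le> simple_root w z" for w z :: 'v by (simp add: simple_root_def)
  \<comment> \<open>Nonnegativity alone is not inductive, because the recurrence subtracts. The two
    extra inequalities keep the subtracted term at most half of the other; multiplied by
    \<open>a\<close> or \<open>b\<close>, and with 4 \<le> ab, they reproduce themselves at the next
    index.\<close>
  have "0 \<le> R k z \<and> 0 \<le> R' k z \<and> b * R' k z \<le> 2 * R (Suc k) z \<and> a * R k z \<le> 2 * R' (Suc k) z" for k z
  proof (induction k)
    case 0
    have "R 0 z = simple_root s z" "R' 0 z = simple_root t z" by (auto simp: R_def R'_def)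
    moreover have "0 \<le> b * simple_root t z" "0 \<le> a * simple_root s z" using a b sr by auto
    ultimately show ?case using sr[of s z] sr[of t z] by (simp add: R1 R1')
  next
    case (Suc k)
    have n: "0 \<le> b * R' k z" "0 \<le> a * R k z" using Suc a b by auto
    then have n1: "0 \<le> R (Suc k) z" "0 \<le> R' (Suc k) z" using Suc by linarith+
    have "b * (a * R k z) \<le> b * (2 * R' (Suc k) z)" "a * (b * R' k z) \<le> a * (2 * R (Suc k) z)"
      using Suc a b by (auto intro: mult_left_mono)
    moreover have "4 * R k z \<le> a * b * R k z" "4 * R' k z \<le> a * b * R' k z"
      using Suc ab by (auto intro: mult_right_mono)
    ultimately have "2 * R k z \<le> b * R' (Suc k) z" "2 * R' k z \<le> a * R (Suc k) z"
      by (simp_all add: algebra_simps)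
    then show ?case using n1 by (simp add: R R')
  qed
  then show ?thesis unfolding nonneg_def R_def by blast
qed

text \<open>If the product of the off-diagonal entries is at least 4, positivity never fails.
  Otherwise the product is 0, 1, 2 or 3 and there is a braid relation of length m = 2, 3, 4 or 6:
  the roots are nonnegative for k < m, and for k \<ge> m the braid relation is the second
  alternative.\<close>

lemma dihedral_cases:
  assumes st: "s \<in> V" "t \<in> V" "s \<noteq> t"
  shows "nonneg (act V A (alternating s t k) (simple_root s)) \<or>
    (\<exists>j>0. j \<le> k \<and> act V A (alternating s t j) = act V A (alternating t s j))"
proof (cases "A s t * A t s \<ge> 4")
  case True
  then show ?thesis using dihedral_infinite[OF st] by blast
next
  case False
  define a where "a = A s t"
  define b where "b = A t s"
  have a: "a \<le> 0" and b: "b \<le> 0" and 0: "a = 0 \<longleftrightarrow> b = 0" and ab: "a * b < 4"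
    using st offdiag zero_sym False by (auto simp: a_def b_def)
  \<comment> \<open>Integrality leaves only the types A1 x A1, A2, B2 and G2, up to exchanging the
    two letters.\<close>
  have cases: "(a = 0 \<and> b = 0) \<or> (a = -1 \<and> b = -1) \<or> (a = -1 \<and> b = -2) \<or> (a = -2 \<and> b = -1)
    \<or> (a = -1 \<and> b = -3) \<or> (a = -3 \<and> b = -1)"
  proof (cases "a = 0")
    case False
    with 0 a b have a1: "1 \<le> -a" and b1: "1 \<le> -b" by auto
    have "-a * 1 \<le> -a * -b" by (rule mult_left_mono) (use a1 b1 in auto)
    moreover have "1 * -b \<le> -a * -b" by (rule mult_right_mono) (use a1 b1 in auto)
    ultimately have "a = -1 \<or> a = -2 \<or> a = -3" "b = -1 \<or> b = -2 \<or> b = -3" using ab a1 b1 by auto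
    then show ?thesis using ab by auto
  qed (use 0 in auto)
  have refl: "simple_reflection V A s f = (\<lambda>z. f z - \<phi> s f * simple_root s z)"
    "simple_reflection V A t f = (\<lambda>z. f z - \<phi> t f * simple_root t z)" for f
    using st by (auto simp: refl_eq)
  have phi: "\<phi> s (\<lambda>z. f z - c * simple_root s z) = \<phi> s f - 2 * c"
    "\<phi> s (\<lambda>z. f z - c * simple_root t z) = \<phi> s f - c * a"
    "\<phi> t (\<lambda>z. f z - c * simple_root s z) = \<phi> t f - c * b"
    "\<phi> t (\<lambda>z. f z - c * simple_root t z) = \<phi> t f - 2 * c" for f c
    using st by (auto simp: cform_sub cform_simple diag a_def b_def)
  \<comment> \<open>Both reflections preserve vectors of the shape f - p \<alpha>_s - q \<alpha>_t,
    so a word is tracked by the pair (p, q) alone; the braid relations are checked from p = q =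
    0.\<close>
  have step: "simple_reflection V A s (\<lambda>z. f z - p * simple_root s z - q * simple_root t z)
      = (\<lambda>z. f z - (\<phi> s f - p - a * q) * simple_root s z - q * simple_root t z)"
    "simple_reflection V A t (\<lambda>z. f z - p * simple_root s z - q * simple_root t z)
      = (\<lambda>z. f z - p * simple_root s z - (\<phi> t f - q - b * p) * simple_root t z)" for f p q
    unfolding refl phi by (auto simp: fun_eq_iff algebra_simps)
  have braid: "act V A (alternating s t m) = act V A (alternating t s m)"
    if "\<And>f z. act V A (alternating s t m) (\<lambda>z. f z - 0 * simple_root s z - 0 * simple_root t z) z
      = act V A (alternating t s m) (\<lambda>z. f z - 0 * simple_root s z - 0 * simple_root t z) z" for m
    using that by (simp add: fun_eq_iff)
  have phi0: "\<phi> s (simple_root s) = 2" "\<phi> s (simple_root t) = a"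
    "\<phi> t (simple_root s) = b" "\<phi> t (simple_root t) = 2"
    using st by (auto simp: cform_simple diag a_def b_def)
  have sr: "0 \<le> (simple_root w z :: int)" for w z :: 'v
    by (simp add: simple_root_def)
  define R where "R k = act V A (alternating s t k) (simple_root s)" for k
  \<comment> \<open>Six entries suffice, since the closed forms are used only for k < m \<le>
    6.\<close>
  have comp: "R 0 z = simple_root s z"
    "R (Suc 0) z = simple_root s z - b * simple_root t z"
    "R (Suc (Suc 0)) z = (a * b - 1) * simple_root s z - b * simple_root t z"
    "R (Suc (Suc (Suc 0))) z = (a * b - 1) * simple_root s z - b * (a * b - 2) * simple_root t z"
    "R (Suc (Suc (Suc (Suc 0)))) z = (a * b * (a * b - 2) - (a * b - 1)) * simple_root s z - b * (a * b - 2) * simple_root t z"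
    "R (Suc (Suc (Suc (Suc (Suc 0))))) z = (a * b * (a * b - 2) - (a * b - 1)) * simple_root s z
       - b * (a * b * (a * b - 2) - (a * b - 1) - (a * b - 2)) * simple_root t z"
    for z
    unfolding R_def by (simp_all only: alternating.simps append.simps foldr.simps o_apply id_apply refl phi phi0)
      (simp_all add: algebra_simps)
  consider (2) "a = 0" "b = 0" | (3) "a = -1" "b = -1" | (4) "a = -1 \<and> b = -2 \<or> a = -2 \<and> b = -1"
    | (6) "a = -1 \<and> b = -3 \<or> a = -3 \<and> b = -1" using cases by blast
  then obtain m where m: "m > 0" "act V A (alternating s t m) = act V A (alternating t s m)"
    "\<And>k. k < m \<Longrightarrow> nonneg (R k)"
  proof cases
    case 2
    show ?thesis
    proof (rule that[of "Suc (Suc 0)"])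
      show "act V A (alternating s t (Suc (Suc 0))) = act V A (alternating t s (Suc (Suc 0)))"
        by (rule braid, simp only: alternating.simps append.simps foldr.simps o_apply id_apply step)
          (simp add: 2 algebra_simps)
      show "nonneg (R k)" if "k < Suc (Suc 0)" for k
        using that sr 2 by (auto simp: less_Suc_eq nonneg_def comp intro!: add_nonneg_nonneg)
    qed simp
  next
    case 3
    show ?thesis
    proof (rule that[of "Suc (Suc (Suc 0))"])
      show "act V A (alternating s t (Suc (Suc (Suc 0)))) = act V A (alternating t s (Suc (Suc (Suc 0))))"
        by (rule braid, simp only: alternating.simps append.simps foldr.simps o_apply id_apply step)
          (simp add: 3 algebra_simps)
      show "nonneg (R k)" if "k < Suc (Suc (Suc 0))" for k
        using that sr 3 by (auto simp: less_Suc_eq nonneg_def comp intro!: add_nonneg_nonneg)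
    qed simp
  next
    case 4
    show ?thesis
    proof (rule that[of "Suc (Suc (Suc (Suc 0)))"])
      show "act V A (alternating s t (Suc (Suc (Suc (Suc 0))))) = act V A (alternating t s (Suc (Suc (Suc (Suc 0)))))"
        using 4 by (intro braid, simp only: alternating.simps append.simps foldr.simps o_apply id_apply step)
          (elim disjE; simp add: algebra_simps)
      show "nonneg (R k)" if "k < Suc (Suc (Suc (Suc 0)))" for k
        using 4 that sr by (elim disjE; auto simp: less_Suc_eq nonneg_def comp intro!: add_nonneg_nonneg)
    qed simp
  next
    case 6
    show ?thesis
    proof (rule that[of "Suc (Suc (Suc (Suc (Suc (Suc 0)))))"])
      show "act V A (alternating s t (Suc (Suc (Suc (Suc (Suc (Suc 0))))))) = act V A (alternating t s (Suc (Suc (Suc (Suc (Suc (Suc 0)))))))"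
        using 6 by (intro braid, simp only: alternating.simps append.simps foldr.simps o_apply id_apply step)
          (elim disjE; simp add: algebra_simps)
      show "nonneg (R k)" if "k < Suc (Suc (Suc (Suc (Suc (Suc 0)))))" for k
        using 6 that sr by (elim disjE; auto simp: less_Suc_eq nonneg_def comp intro!: add_nonneg_nonneg)
    qed simp
  qed
  then show ?thesis unfolding R_def by (cases "k < m") auto
qed

text \<open>Length means the least length of a word with a given action. The hypotheses say that
  \<open>ys\<close> is shortest and that appending \<open>s\<close> does not shorten it. Factor
  \<open>ys\<close> as v u, with u in the letter \<open>s\<close> and the last letter t of
  \<open>ys\<close>, and v as short as possible: by induction v keeps \<alpha>_s and \<alpha>_t
  nonnegative, while u is alternating and sends \<alpha>_s to a nonnegative combination of the
  two.\<close>

lemma nonneg_word: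
  assumes "set ys \<subseteq> V" "s \<in> V"
    and "\<And>zs. set zs \<subseteq> V \<Longrightarrow> act V A zs = act V A ys \<Longrightarrow> length ys \<le> length zs"
    and "\<And>zs. set zs \<subseteq> V \<Longrightarrow> act V A zs = act V A (ys @ [s]) \<Longrightarrow> length ys \<le> length zs"
  shows "nonneg (act V A ys (simple_root s))"
  using assms
proof (induction "length ys" arbitrary: ys s rule: less_induct)
  case less
  show ?case
  proof (cases ys rule: rev_cases)
    case Nil
    then show ?thesis by (simp add: nonneg_def simple_root_def)
  next
    case (snoc ys' t)
    have t: "t \<in> V" and ys': "set ys' \<subseteq> V" using less.prems(1) snoc by auto
    have st: "s \<noteq> t"
    proof
      assume "s = t"
      then have "act V A ys' = act V A (ys @ [s])" using t snoc by (auto simp: fun_eq_iff)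
      then have "length ys \<le> length ys'" by (intro less.prems(4)) (use ys' in simp_all)
      then show False using snoc by simp
    qed
    \<comment> \<open>Factorizations without loss of length; minimizing \<open>length v\<close>
      picks a shortest representative of the coset modulo the rank 2 subgroup.\<close>
    define P where "P v u \<longleftrightarrow> set v \<subseteq> V \<and> set u \<subseteq> {s, t} \<and> act V A (v @ u) = act V A ys \<and> length v + length u = length ys"
      for v u
    have "P ys' [t]" using ys' snoc unfolding P_def by simp
    then obtain v where "\<exists>u. P v u" and min': "\<forall>v'. (\<exists>u. P v' u) \<longrightarrow> length v \<le> length v'"
      using ex_has_least_nat[of "\<lambda>v. \<exists>u. P v u" ys' length] by blast
    then obtain u where vu: "P v u" by blast
    have min: "length v \<le> length v'" if "P v' u'" for v' u'
      using min' that by blast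
    have v: "set v \<subseteq> V" and u: "set u \<subseteq> {s, t}" and act_vu: "act V A (v @ u) = act V A ys"
      and len: "length v + length u = length ys" using vu unfolding P_def by blast+
    have uV: "set u \<subseteq> V" using u less.prems(2) t by auto
    have vlen: "length v < length ys" using min[OF \<open>P ys' [t]\<close>] snoc by simp
    have vred: "length v \<le> length zs" if "set zs \<subseteq> V" "act V A zs = act V A v" for zs
    proof -
      have "act V A (zs @ u) f = act V A ys f" for f using that(2) fun_cong[OF act_vu, of f] by simp
      then have "act V A (zs @ u) = act V A ys" by blast
      then have "length ys \<le> length (zs @ u)" by (intro less.prems(3)) (use that uV in simp_all)
      then show ?thesis using len by simp
    qed
    \<comment> \<open>If appending r shortened v, moving r into the rank 2 factor would give a
      factorization with a smaller first factor.\<close>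
    have vr: "length v \<le> length zs" if "set zs \<subseteq> V" "act V A zs = act V A (v @ [r])" "r \<in> {s, t}" for zs r
    proof (rule ccontr)
      assume less': "\<not> length v \<le> length zs"
      have r: "r \<in> V" using that less.prems(2) t by auto
      have "act V A (zs @ [r]) f = act V A v f" for f
        using that(2) r by (auto simp: fun_eq_iff)
      then have zr: "act V A (zs @ [r]) = act V A v" by blast
      then have "length v \<le> length (zs @ [r])" by (intro vred) (use that(1) r in simp_all)
      with less' have "length zs + 1 = length v" by simp
      moreover have "act V A (zs @ r # u) f = act V A (v @ u) f" for f
        using fun_cong[OF zr, of "act V A u f"] by simp
      ultimately have "P zs (r # u)" using that u len act_vu unfolding P_def by auto
      from min[OF this] less' show False by simp
    qed
    have IH: "nonneg (act V A v (simple_root r))" if "r \<in> {s, t}" for r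
      proof (rule less.hyps[OF vlen v])
      show "r \<in> V" using that less.prems(2) t by blast
    qed (use vred vr that in blast)+
    have adj: "u \<noteq> a @ [c, c] @ b" for a b c
    proof
      assume e: "u = a @ [c, c] @ b"
      then have "c \<in> V" using uV by auto
      then have "act V A (v @ a @ b) = act V A ys" unfolding act_vu[symmetric] e by (intro ext) simp
      then have "length ys \<le> length (v @ a @ b)" by (rule less.prems(3)[rotated]) (use v uV e in simp)
      then show False using len e by simp
    qed
    have lst: "last u = t" if "u \<noteq> []"
    proof (rule ccontr)
      assume "last u \<noteq> t"
      then have "last u = s" using u last_in_set[OF that] by auto
      then have "u = butlast u @ [s]" using append_butlast_last_id[OF that] by metis
      then obtain u' where u': "u = u' @ [s]" by blast
      have "act V A (v @ u') f = act V A (ys @ [s]) f" for f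
        using fun_cong[OF act_vu, of "simple_reflection V A s f"] less.prems(2) u' by simp
      then have "length ys \<le> length (v @ u')" by (intro less.prems(4) ext) (use v uV u' in simp_all)
      then show False using len u' by simp
    qed
    have ualt: "u = alternating s t (length u)" using alternating_eqI[OF u lst adj] .
    \<comment> \<open>A braid relation inside u would let u end in \<open>s\<close> instead of
      \<open>t\<close>; that \<open>s\<close> cancels against the one appended to \<open>ys\<close>,
      which contradicts the second minimality hypothesis.\<close>
    have "\<not> (\<exists>j>0. j \<le> length u \<and> act V A (alternating s t j) = act V A (alternating t s j))"
    proof
      assume "\<exists>j>0. j \<le> length u \<and> act V A (alternating s t j) = act V A (alternating t s j)"
      then obtain j where j: "j > 0" "j \<le> length u" "act V A (alternating s t j) = act V A (alternating t s j)" by blast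
      obtain w where w: "u = w @ alternating s t j" "set w \<subseteq> {s, t}"
        using alternating_suffix[OF j(2), of s t] unfolding ualt[symmetric] by blast
      obtain i where i: "j = Suc i" using j(1) by (cases j) auto
      let ?z = "v @ w @ alternating s t i"
      have "act V A ?z = act V A (ys @ [s])"
      proof
        fix f
        have "act V A (ys @ [s]) f = act V A (v @ u) (simple_reflection V A s f)" using act_vu by simp
        also have "\<dots> = act V A (v @ w) (act V A (alternating s t j) (simple_reflection V A s f))" using w by simp
        also have "\<dots> = act V A (v @ w) (act V A (alternating t s j) (simple_reflection V A s f))" using j(3) by simp
        also have "\<dots> = act V A ?z f" using less.prems(2) i by simp
        finally show "act V A ?z f = act V A (ys @ [s]) f" ..
      qed
      moreover have "set ?z \<subseteq> V" using v w(2) set_alternating[of s t i] less.prems(2) t by auto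
      ultimately have "length ys \<le> length ?z" by (intro less.prems(4)) blast+
      then show False using len w(1) i by simp
    qed
    then have pos: "nonneg (act V A u (simple_root s))"
      using dihedral_cases[OF less.prems(2) t st, of "length u"] unfolding ualt[symmetric] by blast
    define p where "p = act V A u (simple_root s) s"
    define q where "q = act V A u (simple_root s) t"
    have "act V A u (simple_root s) = (\<lambda>z. p * simple_root s z + q * simple_root t z)"
      using dihedral_support[OF less.prems(2) t st, of "length u"] unfolding ualt[symmetric] p_def q_def .
    then have "act V A ys (simple_root s) = act V A v (\<lambda>z. p * simple_root s z + q * simple_root t z)"
      using fun_cong[OF act_vu, of "simple_root s"] by simp
    also have "\<dots> = (\<lambda>z. p * act V A v (simple_root s) z + q * act V A v (simple_root t) z)"
      by (rule act_lincomb[OF v])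
    finally show ?thesis using IH[of s] IH[of t] pos by (simp add: nonneg_def p_def q_def)
  qed
qed

section \<open>The sign theorem for arbitrary roots\<close>

lemma shortest_word:
  assumes "set ys0 \<subseteq> V"
  obtains ys where "set ys \<subseteq> V" "act V A ys = act V A ys0"
    "\<forall>zs. set zs \<subseteq> V \<longrightarrow> act V A zs = act V A ys0 \<longrightarrow> length ys \<le> length zs"
proof -
  define P where "P ys \<longleftrightarrow> set ys \<subseteq> V \<and> act V A ys = act V A ys0" for ys
  have "P ys0" unfolding P_def using assms by blast
  then obtain ys where ys: "P ys" "\<forall>zs. P zs \<longrightarrow> length ys \<le> length zs"
    using ex_has_least_nat[of P ys0 length] by blast
  show thesis
  proof (rule that[of ys])
    show "set ys \<subseteq> V" "act V A ys = act V A ys0" using ys(1) unfolding P_def by blast+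
    show "\<forall>zs. set zs \<subseteq> V \<longrightarrow> act V A zs = act V A ys0 \<longrightarrow> length ys \<le> length zs"
      using ys(2) unfolding P_def by blast
  qed
qed

text \<open>Write the root as w(\<alpha>_s) and compare shortest words for w and for ws. If the one
  for w is not longer, \<open>nonneg_word\<close> applies to it; otherwise it applies to the one for
  ws, and w(\<alpha>_s) is the negative of (ws)(\<alpha>_s).\<close>

theorem root_sign:
  assumes "\<beta> \<in> \<Phi>"
  shows "nonneg \<beta> \<or> nonpos \<beta>"
proof -
  obtain ys0 s where w: "set ys0 \<subseteq> V" "s \<in> V" "\<beta> = act V A ys0 (simple_root s)"
    using root_word[OF assms] .
  obtain ys where ys: "set ys \<subseteq> V" "act V A ys = act V A ys0"
    "\<forall>zs. set zs \<subseteq> V \<longrightarrow> act V A zs = act V A ys0 \<longrightarrow> length ys \<le> length zs"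
    by (rule shortest_word[OF w(1)])
  have \<beta>: "\<beta> = act V A ys (simple_root s)" using w(3) ys(2) by simp
  have "set (ys @ [s]) \<subseteq> V" using ys(1) w(2) by simp
  then obtain zs where zs: "set zs \<subseteq> V" "act V A zs = act V A (ys @ [s])"
    "\<forall>us. set us \<subseteq> V \<longrightarrow> act V A us = act V A (ys @ [s]) \<longrightarrow> length zs \<le> length us"
    by (rule shortest_word)
  show ?thesis
  proof (cases "length ys \<le> length zs")
    case True
    have "nonneg \<beta>" unfolding \<beta>
    proof (rule nonneg_word[OF ys(1) w(2)])
      show "length ys \<le> length us" if "set us \<subseteq> V" "act V A us = act V A ys" for us
        by (rule ys(3)[rule_format, OF that(1)]) (simp only: that(2) ys(2))
      show "length ys \<le> length us" if "set us \<subseteq> V" "act V A us = act V A (ys @ [s])" for us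
        using zs(3)[rule_format, OF that] True by linarith
    qed
    then show ?thesis ..
  next
    case False
    have zs_s: "act V A (zs @ [s]) f = act V A ys f" for f using fun_cong[OF zs(2)] w(2) by simp
    have "nonneg (act V A zs (simple_root s))"
    proof (rule nonneg_word[OF zs(1) w(2)])
      show "length zs \<le> length us" if "set us \<subseteq> V" "act V A us = act V A zs" for us
        by (rule zs(3)[rule_format, OF that(1)]) (simp only: that(2) zs(2))
      show "length zs \<le> length us" if "set us \<subseteq> V" "act V A us = act V A (zs @ [s])" for us
      proof -
        have "act V A us = act V A ys0" by (intro ext) (simp only: that(2) zs_s ys(2))
        then show ?thesis using ys(3)[rule_format, OF that(1)] False by linarith
      qed
    qed
    moreover have "\<beta> = (\<lambda>z. - act V A zs (simple_root s) z)"
      unfolding \<beta> zs_s[symmetric] using act_uminus[OF zs(1)] w(2) by (simp add: refl_simple)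
    ultimately show ?thesis by (simp add: nonneg_def nonpos_def)
  qed
qed

end

section \<open>Reflections and inversions\<close>

text \<open>The conjugated simple reflection may a priori depend on the word that leads to \<beta>,
  hence the choice. Its values on roots are independent of the word by
  \<open>reflection_unique\<close>.\<close>

definition root_reflection :: "'v set \<Rightarrow> ('v \<Rightarrow> 'v \<Rightarrow> int) \<Rightarrow> ('v \<Rightarrow> int) \<Rightarrow> ('v \<Rightarrow> int) \<Rightarrow> 'v \<Rightarrow> int" where
  "root_reflection V A \<beta> = (SOME t. \<exists>ys y. set ys \<subseteq> V \<and> y \<in> V \<and> \<beta> = act V A ys (simple_root y) \<and>
     t = act V A (ys @ y # rev ys))"

text \<open>The root \<beta> is excluded because its own reflection always negates it, whereas a
  fracture needs a second hyperplane.\<close>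

definition inversions :: "'v set \<Rightarrow> ('v \<Rightarrow> 'v \<Rightarrow> int) \<Rightarrow> ('v \<Rightarrow> int) \<Rightarrow> ('v \<Rightarrow> int) set" where
  "inversions V A \<beta> = {\<gamma> \<in> root_system V A. nonneg \<gamma> \<and> \<gamma> \<noteq> \<beta> \<and> nonpos (root_reflection V A \<beta> \<gamma>)}"

context gcm
begin

text \<open>Moving the multiple back to a simple root shows that c divides the coordinate 1 of that
  root.\<close>

lemma root_multiple:
  assumes "\<beta> \<in> \<Phi>" "(\<lambda>z. c * \<beta> z) \<in> \<Phi>"
  shows "c = 1 \<or> c = - 1"
proof -
  obtain ys y where w: "set ys \<subseteq> V" "y \<in> V" "(\<lambda>z. c * \<beta> z) = act V A ys (simple_root y)"
    using root_word[OF assms(2)] .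
  have "simple_root y = act V A (rev ys) (\<lambda>z. c * \<beta> z)" using w by simp
  also have "\<dots> = (\<lambda>z. c * act V A (rev ys) \<beta> z)"
    using act_lincomb[of "rev ys" c \<beta> 0 \<beta>] w(1) by simp
  finally have "simple_root y y = c * act V A (rev ys) \<beta> y" by metis
  then have "c * act V A (rev ys) \<beta> y = 1" by (simp add: simple_root_def)
  then show ?thesis by (auto simp: zmult_eq_1_iff)
qed

text \<open>Proportionality is expressed by vanishing minors, which avoids rational factors. After
  \<beta> is moved to a simple root, the other root has a single nonzero coordinate and
  \<open>root_multiple\<close> applies.\<close>

lemma proportional_roots:
  assumes "\<beta> \<in> \<Phi>" "\<gamma> \<in> \<Phi>" and pr: "\<And>z w. \<gamma> z * \<beta> w = \<gamma> w * \<beta> z"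
  shows "\<gamma> = \<beta> \<or> \<gamma> = (\<lambda>z. - \<beta> z)"
proof -
  obtain ys y where w: "set ys \<subseteq> V" "y \<in> V" "\<beta> = act V A ys (simple_root y)"
    using root_word[OF assms(1)] .
  obtain v where v: "\<beta> v \<noteq> 0" using root_nonzero[OF assms(1)] by blast
  define u where "u = act V A (rev ys) \<gamma>"
  have "(\<lambda>z. \<beta> v * \<gamma> z - \<gamma> v * \<beta> z) = (\<lambda>z. 0)" using pr by (auto simp: algebra_simps)
  then have "act V A (rev ys) (\<lambda>z. \<beta> v * \<gamma> z + (- \<gamma> v) * \<beta> z) = act V A (rev ys) (\<lambda>z. 0)" by simp
  moreover have "act V A (rev ys) (\<lambda>z. 0) = (\<lambda>z. 0)"
    using act_lincomb[of "rev ys" 0 \<beta> 0 \<beta>] w(1) by simp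
  moreover have "act V A (rev ys) (\<lambda>z. \<beta> v * \<gamma> z + (- \<gamma> v) * \<beta> z) = (\<lambda>z. \<beta> v * u z + (- \<gamma> v) * simple_root y z)"
    using act_lincomb[of "rev ys" "\<beta> v" \<gamma> "- \<gamma> v" \<beta>] w by (simp add: u_def)
  ultimately have e: "\<beta> v * u z = \<gamma> v * simple_root y z" for z by (auto simp: fun_eq_iff)
  have "u z = u y * simple_root y z" for z
    using e[of z] v by (cases "z = y") (auto simp: simple_root_def)
  then have uy: "u = (\<lambda>z. u y * simple_root y z)" by blast
  have "u \<in> \<Phi>" unfolding u_def using act_root[of "rev ys" \<gamma>] w(1) assms(2) by simp
  then have "u y = 1 \<or> u y = -1"
    using root_multiple[OF root_system.simple[OF w(2)], of "u y"] uy by metis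
  moreover have "\<gamma> = act V A ys u" unfolding u_def using w(1) by simp
  then have "\<gamma> = (\<lambda>z. u y * \<beta> z)"
    using act_lincomb[OF w(1), of "u y" "simple_root y" 0 "simple_root y"] w(3) uy by (metis (no_types, lifting) add_0_right ext mult_zero_left)
  ultimately show ?thesis by auto
qed

lemma nonneg_nonpos_root: "\<gamma> \<in> \<Phi> \<Longrightarrow> nonneg \<gamma> \<Longrightarrow> nonpos \<gamma> \<Longrightarrow> False"
  using root_nonzero[of \<gamma>] unfolding nonneg_def nonpos_def by (meson order_antisym)

text \<open>Only the coordinate at \<open>y\<close> changes. Were the result nonpositive, all other
  coordinates of \<gamma> would vanish, leaving a positive multiple of a simple root.\<close>

lemma nonneg_refl:
  assumes "\<gamma> \<in> \<Phi>" "nonneg \<gamma>" "y \<in> V" "\<gamma> \<noteq> simple_root y"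
  shows "nonneg (simple_reflection V A y \<gamma>)"
proof (rule ccontr)
  assume "\<not> ?thesis"
  then have np: "nonpos (simple_reflection V A y \<gamma>)"
    using root_sign root_system.reflect[OF assms(1,3)] by blast
  have "\<gamma> z = 0" if "z \<noteq> y" for z
    using np assms(2,3) that unfolding nonneg_def nonpos_def
    by (auto simp: refl_eq simple_root_def dest!: spec[of _ z])
  then have e: "\<gamma> = (\<lambda>z. \<gamma> y * simple_root y z)" by (auto simp: simple_root_def)
  then have "\<gamma> y = 1 \<or> \<gamma> y = -1" using root_multiple[OF root_system.simple[OF assms(3)], of "\<gamma> y"] assms(1) by metis
  moreover have "0 \<le> \<gamma> y" using assms(2) by (simp add: nonneg_def)
  ultimately have "\<gamma> y = 1" by auto
  with e assms(4) show False by auto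
qed

lemma reflection_word:
  assumes "set ys \<subseteq> V" "y \<in> V"
  shows "act V A (ys @ y # rev ys) f = (\<lambda>z. f z - \<phi> y (act V A (rev ys) f) * act V A ys (simple_root y) z)"
proof -
  have "act V A (ys @ y # rev ys) f = act V A ys (\<lambda>z. act V A (rev ys) f z - \<phi> y (act V A (rev ys) f) * simple_root y z)"
    using assms by (simp add: refl_eq)
  also have "\<dots> = (\<lambda>z. f z - \<phi> y (act V A (rev ys) f) * act V A ys (simple_root y) z)"
    using act_sub[OF assms(1)] assms(1) by simp
  finally show ?thesis .
qed

text \<open>Two reflections in the same root differ on \<gamma> by a multiple c\<beta>, and their
  products translate \<gamma> by all integer multiples of c\<beta>. For c \<noteq> 0 this string of
  roots is unbounded in both directions, which by the sign theorem forces \<gamma> to be a multiple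
  of \<beta>; but on multiples of \<beta> both reflections are the negation.\<close>

lemma reflection_unique:
  assumes ys: "set ys \<subseteq> V" "y \<in> V" and zs: "set zs \<subseteq> V" "z \<in> V"
    and eq: "act V A ys (simple_root y) = act V A zs (simple_root z)" and \<gamma>: "\<gamma> \<in> \<Phi>"
  shows "act V A (ys @ y # rev ys) \<gamma> = act V A (zs @ z # rev zs) \<gamma>"
proof -
  define \<beta> where "\<beta> = act V A ys (simple_root y)"
  define \<kappa> where "\<kappa> f = \<phi> y (act V A (rev ys) f)" for f
  define \<kappa>' where "\<kappa>' f = \<phi> z (act V A (rev zs) f)" for f
  have \<kappa>\<beta>: "\<kappa> \<beta> = 2" "\<kappa>' \<beta> = 2"
    unfolding \<kappa>_def \<kappa>'_def using ys zs by (simp add: \<beta>_def cform_simple diag, simp add: \<beta>_def eq cform_simple diag)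
  have lin: "\<kappa> (\<lambda>z. f z + c * \<beta> z) = \<kappa> f + 2 * c" "\<kappa>' (\<lambda>z. f z + c * \<beta> z) = \<kappa>' f + 2 * c" for f c
  proof -
    have "act V A (rev ys) (\<lambda>z. 1 * f z + c * \<beta> z) = (\<lambda>z. 1 * act V A (rev ys) f z + c * act V A (rev ys) \<beta> z)"
      by (rule act_lincomb) (use ys in simp)
    then show "\<kappa> (\<lambda>z. f z + c * \<beta> z) = \<kappa> f + 2 * c"
      using \<kappa>\<beta>(1) cform_lincomb[of y 1 _ c] unfolding \<kappa>_def by simp
    have "act V A (rev zs) (\<lambda>z. 1 * f z + c * \<beta> z) = (\<lambda>z. 1 * act V A (rev zs) f z + c * act V A (rev zs) \<beta> z)"
      by (rule act_lincomb) (use zs in simp)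
    then show "\<kappa>' (\<lambda>z. f z + c * \<beta> z) = \<kappa>' f + 2 * c"
      using \<kappa>\<beta>(2) cform_lincomb[of z 1 _ c] unfolding \<kappa>'_def by simp
  qed
  have t: "act V A (ys @ y # rev ys) f = (\<lambda>w. f w + (- \<kappa> f) * \<beta> w)" for f
    using reflection_word[OF ys] by (simp add: \<kappa>_def \<beta>_def)
  have t': "act V A (zs @ z # rev zs) f = (\<lambda>w. f w + (- \<kappa>' f) * \<beta> w)" for f
    using reflection_word[OF zs] by (simp add: \<kappa>'_def \<beta>_def eq)
  have tt': "(\<lambda>w. f w + (\<kappa>' f - \<kappa> f) * \<beta> w) \<in> \<Phi>" "(\<lambda>w. f w + (\<kappa> f - \<kappa>' f) * \<beta> w) \<in> \<Phi>" if "f \<in> \<Phi>" for f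
  proof -
    have "act V A (ys @ y # rev ys) (act V A (zs @ z # rev zs) f) \<in> \<Phi>"
      "act V A (zs @ z # rev zs) (act V A (ys @ y # rev ys) f) \<in> \<Phi>"
      by (intro act_root; use ys zs that in simp)+
    then show "(\<lambda>w. f w + (\<kappa>' f - \<kappa> f) * \<beta> w) \<in> \<Phi>" "(\<lambda>w. f w + (\<kappa> f - \<kappa>' f) * \<beta> w) \<in> \<Phi>"
      unfolding t t' lin by (simp_all add: algebra_simps)
  qed
  define c where "c = \<kappa>' \<gamma> - \<kappa> \<gamma>"
  have iter: "(\<lambda>w. \<gamma> w + (int m * c) * \<beta> w) \<in> \<Phi> \<and> (\<lambda>w. \<gamma> w + (- int m * c) * \<beta> w) \<in> \<Phi>" for m
  proof (induction m)
    case 0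
    then show ?case using \<gamma> by simp
  next
    case (Suc m)
    from tt'(1)[OF conjunct1[OF Suc]] tt'(2)[OF conjunct2[OF Suc]]
    show ?case unfolding lin by (simp add: c_def algebra_simps)
  qed
  have "c = 0"
  proof (rule ccontr)
    assume c: "c \<noteq> 0"
    define u where "u = act V A (rev ys) \<gamma>"
    have u: "(\<lambda>w. u w + k * simple_root y w) \<in> \<Phi>" if "(\<lambda>w. \<gamma> w + k * \<beta> w) \<in> \<Phi>" for k
    proof -
      have "act V A (rev ys) (\<lambda>w. 1 * \<gamma> w + k * \<beta> w) = (\<lambda>w. 1 * u w + k * act V A (rev ys) \<beta> w)"
        unfolding u_def by (rule act_lincomb) (use ys in simp)
      moreover have "act V A (rev ys) (\<lambda>w. 1 * \<gamma> w + k * \<beta> w) \<in> \<Phi>"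
        by (rule act_root) (use ys that in simp_all)
      ultimately show ?thesis using ys by (simp add: \<beta>_def)
    qed
    have all: "(\<lambda>w. u w + k * c * simple_root y w) \<in> \<Phi>" for k :: int
    proof (cases "k \<ge> 0")
      case True
      then show ?thesis using u[OF conjunct1[OF iter[of "nat k"]]] by simp
    next
      case False
      then show ?thesis using u[OF conjunct2[OF iter[of "nat (-k)"]]] by simp
    qed
    have u0: "u w = 0" if "w \<noteq> y" for w
    proof (rule ccontr)
      assume "u w \<noteq> 0"
      \<comment> \<open>With this multiple the coordinate at \<open>y\<close> outweighs
        \<open>u y\<close> and gets the sign opposite to \<open>u w\<close>, while the coordinate at
        w \<noteq> \<open>y\<close> does not move.\<close>
      define k where "k = - sgn (u w) * sgn c * (\<bar>u y\<bar> + 1)"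
      have kc: "k * c = - sgn (u w) * \<bar>c\<bar> * (\<bar>u y\<bar> + 1)"
        unfolding k_def by (simp add: abs_sgn)
      define M where "M = \<bar>c\<bar> * (\<bar>u y\<bar> + 1)"
      have big: "\<bar>u y\<bar> + 1 \<le> \<bar>c\<bar> * (\<bar>u y\<bar> + 1)"
        using c mult_right_mono[of 1 "\<bar>c\<bar>" "\<bar>u y\<bar> + 1"] by simp
      have kM: "k * c = - sgn (u w) * M" unfolding kc M_def by simp
      have big': "\<bar>u y\<bar> + 1 \<le> M" using big M_def by simp
      consider "u w > 0" | "u w < 0" using \<open>u w \<noteq> 0\<close> by linarith
      then have "u w > 0 \<and> u y + k * c < 0 \<or> u w < 0 \<and> u y + k * c > 0"
        by cases (use big' in \<open>auto simp: kM\<close>)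
      moreover have "0 \<le> u w \<and> 0 \<le> u y + k * c \<or> u w \<le> 0 \<and> u y + k * c \<le> 0"
      proof -
        have v: "u w + k * c * simple_root y w = u w" "u y + k * c * simple_root y y = u y + k * c"
          using that by (auto simp: simple_root_def)
        from root_sign[OF all] show ?thesis
        proof
          assume "nonneg (\<lambda>w. u w + k * c * simple_root y w)"
          then have "0 \<le> u w + k * c * simple_root y w" "0 \<le> u y + k * c * simple_root y y"
            unfolding nonneg_def by blast+
          then show ?thesis unfolding v by blast
        next
          assume "nonpos (\<lambda>w. u w + k * c * simple_root y w)"
          then have "u w + k * c * simple_root y w \<le> 0" "u y + k * c * simple_root y y \<le> 0"
            unfolding nonpos_def by blast+
          then show ?thesis unfolding v by blast
        qed
      qed
      ultimately show False by auto
    qed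
    have "u = (\<lambda>w. 0 + u y * simple_root y w)" using u0 by (auto simp: simple_root_def)
    then have "\<gamma> = act V A ys (\<lambda>w. 0 * simple_root y w + u y * simple_root y w)"
      using ys unfolding u_def by (metis (no_types, lifting) act_rev' ext mult_zero_left)
    also have "\<dots> = (\<lambda>w. 0 * \<beta> w + u y * \<beta> w)" unfolding \<beta>_def by (rule act_lincomb[OF ys(1)])
    finally have g: "\<gamma> = (\<lambda>w. 0 + u y * \<beta> w)" by simp
    have "\<kappa> (\<lambda>w. 0) = 0" "\<kappa>' (\<lambda>w. 0) = 0"
      unfolding \<kappa>_def \<kappa>'_def using act_lincomb[of "rev ys" 0 \<beta> 0 \<beta>] act_lincomb[of "rev zs" 0 \<beta> 0 \<beta>] ys zs
      by (simp_all add: cform_def)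
    then have "\<kappa> \<gamma> = 2 * u y" "\<kappa>' \<gamma> = 2 * u y"
      using lin[of "\<lambda>w. 0" "u y"] g by auto
    then show False using c unfolding c_def by simp
  qed
  then show ?thesis unfolding t t' c_def by simp
qed

lemma root_reflection_eq:
  assumes "set ys \<subseteq> V" "y \<in> V" "\<gamma> \<in> \<Phi>"
  shows "root_reflection V A (act V A ys (simple_root y)) \<gamma> = act V A (ys @ y # rev ys) \<gamma>"
proof -
  let ?P = "\<lambda>t. \<exists>zs z. set zs \<subseteq> V \<and> z \<in> V \<and> act V A ys (simple_root y) = act V A zs (simple_root z) \<and>
     t = act V A (zs @ z # rev zs)"
  have "?P (act V A (ys @ y # rev ys))" using assms(1,2) by (intro exI[of _ ys] exI[of _ y] conjI HOL.refl)
  then have "?P (root_reflection V A (act V A ys (simple_root y)))"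
    unfolding root_reflection_def by (rule someI[of ?P])
  then obtain zs z where z: "set zs \<subseteq> V" "z \<in> V" "act V A ys (simple_root y) = act V A zs (simple_root z)"
     "root_reflection V A (act V A ys (simple_root y)) = act V A (zs @ z # rev zs)" by blast
  show ?thesis unfolding z(4) using reflection_unique[OF assms(1,2) z(1-3) assms(3)] by simp
qed

lemma root_reflection_root:
  assumes "\<beta> \<in> \<Phi>" "\<gamma> \<in> \<Phi>"
  shows "root_reflection V A \<beta> \<gamma> \<in> \<Phi>"
proof -
  obtain ys y where w: "set ys \<subseteq> V" "y \<in> V" "\<beta> = act V A ys (simple_root y)"
    using root_word[OF assms(1)] .
  show ?thesis unfolding w(3) root_reflection_eq[OF w(1,2) assms(2)]
    by (rule act_root) (use w assms in simp_all)
qed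

lemma linear_functional_sum:
  fixes F :: "('v \<Rightarrow> int) \<Rightarrow> int"
  assumes lin: "\<And>p f q g. F (\<lambda>z. p * f z + q * g z) = p * F f + q * F g"
    and supp: "\<And>z. z \<notin> V \<Longrightarrow> f z = 0"
  shows "F f = (\<Sum>z\<in>V. F (simple_root z) * f z)"
proof -
  have "finite W \<Longrightarrow> F (\<lambda>z. if z \<in> W then f z else 0) = (\<Sum>z\<in>W. F (simple_root z) * f z)" for W
  proof (induction W rule: finite_induct)
    case empty
    show ?case using lin[of 0 f 0 f] by simp
  next
    case (insert w W)
    have "(\<lambda>z. if z \<in> insert w W then f z else 0) = (\<lambda>z. f w * simple_root w z + 1 * (if z \<in> W then f z else 0))"
      using insert.hyps by (auto simp: simple_root_def)
    then show ?case using insert lin[of "f w" "simple_root w" 1 "\<lambda>z. if z \<in> W then f z else 0"] by simp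
  qed
  from this[OF finite_V] have "F (\<lambda>z. if z \<in> V then f z else 0) = (\<Sum>z\<in>V. F (simple_root z) * f z)" .
  moreover have "(\<lambda>z. if z \<in> V then f z else 0) = f" using supp by auto
  ultimately show ?thesis by simp
qed

text \<open>For \<beta> = w(\<alpha>_y) the coroot sends \<gamma> to the value of
  \<open>\<phi> y\<close> on w^-1(\<gamma>). Having it in coordinates makes it applicable to real
  combinations of roots as well.\<close>

lemma coroot:
  assumes "\<beta> \<in> \<Phi>"
  obtains \<kappa> where "\<forall>\<gamma>\<in>\<Phi>. root_reflection V A \<beta> \<gamma> = (\<lambda>z. \<gamma> z - (\<Sum>w\<in>V. \<kappa> w * \<gamma> w) * \<beta> z)"
    "(\<Sum>w\<in>V. \<kappa> w * \<beta> w) = 2"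
proof -
  obtain ys y where w: "set ys \<subseteq> V" "y \<in> V" "\<beta> = act V A ys (simple_root y)"
    using root_word[OF assms(1)] .
  define F where "F f = \<phi> y (act V A (rev ys) f)" for f
  have lin: "F (\<lambda>z. p * f z + q * g z) = p * F f + q * F g" for p f q g
    unfolding F_def using act_lincomb[of "rev ys" p f q g] w(1) by (simp add: cform_lincomb)
  have F: "F \<gamma> = (\<Sum>z\<in>V. F (simple_root z) * \<gamma> z)" if "\<gamma> \<in> \<Phi>" for \<gamma>
    using linear_functional_sum[of F, OF lin] root_support[OF that] by blast
  show thesis
  proof (rule that[of "\<lambda>z. F (simple_root z)"])
    have "root_reflection V A \<beta> \<gamma> = (\<lambda>z. \<gamma> z - (\<Sum>w\<in>V. F (simple_root w) * \<gamma> w) * \<beta> z)" if "\<gamma> \<in> \<Phi>" for \<gamma>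
      unfolding F[OF that, symmetric] unfolding w(3) root_reflection_eq[OF w(1,2) that] F_def
      by (rule reflection_word[OF w(1,2)])
    then show "\<forall>\<gamma>\<in>\<Phi>. root_reflection V A \<beta> \<gamma> = (\<lambda>z. \<gamma> z - (\<Sum>w\<in>V. F (simple_root w) * \<gamma> w) * \<beta> z)" by blast
    show "(\<Sum>z\<in>V. F (simple_root z) * \<beta> z) = 2"
    proof -
      have "F \<beta> = 2" unfolding F_def using w by (simp add: cform_simple diag)
      then show ?thesis using F[OF assms] by simp
    qed
  qed
qed

lemma root_reflection_equivariant:
  assumes "\<beta> \<in> \<Phi>" "\<gamma> \<in> \<Phi>" "v \<in> V"
  shows "root_reflection V A (simple_reflection V A v \<beta>) (simple_reflection V A v \<gamma>)
    = simple_reflection V A v (root_reflection V A \<beta> \<gamma>)"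
proof -
  obtain ys y where w: "set ys \<subseteq> V" "y \<in> V" "\<beta> = act V A ys (simple_root y)"
    using root_word[OF assms(1)] .
  have "root_reflection V A (act V A (v # ys) (simple_root y)) (simple_reflection V A v \<gamma>)
    = act V A ((v # ys) @ y # rev (v # ys)) (simple_reflection V A v \<gamma>)"
    by (rule root_reflection_eq) (use w assms root_system.reflect in auto)
  then show ?thesis unfolding w(3) root_reflection_eq[OF w(1,2) assms(2)] using assms(3) by simp
qed

text \<open>Read from the right, each letter turns at most one further positive root negative: the
  one that the letters to its right have carried to the simple root of that letter.\<close>

lemma inversions_word:
  assumes "set zs \<subseteq> V"
  shows "finite {\<gamma> \<in> \<Phi>. nonneg \<gamma> \<and> nonpos (act V A zs \<gamma>)} \<and>
    card {\<gamma> \<in> \<Phi>. nonneg \<gamma> \<and> nonpos (act V A zs \<gamma>)} \<le> length zs"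
  using assms
proof (induction zs)
  case Nil
  have "{\<gamma> \<in> \<Phi>. nonneg \<gamma> \<and> nonpos (act V A [] \<gamma>)} = {}" using nonneg_nonpos_root by auto
  then show ?case by (metis card.empty finite.emptyI le0)
next
  case (Cons z zs)
  let ?S = "{\<gamma> \<in> \<Phi>. nonneg \<gamma> \<and> nonpos (act V A zs \<gamma>)}"
  have z: "z \<in> V" "set zs \<subseteq> V" using Cons.prems by auto
  have sub: "{\<gamma> \<in> \<Phi>. nonneg \<gamma> \<and> nonpos (act V A (z # zs) \<gamma>)} \<subseteq> insert (act V A (rev zs) (simple_root z)) ?S"
  proof
    fix \<gamma> assume "\<gamma> \<in> {\<gamma> \<in> \<Phi>. nonneg \<gamma> \<and> nonpos (act V A (z # zs) \<gamma>)}"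
    then have g: "\<gamma> \<in> \<Phi>" "nonneg \<gamma>" "nonpos (simple_reflection V A z (act V A zs \<gamma>))" by auto
    have r: "act V A zs \<gamma> \<in> \<Phi>" by (rule act_root[OF z(2) g(1)])
    show "\<gamma> \<in> insert (act V A (rev zs) (simple_root z)) ?S"
    proof (cases "nonpos (act V A zs \<gamma>)")
      case False
      then have n: "nonneg (act V A zs \<gamma>)" using root_sign[OF r] by blast
      have "act V A zs \<gamma> = simple_root z"
        using nonneg_refl[OF r n z(1)] g(3) nonneg_nonpos_root[OF root_system.reflect[OF r z(1)]] by blast
      then show ?thesis using z(2) by (metis act_rev insertI1)
    qed (use g in simp)
  qed
  have IH: "finite ?S" "card ?S \<le> length zs" using Cons.IH[OF z(2)] by auto
  have "card {\<gamma> \<in> \<Phi>. nonneg \<gamma> \<and> nonpos (act V A (z # zs) \<gamma>)} \<le> card (insert (act V A (rev zs) (simple_root z)) ?S)"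
    by (rule card_mono[OF _ sub]) (use IH in simp)
  also have "\<dots> \<le> Suc (card ?S)" using IH(1) card_insert_if[OF IH(1)] by simp
  finally have "card {\<gamma> \<in> \<Phi>. nonneg \<gamma> \<and> nonpos (act V A (z # zs) \<gamma>)} \<le> length (z # zs)" using IH(2) by simp
  then show ?case using finite_subset[OF sub] IH(1) by blast
qed

lemma root_reflection_self:
  assumes "\<beta> \<in> \<Phi>"
  shows "root_reflection V A \<beta> \<beta> = (\<lambda>z. - \<beta> z)"
proof -
  obtain \<kappa> where "\<forall>\<gamma>\<in>\<Phi>. root_reflection V A \<beta> \<gamma> = (\<lambda>z. \<gamma> z - (\<Sum>w\<in>V. \<kappa> w * \<gamma> w) * \<beta> z)"
    "(\<Sum>w\<in>V. \<kappa> w * \<beta> w) = 2" using coroot[OF assms] .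
  then show ?thesis using assms by simp
qed

text \<open>A shortest expression of \<beta> uses depth - 1 reflections, so the reflection in
  \<beta> is a word of length 2(depth - 1) + 1, and \<beta> itself is one of the roots that this
  word inverts.\<close>

lemma inversions_bound:
  assumes "\<beta> \<in> \<Phi>" "nonneg \<beta>"
  shows "finite (inversions V A \<beta>)" "card (inversions V A \<beta>) \<le> 2 * (depth V A \<beta> - 1)"
proof -
  have ex: "\<exists>l ys y. length ys = l \<and> set ys \<subseteq> V \<and> y \<in> V \<and> \<beta> = act V A ys (simple_root y)"
    using root_word[OF assms(1)] by metis
  obtain ys y where w: "length ys = depth V A \<beta> - 1" "set ys \<subseteq> V" "y \<in> V" "\<beta> = act V A ys (simple_root y)"
    using LeastI_ex[OF ex] unfolding depth_def by auto
  let ?S = "{\<gamma> \<in> \<Phi>. nonneg \<gamma> \<and> nonpos (act V A (ys @ y # rev ys) \<gamma>)}"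
  have S: "finite ?S" "card ?S \<le> length (ys @ y # rev ys)" using inversions_word[of "ys @ y # rev ys"] w by auto
  have rr: "root_reflection V A \<beta> \<gamma> = act V A (ys @ y # rev ys) \<gamma>" if "\<gamma> \<in> \<Phi>" for \<gamma>
    unfolding w(4) by (rule root_reflection_eq[OF w(2,3) that])
  have eq: "inversions V A \<beta> = ?S - {\<beta>}" unfolding inversions_def using rr by auto
  have "\<beta> \<in> ?S" using root_reflection_self[OF assms(1)] rr[OF assms(1)] assms by (auto simp: nonneg_def nonpos_def)
  then show "finite (inversions V A \<beta>)" "card (inversions V A \<beta>) \<le> 2 * (depth V A \<beta> - 1)"
    unfolding eq using S w(1) by (auto simp: card_Diff_singleton)
qed

text \<open>The partner is the negative of the reflected root, \<gamma>' = K\<beta> - \<gamma> with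
  K the value of the coroot of \<beta> on \<gamma>. Its reflection is -\<gamma>, so it is an
  inversion again.\<close>

lemma inversion_partner:
  assumes "\<beta> \<in> \<Phi>" "nonneg \<beta>" "\<gamma> \<in> inversions V A \<beta>"
  obtains \<gamma>' k where "\<gamma>' \<in> inversions V A \<beta>" "k > 0" "\<And>z. \<gamma> z + \<gamma>' z = k * \<beta> z"
proof -
  have g: "\<gamma> \<in> \<Phi>" "nonneg \<gamma>" "\<gamma> \<noteq> \<beta>" "nonpos (root_reflection V A \<beta> \<gamma>)" using assms(3) by (auto simp: inversions_def)
  obtain \<kappa> where k: "\<forall>\<gamma>\<in>\<Phi>. root_reflection V A \<beta> \<gamma> = (\<lambda>z. \<gamma> z - (\<Sum>w\<in>V. \<kappa> w * \<gamma> w) * \<beta> z)"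
    "(\<Sum>w\<in>V. \<kappa> w * \<beta> w) = 2" using coroot[OF assms(1)] .
  define K where "K = (\<Sum>w\<in>V. \<kappa> w * \<gamma> w)"
  define \<gamma>' where "\<gamma>' = (\<lambda>z. K * \<beta> z - \<gamma> z)"
  have rr: "root_reflection V A \<beta> \<gamma> = (\<lambda>z. - \<gamma>' z)" using bspec[OF k(1) g(1)] by (simp add: K_def \<gamma>'_def)
  have n': "nonneg \<gamma>'" using g(4) unfolding rr by (simp add: nonneg_def nonpos_def)
  have r': "\<gamma>' \<in> \<Phi>" using root_uminus[OF root_reflection_root[OF assms(1) g(1)]] unfolding rr by simp
  have "(\<Sum>w\<in>V. \<kappa> w * \<gamma>' w) = K * (\<Sum>w\<in>V. \<kappa> w * \<beta> w) - (\<Sum>w\<in>V. \<kappa> w * \<gamma> w)"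
    unfolding \<gamma>'_def by (simp add: sum_subtractf sum_distrib_left algebra_simps)
  then have "(\<Sum>w\<in>V. \<kappa> w * \<gamma>' w) = K * (\<Sum>w\<in>V. \<kappa> w * \<beta> w) - K" by (simp add: K_def)
  then have "root_reflection V A \<beta> \<gamma>' = (\<lambda>z. - \<gamma> z)"
    using bspec[OF k(1) r'] k(2) by (auto simp: \<gamma>'_def)
  then have np: "nonpos (root_reflection V A \<beta> \<gamma>')" using g(2) by (simp add: nonneg_def nonpos_def)
  have "\<gamma>' \<noteq> \<beta>"
  proof
    assume e: "\<gamma>' = \<beta>"
    then have "\<gamma> = (\<lambda>z. (K - 1) * \<beta> z)" using e by (auto simp: \<gamma>'_def fun_eq_iff algebra_simps)
    then have "K - 1 = 1 \<or> K - 1 = -1" using root_multiple[OF assms(1)] g(1) by metis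
    then show False
    proof
      assume "K - 1 = 1"
      then show False using g(3) \<open>\<gamma> = (\<lambda>z. (K - 1) * \<beta> z)\<close> by simp
    next
      assume "K - 1 = -1"
      then have "\<gamma> = (\<lambda>z. - \<gamma>' z)" using e \<open>\<gamma> = (\<lambda>z. (K - 1) * \<beta> z)\<close> by simp
      then show False using nonneg_nonpos_root[OF g(1,2)] n' by (simp add: nonneg_def nonpos_def)
    qed
  qed
  moreover have "K > 0"
  proof -
    obtain z where "\<gamma> z \<noteq> 0" using root_nonzero[OF g(1)] by blast
    then have "0 < \<gamma> z + \<gamma>' z" using g(2) n' unfolding nonneg_def by (metis add_pos_nonneg order_less_le)
    then have "0 < K * \<beta> z" by (simp add: \<gamma>'_def)
    then show ?thesis using assms(2) by (auto simp: nonneg_def zero_less_mult_iff dest: spec[of _ z])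
  qed
  ultimately show thesis using that[of \<gamma>' K] r' n' np by (auto simp: inversions_def \<gamma>'_def)
qed

lemma inversions_simple: "y \<in> V \<Longrightarrow> inversions V A (simple_root y) = {}"
proof -
  assume y: "y \<in> V"
  have rr: "root_reflection V A (simple_root y) \<gamma> = simple_reflection V A y \<gamma>" if "\<gamma> \<in> \<Phi>" for \<gamma>
    using root_reflection_eq[of "[]" y \<gamma>] y that by simp
  have "\<not> nonpos (root_reflection V A (simple_root y) \<gamma>)"
    if "\<gamma> \<in> \<Phi>" "nonneg \<gamma>" "\<gamma> \<noteq> simple_root y" for \<gamma>
    unfolding rr[OF that(1)]
    using nonneg_nonpos_root[OF root_system.reflect[OF that(1) y] nonneg_refl[OF that(1,2) y that(3)]] by blast
  then show ?thesis unfolding inversions_def by blast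
qed

text \<open>In the application \<open>P\<close> consists of the vectors that vanish on a codimension
  2 space, and the lemma provides a basic root of the subsystem in \<open>P\<close>. A simple root
  in \<open>P\<close> has no inversions at all. If \<open>P\<close> contains none, no simple
  reflection changes the sign of a root in \<open>P\<close>, so the problem can be moved along the
  word of \<beta> until a simple root is met.\<close>

lemma exists_without_inversions:
  assumes "\<beta> \<in> \<Phi>" "nonneg \<beta>" "\<beta> \<in> P" and "\<And>u v k. u \<in> P \<Longrightarrow> v \<in> P \<Longrightarrow> (\<lambda>z. u z - k * v z) \<in> P"
  shows "\<exists>\<delta>\<in>\<Phi>. \<delta> \<in> P \<and> nonneg \<delta> \<and> inversions V A \<delta> \<inter> P = {}"
proof -
  obtain ys y where w: "set ys \<subseteq> V" "y \<in> V" "\<beta> = act V A ys (simple_root y)"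
    using root_word[OF assms(1)] .
  have "set ys \<subseteq> V \<Longrightarrow> nonneg (act V A ys (simple_root y)) \<Longrightarrow> act V A ys (simple_root y) \<in> P \<Longrightarrow>
     (\<And>u v k. u \<in> P \<Longrightarrow> v \<in> P \<Longrightarrow> (\<lambda>z. u z - k * v z) \<in> P) \<Longrightarrow>
     \<exists>\<delta>\<in>\<Phi>. \<delta> \<in> P \<and> nonneg \<delta> \<and> inversions V A \<delta> \<inter> P = {}" for ys P
  proof (induction ys arbitrary: P)
    case Nil
    then show ?case using inversions_simple[OF w(2)]
      by (intro bexI[of _ "simple_root y"] root_system.simple w(2) conjI) (simp_all only: foldr.simps id_apply Int_empty_left)
  next
    case (Cons v ys P)
    show ?case
    proof (cases "\<exists>v\<in>V. simple_root v \<in> P")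
      case True
      then obtain v where "v \<in> V" "simple_root v \<in> P" by blast
      then show ?thesis using inversions_simple[of v]
        by (intro bexI[of _ "simple_root v"] root_system.simple) (simp_all add: nonneg_def simple_root_def)
    next
      case False
      have v: "v \<in> V" "set ys \<subseteq> V" using Cons.prems(1) by auto
      let ?b = "act V A ys (simple_root y)"
      define P1 where "P1 = {f. simple_reflection V A v f \<in> P}"
      have b: "?b \<in> \<Phi>" "simple_reflection V A v ?b \<in> \<Phi>"
        using act_root[OF v(2) root_system.simple[OF w(2)]] root_system.reflect v(1) by auto
      have neg: "(\<lambda>z. - u z) \<in> P" if "u \<in> P" for u
        using Cons.prems(4)[OF that that, of 2] by simp
      have nv: "(\<lambda>z. - simple_root v z) \<notin> P" using neg[of "\<lambda>z. - simple_root v z"] False v(1) by auto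
      have flip: "nonneg (simple_reflection V A v \<gamma>)" if "\<gamma> \<in> \<Phi>" "nonneg \<gamma>" "\<gamma> \<in> P" for \<gamma>
        using nonneg_refl[OF that(1,2) v(1)] False v(1) that(3) by blast
      have "\<exists>\<delta>\<in>\<Phi>. \<delta> \<in> P1 \<and> nonneg \<delta> \<and> inversions V A \<delta> \<inter> P1 = {}"
      proof (rule Cons.IH[OF v(2)])
        show "nonneg ?b" using flip[OF b(2)] Cons.prems(2,3) v(1) by simp
        show "?b \<in> P1" using Cons.prems(3) by (simp add: P1_def)
        show "(\<lambda>z. u z - k * u' z) \<in> P1" if "u \<in> P1" "u' \<in> P1" for u u' k
          using Cons.prems(4)[of "simple_reflection V A v u" "simple_reflection V A v u'" k]
            act_sub[of "[v]" u k u'] v(1) that unfolding P1_def by simp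
      qed
      then obtain \<delta> where d: "\<delta> \<in> \<Phi>" "simple_reflection V A v \<delta> \<in> P" "nonneg \<delta>" "inversions V A \<delta> \<inter> P1 = {}"
        by (auto simp: P1_def)
      let ?d = "simple_reflection V A v \<delta>"
      have dr: "?d \<in> \<Phi>" using root_system.reflect[OF d(1) v(1)] .
      have "nonneg ?d" using nonneg_refl[OF d(1,3) v(1)] nv d(2) refl_simple[OF v(1)] by metis
      moreover have "inversions V A ?d \<inter> P = {}"
      proof (rule ccontr)
        assume "inversions V A ?d \<inter> P \<noteq> {}"
        then obtain \<gamma> where g: "\<gamma> \<in> \<Phi>" "nonneg \<gamma>" "\<gamma> \<noteq> ?d" "nonpos (root_reflection V A ?d \<gamma>)" "\<gamma> \<in> P"
          by (auto simp: inversions_def)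
        let ?g = "simple_reflection V A v \<gamma>"
        have gr: "?g \<in> \<Phi>" using root_system.reflect[OF g(1) v(1)] .
        have eqv: "root_reflection V A \<delta> ?g = simple_reflection V A v (root_reflection V A ?d \<gamma>)"
          using root_reflection_equivariant[OF dr g(1) v(1)] v(1) by simp
        obtain \<kappa> where "root_reflection V A ?d \<gamma> = (\<lambda>z. \<gamma> z - (\<Sum>w\<in>V. \<kappa> w * \<gamma> w) * ?d z)"
          using coroot[OF dr] g(1) by metis
        then have inP: "root_reflection V A ?d \<gamma> \<in> P" using Cons.prems(4)[OF g(5) d(2)] by simp
        let ?t = "\<lambda>z. - root_reflection V A ?d \<gamma> z"
        \<comment> \<open>The reflected root differs from \<gamma> by a multiple of s_v(\<delta>),
          so it stays in \<open>P\<close> and s_v preserves its sign as well. Hence an inversion in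
          \<open>P\<close> would yield one in \<open>P1\<close>.\<close>
        have "nonneg (simple_reflection V A v ?t)"
          by (rule flip) (use root_uminus[OF root_reflection_root[OF dr g(1)]] g(4) neg[OF inP] in \<open>auto simp: nonneg_def nonpos_def\<close>)
        then have "nonpos (root_reflection V A \<delta> ?g)"
          unfolding eqv using act_uminus[of "[v]"] v(1) by (simp add: nonneg_def nonpos_def)
        moreover have "?g \<noteq> \<delta>" using g(3) v(1) by auto
        ultimately have "?g \<in> inversions V A \<delta>" using gr flip[OF g(1,2,5)] by (simp add: inversions_def)
        moreover have "?g \<in> P1" using g(5) v(1) by (simp add: P1_def)
        ultimately show False using d(4) by blast
      qed
      ultimately show ?thesis using dr d(2) by blast
    qed
  qed
  from this[OF w(1), of P] show ?thesis unfolding w(3)[symmetric] using assms(2-4) by simp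
qed

end

section \<open>Fractures and inversions\<close>

lemma lookup_scaleR [simp]: "Poly_Mapping.lookup (c *\<^sub>R f) y = c * Poly_Mapping.lookup (f :: 'v functional) y"
  by (simp add: scaleR_poly_mapping_def)

lemma pairing_add: "pairing V (f + g) \<beta> = pairing V f \<beta> + pairing V g \<beta>"
  by (simp add: pairing_def lookup_add algebra_simps sum.distrib)

lemma pairing_diff: "pairing V (f - g) \<beta> = pairing V f \<beta> - pairing V g \<beta>"
  by (simp add: pairing_def lookup_minus algebra_simps sum_subtractf)

lemma pairing_scaleR: "pairing V (c *\<^sub>R f) \<beta> = c * pairing V f \<beta>"
  by (simp add: pairing_def sum_distrib_left algebra_simps)

lemma pairing_vector_diff: "pairing V f (\<lambda>z. \<beta> z - k * \<gamma> z) = pairing V f \<beta> - of_int k * pairing V f \<gamma>"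
  by (simp add: pairing_def sum_distrib_left sum_subtractf algebra_simps)

lemma pairing_vector_uminus: "pairing V f (\<lambda>z. - \<beta> z) = - pairing V f \<beta>"
  by (simp add: pairing_def sum_negf)

lemma pairing_single:
  assumes "finite V" "y \<in> V"
  shows "pairing V (Poly_Mapping.single y c) \<beta> = c * of_int (\<beta> y)"
proof -
  have "pairing V (Poly_Mapping.single y c) \<beta> = (\<Sum>z\<in>V. if z = y then c * of_int (\<beta> z) else 0)"
    unfolding pairing_def by (rule sum.cong) (auto simp: lookup_single when_def)
  then show ?thesis using assms by simp
qed

lemma dual_space_iff: "f \<in> dual_space V \<longleftrightarrow> (\<forall>y. y \<notin> V \<longrightarrow> Poly_Mapping.lookup f y = 0)"
  unfolding dual_space_def by (auto simp: in_keys_iff)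

lemma subspace_dual_space: "subspace (dual_space V)"
  by (auto simp: subspace_def dual_space_iff lookup_add)

lemma subspace_perp: "subspace (perp V \<beta>)"
  using subspace_dual_space[of V]
  by (auto simp: subspace_def perp_def pairing_add pairing_scaleR) (simp add: pairing_def)

lemma perp_uminus [simp]: "perp V (\<lambda>z. - \<beta> z) = perp V \<beta>"
  by (simp add: perp_def pairing_vector_uminus)

lemma abs_lookup_le_norm: "\<bar>Poly_Mapping.lookup f y\<bar> \<le> norm (f :: 'v functional)"
proof (cases "y \<in> Poly_Mapping.keys f")
  case True
  then have "\<bar>Poly_Mapping.lookup f y\<bar> \<le> (\<Sum>n\<in>Poly_Mapping.keys f. \<bar>Poly_Mapping.lookup f n\<bar>)"
    by (intro member_le_sum) auto
  then show ?thesis by (simp add: norm_poly_mapping_def dist_poly_mapping_def)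
qed (simp add: in_keys_iff)

lemma continuous_on_lookup: "continuous_on S (\<lambda>f :: 'v functional. Poly_Mapping.lookup f y)"
proof -
  have "bounded_linear (\<lambda>f :: 'v functional. Poly_Mapping.lookup f y)"
    by (rule bounded_linear_intro[where K = 1]) (auto simp: lookup_add abs_lookup_le_norm)
  then show ?thesis by (rule linear_continuous_on)
qed

lemma continuous_on_pairing: "continuous_on S (\<lambda>f. pairing V f \<beta>)"
  unfolding pairing_def by (intro continuous_intros continuous_on_lookup)

lemma closed_dual_space: "closed (dual_space (V :: 'v set))"
proof -
  have "dual_space V = (\<Inter>y\<in>-V. {f. Poly_Mapping.lookup f y = 0})"
    by (auto simp: dual_space_iff)
  moreover have "closed {f :: 'v functional. Poly_Mapping.lookup f y = 0}" for y :: 'v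
    by (intro closed_Collect_eq continuous_on_lookup continuous_on_const)
  ultimately show ?thesis by (simp add: closed_INT)
qed

context gcm
begin


text \<open>The functional with value \<beta>_w on \<alpha>_z, value -\<beta>_z on \<alpha>_w and 0
  on the other simple roots annihilates \<beta>; evaluating it on \<gamma> gives the minor.\<close>

lemma perp_subset_imp_proportional:
  assumes "perp V \<beta> \<subseteq> perp V \<gamma>" "z \<in> V" "w \<in> V"
  shows "\<gamma> z * \<beta> w = \<gamma> w * \<beta> z"
proof (cases "z = w")
  case False
  define f where "f = Poly_Mapping.single z (real_of_int (\<beta> w)) - Poly_Mapping.single w (real_of_int (\<beta> z))"
  have pf: "pairing V f \<delta> = \<beta> w * \<delta> z - \<beta> z * \<delta> w" for \<delta>
    using assms by (simp add: f_def pairing_diff pairing_single)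
  have "f \<in> dual_space V" using assms by (auto simp: dual_space_iff f_def lookup_minus lookup_single when_def)
  then have "f \<in> perp V \<beta>" by (simp add: perp_def pf)
  then have "pairing V f \<gamma> = 0" using assms(1) by (auto simp: perp_def)
  then show ?thesis unfolding pf by (simp add: mult.commute flip: of_int_mult of_int_diff)
qed simp

lemma perp_subset_imp_eq:
  assumes "\<beta> \<in> \<Phi>" "\<gamma> \<in> \<Phi>" "nonneg \<beta>" "nonneg \<gamma>" "perp V \<beta> \<subseteq> perp V \<gamma>"
  shows "\<gamma> = \<beta>"
proof -
  have "\<gamma> z * \<beta> w = \<gamma> w * \<beta> z" for z w
    using perp_subset_imp_proportional[OF assms(5)] root_support[OF assms(1)] root_support[OF assms(2)]
    by (cases "z \<in> V"; cases "w \<in> V") auto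
  from proportional_roots[OF assms(1,2) this] show ?thesis
  proof
    assume g: "\<gamma> = (\<lambda>z. - \<beta> z)"
    then have "nonpos \<gamma>" using assms(3) by (simp add: nonneg_def nonpos_def)
    then show ?thesis using nonneg_nonpos_root[OF assms(2,4)] by blast
  qed
qed

lemma root_hyperplaneE:
  assumes "H \<in> root_hyperplanes V A"
  obtains \<gamma> where "\<gamma> \<in> \<Phi>" "nonneg \<gamma>" "H = perp V \<gamma>"
proof -
  obtain \<gamma> where g: "\<gamma> \<in> \<Phi>" "H = perp V \<gamma>" using assms by (auto simp: root_hyperplanes_def)
  show thesis
  proof (cases "nonneg \<gamma>")
    case False
    then have "nonpos \<gamma>" using root_sign[OF g(1)] by blast
    then show ?thesis using that[of "\<lambda>z. - \<gamma> z"] root_uminus[OF g(1)] g(2) by (simp add: nonneg_def nonpos_def)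
  qed (use that g in blast)
qed

lemma base_region_pos:
  assumes "f \<in> base_region V" "\<gamma> \<in> \<Phi>" "nonneg \<gamma>"
  shows "0 < pairing V f \<gamma>"
proof -
  have f: "0 < Poly_Mapping.lookup f y" if "y \<in> V" for y
  proof -
    have "pairing V f (simple_root y) = (\<Sum>z\<in>V. if z = y then Poly_Mapping.lookup f z else 0)"
      unfolding pairing_def by (rule sum.cong) (auto simp: simple_root_def)
    then show ?thesis using assms(1) that by (force simp: base_region_def)
  qed
  obtain z where z: "z \<in> V" "\<gamma> z \<noteq> 0" using root_nonzero[OF assms(2)] by blast
  show ?thesis unfolding pairing_def
  proof (rule sum_pos2[OF finite_V z(1)])
    have "\<gamma> z > 0" using z assms(3) by (simp add: nonneg_def order_less_le)
    then show "0 < Poly_Mapping.lookup f z * real_of_int (\<gamma> z)" using f[OF z(1)] by simp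
    show "0 \<le> Poly_Mapping.lookup f y * real_of_int (\<gamma> y)" if "y \<in> V" for y
      using f[OF that] assms(3) by (simp add: nonneg_def)
  qed
qed

lemma base_region_nonempty: "\<exists>b. b \<in> base_region V"
proof
  define b where "b = (\<Sum>y\<in>V. Poly_Mapping.single y (1::real))"
  have l: "Poly_Mapping.lookup b z = (if z \<in> V then 1 else 0)" for z
    by (simp add: b_def lookup_sum lookup_single when_def)
  have "pairing V b (simple_root y) = (\<Sum>z\<in>V. if z = y then 1 else 0)" for y
    unfolding pairing_def by (rule sum.cong) (auto simp: simple_root_def l)
  then show "b \<in> base_region V"
    by (simp add: base_region_def dual_space_iff l)
qed

text \<open>The family may be infinite. A connected set on which a pairing takes a positive and a
  nonpositive value meets the hyperplane; conversely the set of functionals with positive pairings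
  is convex, avoids all hyperplanes and contains the base region.\<close>

lemma region_eq:
  assumes "\<H> \<subseteq> root_hyperplanes V A"
  defines "\<Psi> \<equiv> {\<gamma> \<in> \<Phi>. nonneg \<gamma> \<and> perp V \<gamma> \<in> \<H>}"
  shows "region_containing_base V \<H> = {f \<in> dual_space V. \<forall>\<gamma>\<in>\<Psi>. 0 < pairing V f \<gamma>}" (is "_ = ?C")
proof (intro equalityI subsetI)
  fix f assume "f \<in> region_containing_base V \<H>"
  then obtain b T where b: "b \<in> base_region V" and T: "connected T" "T \<subseteq> dual_space V - \<Union>\<H>" "b \<in> T" "f \<in> T"
    unfolding region_containing_base_def connected_component_def by auto
  have "0 < pairing V f \<gamma>" if g: "\<gamma> \<in> \<Psi>" for \<gamma>
  proof (rule ccontr)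
    assume "\<not> 0 < pairing V f \<gamma>"
    then have "0 \<in> {pairing V f \<gamma>..pairing V b \<gamma>}"
      using base_region_pos[OF b, of \<gamma>] g unfolding \<Psi>_def by simp
    moreover have "connected ((\<lambda>f. pairing V f \<gamma>) ` T)"
      by (rule connected_continuous_image[OF continuous_on_pairing T(1)])
    ultimately have "0 \<in> (\<lambda>f. pairing V f \<gamma>) ` T"
      using connected_contains_Icc T(3,4) by blast
    then obtain g' where "g' \<in> T" "pairing V g' \<gamma> = 0" by auto
    then have "g' \<in> perp V \<gamma>" "g' \<notin> \<Union>\<H>" using T(2) by (auto simp: perp_def)
    then show False using g unfolding \<Psi>_def by blast
  qed
  then show "f \<in> ?C" using T(2,4) by auto
next
  fix f assume f: "f \<in> ?C"
  obtain b where b: "b \<in> base_region V" using base_region_nonempty ..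
  have bC: "b \<in> ?C" using base_region_pos[OF b] b by (auto simp: \<Psi>_def base_region_def)
  have "convex ?C"
  proof (rule convexI)
    fix g h :: "'v functional" and u v :: real
    assume gh: "g \<in> ?C" "h \<in> ?C" and uv: "0 \<le> u" "0 \<le> v" "u + v = 1"
    have "u *\<^sub>R g + v *\<^sub>R h \<in> dual_space V"
      using gh by (intro subspace_add subspace_scale subspace_dual_space) auto
    moreover have "0 < pairing V (u *\<^sub>R g + v *\<^sub>R h) \<gamma>" if "\<gamma> \<in> \<Psi>" for \<gamma>
    proof -
      have p: "0 < pairing V g \<gamma>" "0 < pairing V h \<gamma>" using gh that by auto
      show ?thesis
      proof (cases "u = 0")
        case True
        then show ?thesis using p uv by (simp add: pairing_add pairing_scaleR)
      next
        case False
        then have "0 < u * pairing V g \<gamma>" "0 \<le> v * pairing V h \<gamma>" using uv p by auto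
        then show ?thesis by (simp add: pairing_add pairing_scaleR)
      qed
    qed
    ultimately show "u *\<^sub>R g + v *\<^sub>R h \<in> ?C" by blast
  qed
  then have "connected ?C" by (rule convex_connected)
  moreover have "?C \<subseteq> dual_space V - \<Union>\<H>"
  proof
    fix g assume g: "g \<in> ?C"
    have "g \<notin> H" if "H \<in> \<H>" for H
    proof -
      obtain \<gamma> where "\<gamma> \<in> \<Phi>" "nonneg \<gamma>" "H = perp V \<gamma>" using root_hyperplaneE assms(1) \<open>H \<in> \<H>\<close> by blast
      then have "\<gamma> \<in> \<Psi>" "H = perp V \<gamma>" using that by (auto simp: \<Psi>_def)
      then show ?thesis using g by (force simp: perp_def)
    qed
    then show "g \<in> dual_space V - \<Union>\<H>" using g by blast
  qed
  ultimately have "connected_component (dual_space V - \<Union>\<H>) b f"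
    unfolding connected_component_def using bC f by blast
  then show "f \<in> region_containing_base V \<H>" unfolding region_containing_base_def using b by blast
qed

lemma closure_region_eq:
  assumes "\<H> \<subseteq> root_hyperplanes V A"
  defines "\<Psi> \<equiv> {\<gamma> \<in> \<Phi>. nonneg \<gamma> \<and> perp V \<gamma> \<in> \<H>}"
  shows "closure (region_containing_base V \<H>) = {f \<in> dual_space V. \<forall>\<gamma>\<in>\<Psi>. 0 \<le> pairing V f \<gamma>}" (is "_ = ?D")
proof -
  let ?C = "{f \<in> dual_space V. \<forall>\<gamma>\<in>\<Psi>. 0 < pairing V f \<gamma>}"
  have C: "region_containing_base V \<H> = ?C" unfolding \<Psi>_def by (rule region_eq[OF assms(1)])
  show ?thesis unfolding C
  proof
    have "?D = dual_space V \<inter> (\<Inter>\<gamma>\<in>\<Psi>. {f. 0 \<le> pairing V f \<gamma>})" by auto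
    moreover have "closed {f. 0 \<le> pairing V f \<gamma>}" for \<gamma>
      by (intro closed_Collect_le continuous_on_pairing continuous_on_const)
    ultimately have "closed ?D" using closed_dual_space[of V] by (simp add: closed_INT closed_Int)
    then show "closure ?C \<subseteq> ?D" by (rule closure_minimal[rotated]) (auto intro: less_imp_le)
    show "?D \<subseteq> closure ?C"
    proof
      fix f assume f: "f \<in> ?D"
      obtain b where b: "b \<in> base_region V" using base_region_nonempty ..
      \<comment> \<open>Moving slightly towards a point of the base region makes all pairings
        strictly positive at once, however many roots there are.\<close>
      define X where "X n = f + inverse (real (Suc n)) *\<^sub>R b" for n
      have "X n \<in> ?C" for n
      proof -
        have "X n \<in> dual_space V" using f b subspace_dual_space
          unfolding X_def base_region_def by (auto intro: subspace_add subspace_scale)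
        moreover have "0 < pairing V (X n) \<gamma>" if "\<gamma> \<in> \<Psi>" for \<gamma>
        proof -
          have "0 < inverse (real (Suc n)) * pairing V b \<gamma>" using base_region_pos[OF b, of \<gamma>] that by (simp add: \<Psi>_def)
          then show ?thesis using f that by (simp add: X_def pairing_add pairing_scaleR add_nonneg_pos)
        qed
        ultimately show ?thesis by blast
      qed
      moreover have "X \<longlonglongrightarrow> f"
      proof -
        have "(\<lambda>n. f + inverse (real (Suc n)) *\<^sub>R b) \<longlonglongrightarrow> f + 0 *\<^sub>R b"
          by (intro tendsto_intros LIMSEQ_inverse_real_of_nat)
        then show ?thesis by (simp add: X_def[abs_def])
      qed
      ultimately show "f \<in> closure ?C" unfolding closure_sequential by blast
    qed
  qed
qed

text \<open>Inside \<open>perp V \<beta>\<close> the codimension 2 space is a hyperplane with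
  complementary line spanned by \<open>f\<^sub>0\<close>, so a vector that pairs to 0 with it is
  determined on \<open>perp V \<beta>\<close> by its pairing with \<open>f\<^sub>0\<close>.\<close>

lemma rank2_functional:
  assumes f0: "f\<^sub>0 \<in> perp V \<beta>" "pairing V f\<^sub>0 \<gamma>\<^sub>1 \<noteq> 0"
    and \<gamma>: "\<And>f. f \<in> perp V \<gamma>\<^sub>1 \<inter> perp V \<beta> \<Longrightarrow> pairing V f \<gamma> = 0" and f: "f \<in> perp V \<beta>"
  shows "pairing V f \<gamma> = pairing V f \<gamma>\<^sub>1 / pairing V f\<^sub>0 \<gamma>\<^sub>1 * pairing V f\<^sub>0 \<gamma>"
    "f - (pairing V f \<gamma>\<^sub>1 / pairing V f\<^sub>0 \<gamma>\<^sub>1) *\<^sub>R f\<^sub>0 \<in> perp V \<gamma>\<^sub>1 \<inter> perp V \<beta>"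
proof -
  let ?g = "f - (pairing V f \<gamma>\<^sub>1 / pairing V f\<^sub>0 \<gamma>\<^sub>1) *\<^sub>R f\<^sub>0"
  have "?g \<in> perp V \<beta>" using f f0(1) subspace_perp by (auto intro: subspace_diff subspace_scale)
  moreover have "pairing V ?g \<gamma>\<^sub>1 = 0" using f0(2) by (simp add: pairing_diff pairing_scaleR)
  ultimately show g: "?g \<in> perp V \<gamma>\<^sub>1 \<inter> perp V \<beta>" by (simp add: perp_def)
  from \<gamma>[OF g] show "pairing V f \<gamma> = pairing V f \<gamma>\<^sub>1 / pairing V f\<^sub>0 \<gamma>\<^sub>1 * pairing V f\<^sub>0 \<gamma>"
    by (simp add: pairing_diff pairing_scaleR)
qed

text \<open>Among the positive roots of \<open>P\<close> with h > 0, take one of least height. If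
  the coroot of \<beta> were positive on it, reflecting would subtract a positive multiple of
  \<beta>; in the absence of inversions the result is still positive, still has h > 0 since h
  ignores \<beta>, and has smaller height.\<close>

lemma low_root:
  assumes b: "\<beta> \<in> \<Phi>" "nonneg \<beta>" and k: "\<forall>\<gamma>\<in>\<Phi>. root_reflection V A \<beta> \<gamma> = (\<lambda>z. \<gamma> z - (\<Sum>w\<in>V. \<kappa> w * \<gamma> w) * \<beta> z)"
    and closed: "\<And>u k. u \<in> P \<Longrightarrow> (\<lambda>z. u z - k * \<beta> z) \<in> P" and inv: "inversions V A \<beta> \<inter> P = {}"
    and h: "\<And>u k. h (\<lambda>z. u z - k * \<beta> z) = (h u :: real)" "h \<beta> = 0"
    and g: "\<gamma> \<in> \<Phi>" "nonneg \<gamma>" "\<gamma> \<in> P" "0 < h \<gamma>"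
  shows "\<exists>\<delta>\<in>\<Phi>. nonneg \<delta> \<and> \<delta> \<in> P \<and> 0 < h \<delta> \<and> (\<Sum>w\<in>V. \<kappa> w * \<delta> w) \<le> 0"
proof -
  define Q where "Q \<delta> \<longleftrightarrow> \<delta> \<in> \<Phi> \<and> nonneg \<delta> \<and> \<delta> \<in> P \<and> 0 < h \<delta>" for \<delta>
  have "Q \<gamma>" using g by (simp add: Q_def)
  then obtain \<delta> where d: "Q \<delta>" "\<forall>\<epsilon>. Q \<epsilon> \<longrightarrow> nat (\<Sum>z\<in>V. \<delta> z) \<le> nat (\<Sum>z\<in>V. \<epsilon> z)"
    using ex_has_least_nat[of Q \<gamma> "\<lambda>\<delta>. nat (\<Sum>z\<in>V. \<delta> z)"] by blast
  have d': "\<delta> \<in> \<Phi>" "nonneg \<delta>" "\<delta> \<in> P" "0 < h \<delta>" using d(1) by (auto simp: Q_def)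
  define K where "K = (\<Sum>w\<in>V. \<kappa> w * \<delta> w)"
  have "K \<le> 0"
  proof (rule ccontr)
    assume K: "\<not> K \<le> 0"
    let ?e = "\<lambda>z. \<delta> z - K * \<beta> z"
    have e: "root_reflection V A \<beta> \<delta> = ?e" using bspec[OF k d'(1)] by (simp add: K_def)
    have er: "?e \<in> \<Phi>" using root_reflection_root[OF b(1) d'(1)] e by simp
    have "\<delta> \<noteq> \<beta>" using d'(4) h(2) by auto
    then have "\<not> nonpos ?e" using inv d' e by (auto simp: inversions_def)
    then have en: "nonneg ?e" using root_sign[OF er] by blast
    have "Q ?e" unfolding Q_def using er en closed[OF d'(3)] h(1) d'(4) by simp
    with d(2) have le: "nat (\<Sum>z\<in>V. \<delta> z) \<le> nat (\<Sum>z\<in>V. ?e z)" by blast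
    obtain z where z: "z \<in> V" "\<beta> z \<noteq> 0" using root_nonzero[OF b(1)] by blast
    have pos: "0 < (\<Sum>z\<in>V. \<beta> z)"
      by (rule sum_pos2[OF finite_V z(1)]) (use z b(2) in \<open>auto simp: nonneg_def order_less_le\<close>)
    have "(\<Sum>z\<in>V. ?e z) = (\<Sum>z\<in>V. \<delta> z) - K * (\<Sum>z\<in>V. \<beta> z)" by (simp add: sum_subtractf sum_distrib_left)
    moreover have "0 < K * (\<Sum>z\<in>V. \<beta> z)" using K pos by simp
    moreover have "0 \<le> (\<Sum>z\<in>V. ?e z)" using en by (intro sum_nonneg) (simp add: nonneg_def)
    ultimately show False using le by linarith
  qed
  then show ?thesis using d' unfolding K_def by blast
qed

text \<open>An inversion \<gamma> in \<open>P\<close> and its partner are nonnegative on the closed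
  region and add up to a multiple of \<beta>, so both vanish on the face in
  \<open>perp V \<beta>\<close>, which is then too small. Without inversions, all positive roots of
  \<open>P\<close> pair with the transversal functional f0 in one weak sign; a nonzero multiple of
  f0 therefore lies on the face and spans the hyperplane together with the codimension 2
  space.\<close>

lemma basic_iff_no_inversions:
  assumes b: "\<beta> \<in> \<Phi>" "nonneg \<beta>" and g1: "\<gamma>\<^sub>1 \<in> \<Phi>" "nonneg \<gamma>\<^sub>1" "\<gamma>\<^sub>1 \<noteq> \<beta>"
  defines "P \<equiv> {u. \<forall>f\<in>perp V \<gamma>\<^sub>1 \<inter> perp V \<beta>. pairing V f u = 0}"
  shows "perp V \<beta> \<in> basic_hyperplanes V (rank2_subarrangement V A (perp V \<gamma>\<^sub>1) (perp V \<beta>)) \<longleftrightarrow>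
    inversions V A \<beta> \<inter> P = {}"
proof -
  let ?H = "rank2_subarrangement V A (perp V \<gamma>\<^sub>1) (perp V \<beta>)"
  have sub: "?H \<subseteq> root_hyperplanes V A" by (auto simp: rank2_subarrangement_def)
  have memH: "perp V \<gamma> \<in> ?H \<longleftrightarrow> \<gamma> \<in> P" if "\<gamma> \<in> \<Phi>" for \<gamma>
    using that unfolding rank2_subarrangement_def root_hyperplanes_def P_def by (auto simp: perp_def)
  define D where "D = closure (region_containing_base V ?H)"
  have D: "D = {f \<in> dual_space V. \<forall>\<gamma>\<in>\<Phi>. nonneg \<gamma> \<longrightarrow> \<gamma> \<in> P \<longrightarrow> 0 \<le> pairing V f \<gamma>}"
    unfolding D_def closure_region_eq[OF sub] using memH by blast
  have bP: "\<beta> \<in> P" by (auto simp: P_def perp_def)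
  have bH: "perp V \<beta> \<in> ?H" using memH b(1) bP by blast
  have Pcl: "(\<lambda>z. u z - k * v z) \<in> P" if "u \<in> P" "v \<in> P" for u v k
    using that by (simp add: P_def pairing_vector_diff)
  have basic: "perp V \<beta> \<in> basic_hyperplanes V ?H \<longleftrightarrow> span (perp V \<beta> \<inter> D) = perp V \<beta>"
    using bH by (simp add: basic_hyperplanes_def D_def)
  show ?thesis
  proof
    assume span: "perp V \<beta> \<in> basic_hyperplanes V ?H"
    show "inversions V A \<beta> \<inter> P = {}"
    proof (rule ccontr)
      assume "inversions V A \<beta> \<inter> P \<noteq> {}"
      then obtain \<gamma> where g: "\<gamma> \<in> inversions V A \<beta>" "\<gamma> \<in> P" by blast
      obtain \<gamma>' k where g': "\<gamma>' \<in> inversions V A \<beta>" "k > 0" "\<And>z. \<gamma> z + \<gamma>' z = k * \<beta> z"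
        by (rule inversion_partner[OF b g(1)]) blast
      have "\<gamma>' = (\<lambda>z. (\<lambda>z. \<beta> z - (1 - k) * \<beta> z) z - 1 * \<gamma> z)"
        using g'(3) by (auto simp: fun_eq_iff algebra_simps)
      then have "\<gamma>' \<in> P" using Pcl[OF Pcl[OF bP bP] g(2)] by metis
      have gr: "\<gamma> \<in> \<Phi>" "nonneg \<gamma>" "\<gamma> \<noteq> \<beta>" and gr': "\<gamma>' \<in> \<Phi>" "nonneg \<gamma>'"
        using g(1) g'(1) by (auto simp: inversions_def)
      have "pairing V f \<gamma> = 0" if "f \<in> perp V \<beta> \<inter> D" for f
      proof -
        have "pairing V f \<gamma> + pairing V f \<gamma>' = (\<Sum>z\<in>V. Poly_Mapping.lookup f z * real_of_int (\<gamma> z + \<gamma>' z))"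
          by (simp add: pairing_def sum.distrib algebra_simps)
        also have "\<dots> = k * pairing V f \<beta>" unfolding g'(3) by (simp add: pairing_def sum_distrib_left algebra_simps)
        also have "\<dots> = 0" using that by (simp add: perp_def)
        finally show ?thesis using that gr gr' g(2) \<open>\<gamma>' \<in> P\<close> unfolding D by (smt (verit) IntD2 mem_Collect_eq)
      qed
      then have "perp V \<beta> \<inter> D \<subseteq> perp V \<gamma>" by (auto simp: perp_def)
      then have "span (perp V \<beta> \<inter> D) \<subseteq> perp V \<gamma>" by (rule span_minimal[OF _ subspace_perp])
      then have "perp V \<beta> \<subseteq> perp V \<gamma>" using span basic by simp
      then show False using perp_subset_imp_eq[OF b(1) gr(1) b(2) gr(2)] gr(3) by blast
    qed
  next
    assume inv: "inversions V A \<beta> \<inter> P = {}"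
    have "\<not> perp V \<beta> \<subseteq> perp V \<gamma>\<^sub>1" using perp_subset_imp_eq[OF b(1) g1(1) b(2) g1(2)] g1(3) by blast
    then obtain f0 where f0: "f0 \<in> perp V \<beta>" "pairing V f0 \<gamma>\<^sub>1 \<noteq> 0" by (auto simp: perp_def)
    define h where "h u = pairing V f0 u" for u
    have hb: "h \<beta> = 0" using f0(1) by (simp add: h_def perp_def)
    have hk: "h (\<lambda>z. u z - k * \<beta> z) = h u" for u k
      using hb by (simp add: h_def pairing_vector_diff)
    obtain \<kappa> where k: "\<forall>\<gamma>\<in>\<Phi>. root_reflection V A \<beta> \<gamma> = (\<lambda>z. \<gamma> z - (\<Sum>w\<in>V. \<kappa> w * \<gamma> w) * \<beta> z)"
      "(\<Sum>w\<in>V. \<kappa> w * \<beta> w) = 2" using coroot[OF b(1)] .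
    have res: "pairing V f \<gamma> = pairing V f \<gamma>\<^sub>1 / h \<gamma>\<^sub>1 * h \<gamma>" if "f \<in> perp V \<beta>" "\<gamma> \<in> P" for f \<gamma>
      unfolding h_def using rank2_functional(1)[OF f0 _ that(1), of \<gamma>] that(2) by (simp add: P_def)
    \<comment> \<open>Low roots on both sides would have a positive combination equal to c\<beta>
      with c > 0. The coroot of \<beta> takes the value 2c on it, but is at most 0 on either
      summand.\<close>
    have one_sided: False if g: "\<gamma> \<in> \<Phi>" "nonneg \<gamma>" "\<gamma> \<in> P" "0 < h \<gamma>" and d: "\<delta> \<in> \<Phi>" "nonneg \<delta>" "\<delta> \<in> P" "h \<delta> < 0" for \<gamma> \<delta>
    proof -
      obtain \<gamma>0 where g0: "\<gamma>0 \<in> \<Phi>" "nonneg \<gamma>0" "\<gamma>0 \<in> P" "0 < h \<gamma>0" "(\<Sum>w\<in>V. \<kappa> w * \<gamma>0 w) \<le> 0"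
        using low_root[where h = h, OF b k(1) Pcl[OF _ bP] inv hk hb g] by blast
      obtain \<delta>0 where d0: "\<delta>0 \<in> \<Phi>" "nonneg \<delta>0" "\<delta>0 \<in> P" "0 < - h \<delta>0" "(\<Sum>w\<in>V. \<kappa> w * \<delta>0 w) \<le> 0"
        using low_root[where h = "\<lambda>u. - h u", OF b k(1) Pcl[OF _ bP] inv _ _ d(1-3)] hk hb d(4) by auto
      \<comment> \<open>The weights cancel the value at f0, so v vanishes on all of
        \<open>perp V \<beta>\<close> and is a multiple of \<beta>.\<close>
      define v where "v z = - h \<delta>0 * \<gamma>0 z + h \<gamma>0 * \<delta>0 z" for z
      have van: "- h \<delta>0 * pairing V f \<gamma>0 + h \<gamma>0 * pairing V f \<delta>0 = 0" if "f \<in> perp V \<beta>" for f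
        unfolding res[OF that g0(3)] res[OF that d0(3)] by simp
      have cross: "v z * \<beta> w = v w * \<beta> z" if zw: "z \<in> V" "w \<in> V" for z w
      proof (cases "z = w")
        case False
        define f where "f = Poly_Mapping.single z (real_of_int (\<beta> w)) - Poly_Mapping.single w (real_of_int (\<beta> z))"
        have pf: "pairing V f \<delta> = \<beta> w * \<delta> z - \<beta> z * \<delta> w" for \<delta>
          using zw by (simp add: f_def pairing_diff pairing_single)
        have "f \<in> dual_space V" using zw by (auto simp: dual_space_iff f_def lookup_minus lookup_single when_def)
        then have "f \<in> perp V \<beta>" by (simp add: perp_def pf)
        from van[OF this] show ?thesis unfolding pf v_def by (simp add: algebra_simps)
      qed simp
      obtain w where w: "w \<in> V" "\<beta> w \<noteq> 0" using root_nonzero[OF b(1)] by blast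
      define c where "c = v w / \<beta> w"
      have vc: "v z = c * \<beta> z" if "z \<in> V" for z
        using cross[OF that w(1)] w(2) by (simp add: c_def field_simps)
      obtain z where z: "z \<in> V" "\<gamma>0 z \<noteq> 0" using root_nonzero[OF g0(1)] by blast
      have "0 < - h \<delta>0 * \<gamma>0 z" using z(2) g0(2) d0(4)
        by (intro mult_pos_pos) (auto simp: nonneg_def order_less_le)
      moreover have "0 \<le> h \<gamma>0 * \<delta>0 z" using g0(4) d0(2) by (simp add: nonneg_def)
      ultimately have "0 < c * \<beta> z" using vc[OF z(1)] by (simp add: v_def)
      then have c: "0 < c" using b(2) by (auto simp: zero_less_mult_iff nonneg_def dest: spec[of _ z])
      have "2 * c = c * (\<Sum>w\<in>V. \<kappa> w * \<beta> w)" using k(2) by simp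
      also have "\<dots> = (\<Sum>w\<in>V. \<kappa> w * v w)" using vc by (simp add: sum_distrib_left algebra_simps)
      also have "\<dots> = - h \<delta>0 * (\<Sum>w\<in>V. \<kappa> w * \<gamma>0 w) + h \<gamma>0 * (\<Sum>w\<in>V. \<kappa> w * \<delta>0 w)"
        by (simp add: v_def sum_distrib_left sum.distrib sum_subtractf sum_negf algebra_simps)
      also have "\<dots> \<le> 0"
      proof -
        have "- h \<delta>0 * real_of_int (\<Sum>w\<in>V. \<kappa> w * \<gamma>0 w) \<le> 0"
          using d0(4) g0(5) by (intro mult_nonneg_nonpos) (simp_all only: of_int_le_0_iff less_imp_le)
        moreover have "h \<gamma>0 * real_of_int (\<Sum>w\<in>V. \<kappa> w * \<delta>0 w) \<le> 0"
          using g0(4) d0(5) by (intro mult_nonneg_nonpos) (simp_all only: of_int_le_0_iff less_imp_le)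
        ultimately show ?thesis by linarith
      qed
      finally show False using c by simp
    qed
    obtain s :: real where s: "s \<noteq> 0" "\<forall>\<gamma>\<in>\<Phi>. nonneg \<gamma> \<longrightarrow> \<gamma> \<in> P \<longrightarrow> 0 \<le> s * h \<gamma>"
    proof (cases "\<exists>\<gamma>\<in>\<Phi>. nonneg \<gamma> \<and> \<gamma> \<in> P \<and> 0 < h \<gamma>")
      case True
      then have "\<forall>\<delta>\<in>\<Phi>. nonneg \<delta> \<longrightarrow> \<delta> \<in> P \<longrightarrow> 0 \<le> h \<delta>" using one_sided by (meson not_le)
      then show ?thesis using that[of 1] by simp
    next
      case False
      then show ?thesis using that[of "-1"] by (auto simp: not_less)
    qed
    have f1: "s *\<^sub>R f0 \<in> perp V \<beta> \<inter> D"
      using s(2) f0(1) subspace_scale[OF subspace_perp f0(1)]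
      unfolding D h_def by (auto simp: pairing_scaleR perp_def)
    have L: "perp V \<gamma>\<^sub>1 \<inter> perp V \<beta> \<subseteq> perp V \<beta> \<inter> D"
      unfolding D by (auto simp: P_def perp_def)
    have "perp V \<beta> \<subseteq> span (perp V \<beta> \<inter> D)"
    proof
      fix f assume f: "f \<in> perp V \<beta>"
      define a where "a = pairing V f \<gamma>\<^sub>1 / pairing V f0 \<gamma>\<^sub>1"
      have "f - a *\<^sub>R f0 \<in> perp V \<gamma>\<^sub>1 \<inter> perp V \<beta>"
        unfolding a_def by (rule rank2_functional(2)[OF f0 _ f, of \<gamma>\<^sub>1]) (simp add: perp_def)
      then have "f - a *\<^sub>R f0 \<in> span (perp V \<beta> \<inter> D)" using L by (intro span_base) blast
      moreover have "(a / s) *\<^sub>R (s *\<^sub>R f0) \<in> span (perp V \<beta> \<inter> D)" using f1 by (intro span_scale span_base)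
      then have "a *\<^sub>R f0 \<in> span (perp V \<beta> \<inter> D)" using s(1) by simp
      ultimately have "(f - a *\<^sub>R f0) + a *\<^sub>R f0 \<in> span (perp V \<beta> \<inter> D)" by (rule span_add)
      then show "f \<in> span (perp V \<beta> \<inter> D)" by simp
    qed
    moreover have "span (perp V \<beta> \<inter> D) \<subseteq> perp V \<beta>" by (rule span_minimal[OF _ subspace_perp]) simp
    ultimately show "perp V \<beta> \<in> basic_hyperplanes V ?H" using basic by blast
  qed
qed

lemma rank2_intersection:
  assumes b: "\<beta> \<in> \<Phi>" "nonneg \<beta>" and g1: "\<gamma>\<^sub>1 \<in> \<Phi>" "nonneg \<gamma>\<^sub>1" "\<gamma>\<^sub>1 \<noteq> \<beta>"
    and g: "\<gamma> \<in> \<Phi>" "nonneg \<gamma>" "\<gamma> \<noteq> \<beta>" and P: "\<And>f. f \<in> perp V \<gamma>\<^sub>1 \<inter> perp V \<beta> \<Longrightarrow> pairing V f \<gamma> = 0"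
  shows "perp V \<gamma> \<inter> perp V \<beta> = perp V \<gamma>\<^sub>1 \<inter> perp V \<beta>"
proof
  have "\<not> perp V \<beta> \<subseteq> perp V \<gamma>\<^sub>1" using perp_subset_imp_eq[OF b(1) g1(1) b(2) g1(2)] g1(3) by blast
  then obtain f0 where f0: "f0 \<in> perp V \<beta>" "pairing V f0 \<gamma>\<^sub>1 \<noteq> 0" by (auto simp: perp_def)
  have res: "pairing V f \<gamma> = pairing V f \<gamma>\<^sub>1 / pairing V f0 \<gamma>\<^sub>1 * pairing V f0 \<gamma>" if "f \<in> perp V \<beta>" for f
    by (rule rank2_functional(1)[OF f0 P that])
  have nz: "pairing V f0 \<gamma> \<noteq> 0"
  proof
    assume "pairing V f0 \<gamma> = 0"
    then have "perp V \<beta> \<subseteq> perp V \<gamma>" using res by (auto simp: perp_def)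
    then show False using perp_subset_imp_eq[OF b(1) g(1) b(2) g(2)] g(3) by blast
  qed
  show "perp V \<gamma> \<inter> perp V \<beta> \<subseteq> perp V \<gamma>\<^sub>1 \<inter> perp V \<beta>"
    using res nz f0(2) by (auto simp: perp_def)
  show "perp V \<gamma>\<^sub>1 \<inter> perp V \<beta> \<subseteq> perp V \<gamma> \<inter> perp V \<beta>"
    using P by (auto simp: perp_def)
qed

text \<open>An inversion need not be basic in its rank 2 subarrangement, so its own hyperplane need
  not cut. It suffices that some basic root \<delta> has the same codimension 2 intersection with
  \<open>perp V \<beta>\<close>, and \<open>exists_without_inversions\<close> supplies one.\<close>

theorem fractures_eq:
  assumes b: "\<beta> \<in> \<Phi>" "nonneg \<beta>"
  shows "fractures V A (perp V \<beta>) = (\<lambda>\<gamma>. perp V \<gamma> \<inter> perp V \<beta>) ` inversions V A \<beta>"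
proof (intro equalityI subsetI)
  fix X assume "X \<in> fractures V A (perp V \<beta>)"
  then obtain H1 where X: "X = H1 \<inter> perp V \<beta>" and c: "cuts V A H1 (perp V \<beta>)" by (auto simp: fractures_def)
  obtain \<gamma>1 where g1: "\<gamma>1 \<in> \<Phi>" "nonneg \<gamma>1" "H1 = perp V \<gamma>1" using c root_hyperplaneE unfolding cuts_def by blast
  have ne: "\<gamma>1 \<noteq> \<beta>" using c g1(3) unfolding cuts_def by blast
  let ?P = "{u. \<forall>f\<in>perp V \<gamma>1 \<inter> perp V \<beta>. pairing V f u = 0}"
  have "inversions V A \<beta> \<inter> ?P \<noteq> {}"
    using basic_iff_no_inversions[OF b g1(1,2) ne] c unfolding cuts_def g1(3) by blast
  then obtain \<gamma> where g: "\<gamma> \<in> inversions V A \<beta>" "\<forall>f\<in>perp V \<gamma>1 \<inter> perp V \<beta>. pairing V f \<gamma> = 0" by blast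
  then have "perp V \<gamma> \<inter> perp V \<beta> = X" unfolding X g1(3)
    by (intro rank2_intersection[OF b g1(1,2) ne]) (auto simp: inversions_def)
  then show "X \<in> (\<lambda>\<gamma>. perp V \<gamma> \<inter> perp V \<beta>) ` inversions V A \<beta>" using g(1) by blast
next
  fix X assume "X \<in> (\<lambda>\<gamma>. perp V \<gamma> \<inter> perp V \<beta>) ` inversions V A \<beta>"
  then obtain \<gamma> where g: "\<gamma> \<in> inversions V A \<beta>" and X: "X = perp V \<gamma> \<inter> perp V \<beta>" by blast
  have gr: "\<gamma> \<in> \<Phi>" "nonneg \<gamma>" "\<gamma> \<noteq> \<beta>" using g by (auto simp: inversions_def)
  define P where "P = {u. \<forall>f\<in>X. pairing V f u = 0}"
  have Pcl: "(\<lambda>z. u z - k * v z) \<in> P" if "u \<in> P" "v \<in> P" for u v k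
    using that by (simp add: P_def pairing_vector_diff)
  have bP: "\<beta> \<in> P" and gP: "\<gamma> \<in> P" by (auto simp: P_def X perp_def)
  obtain \<delta> where d: "\<delta> \<in> \<Phi>" "\<delta> \<in> P" "nonneg \<delta>" "inversions V A \<delta> \<inter> P = {}"
    using exists_without_inversions[OF b bP Pcl] by blast
  have db: "\<delta> \<noteq> \<beta>" using d(4) g gP by blast
  have dX: "perp V \<delta> \<inter> perp V \<beta> = X" unfolding X
    by (rule rank2_intersection[OF b gr d(1,3) db]) (use d(2) in \<open>auto simp: P_def X\<close>)
  have P1: "P = {u. \<forall>f\<in>perp V \<delta> \<inter> perp V \<beta>. pairing V f u = 0}" unfolding P_def dX ..
  have P2: "P = {u. \<forall>f\<in>perp V \<beta> \<inter> perp V \<delta>. pairing V f u = 0}" using P1 by (simp add: Int_commute)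
  have "perp V \<beta> \<notin> basic_hyperplanes V (rank2_subarrangement V A (perp V \<delta>) (perp V \<beta>))"
    using basic_iff_no_inversions[OF b d(1,3) db] g gP unfolding P1[symmetric] by blast
  moreover have "perp V \<delta> \<in> basic_hyperplanes V (rank2_subarrangement V A (perp V \<beta>) (perp V \<delta>))"
    using basic_iff_no_inversions[OF d(1,3) b db[symmetric]] d(4) unfolding P2[symmetric] by blast
  moreover have "rank2_subarrangement V A (perp V \<beta>) (perp V \<delta>) = rank2_subarrangement V A (perp V \<delta>) (perp V \<beta>)"
    by (simp add: rank2_subarrangement_def Int_commute)
  moreover have "perp V \<delta> \<noteq> perp V \<beta>" using perp_subset_imp_eq[OF b(1) d(1) b(2) d(3)] db by blast
  ultimately have "cuts V A (perp V \<delta>) (perp V \<beta>)"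
    unfolding cuts_def root_hyperplanes_def using b(1) d(1) by simp
  then show "X \<in> fractures V A (perp V \<beta>)" unfolding fractures_def using dX by blast
qed

end

section \<open>Characteristic polynomials of fibred arrangements\<close>

lemma sum_Pow_neg_one:
  assumes "finite S"
  shows "(\<Sum>B\<in>Pow S. (-1) ^ card B :: 'b::comm_ring_1) = (if S = {} then 1 else 0)"
proof -
  have "(\<Prod>x\<in>S. (1::'b) - 1) = (\<Sum>X\<in>Pow S. (-1) ^ card X * (\<Prod>x\<in>X. 1) * (\<Prod>x\<in>S-X. 1))"
    by (rule prod_diff_conv_sum[OF assms])
  then show ?thesis using assms by (auto simp: power_0_left)
qed

lemma finite_intersection_lattice: "finite \<A> \<Longrightarrow> finite (intersection_lattice E \<A>)"
  by (rule finite_subset[of _ "(\<lambda>\<B>. E \<inter> \<Inter>\<B>) ` Pow \<A>"]) (auto simp: intersection_lattice_def)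

text \<open>Whitney's theorem. The alternating sum satisfies the recursion of the Moebius function:
  summed over all Z containing X it runs over all subsets of the members through X, where the signs
  cancel. An indexed family admits coinciding members, which do occur, since an inversion and its
  partner give the same fracture.\<close>

lemma moebius_whitney:
  assumes I: "finite I" and proper: "\<And>i. i \<in> I \<Longrightarrow> H i \<subset> E"
    and X: "X \<in> intersection_lattice E (H ` I)"
  shows "moebius (intersection_lattice E (H ` I)) E X = (\<Sum>B | B \<subseteq> I \<and> E \<inter> \<Inter>(H ` B) = X. (-1) ^ card B)"
  using X
proof (induction "card {Z \<in> intersection_lattice E (H ` I). X \<subset> Z}" arbitrary: X rule: less_induct)
  case less
  let ?L = "intersection_lattice E (H ` I)"
  define g where "g X = (\<Sum>B | B \<subseteq> I \<and> E \<inter> \<Inter>(H ` B) = X. (-1) ^ card B :: int)" for X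
  have fL: "finite ?L" by (rule finite_intersection_lattice) (use I in simp)
  have XE: "X \<subseteq> E" using less.prems by (auto simp: intersection_lattice_def)
  show ?case
  proof (cases "X = E")
    case True
    have "{B. B \<subseteq> I \<and> E \<inter> \<Inter>(H ` B) = X} = {{}}"
    proof (intro equalityI subsetI)
      fix B assume B: "B \<in> {B. B \<subseteq> I \<and> E \<inter> \<Inter>(H ` B) = X}"
      have "i \<notin> B" for i
      proof
        assume "i \<in> B"
        then have "E \<subseteq> H i" "i \<in> I" using B True by auto
        then show False using proper by blast
      qed
      then show "B \<in> {{}}" by blast
    qed (use True in auto)
    then show ?thesis using True by (simp add: moebius.simps)
  next
    case False
    let ?Z = "{Z. Z \<in> ?L \<and> X \<subset> Z \<and> Z \<subseteq> E}"
    have ZL: "Z \<subseteq> E" if "Z \<in> ?L" for Z using that by (auto simp: intersection_lattice_def)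
    define J where "J = {i \<in> I. X \<subseteq> H i}"
    have J: "finite J" using I by (simp add: J_def)
    have "J \<noteq> {}"
    proof
      assume "J = {}"
      obtain \<B> where "\<B> \<subseteq> H ` I" "X = E \<inter> \<Inter>\<B>" using less.prems by (auto simp: intersection_lattice_def)
      moreover have "\<B> = {}" using calculation \<open>J = {}\<close> unfolding J_def by blast
      ultimately show False using False by simp
    qed
    have "(\<Sum>Z\<in>{Z\<in>?L. X \<subseteq> Z}. g Z) = (\<Sum>Z\<in>{Z\<in>?L. X \<subseteq> Z}. sum (\<lambda>B. (-1) ^ card B) {B. B \<in> Pow J \<and> E \<inter> \<Inter>(H ` B) = Z})"
    proof (rule sum.cong[OF refl])
      fix Z assume "Z \<in> {Z\<in>?L. X \<subseteq> Z}"
      then show "g Z = sum (\<lambda>B. (-1) ^ card B) {B. B \<in> Pow J \<and> E \<inter> \<Inter>(H ` B) = Z}"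
        unfolding g_def J_def by (intro sum.cong) auto
    qed
    also have "\<dots> = (\<Sum>B\<in>Pow J. (-1) ^ card B)"
    proof (rule sum.group)
      show "(\<lambda>B. E \<inter> \<Inter>(H ` B)) ` Pow J \<subseteq> {Z\<in>?L. X \<subseteq> Z}"
      proof (intro subsetI, elim imageE)
        fix Z B assume B: "B \<in> Pow J" and Z: "Z = E \<inter> \<Inter>(H ` B)"
        then have "H ` B \<subseteq> H ` I" "X \<subseteq> Z" using XE by (auto simp: J_def)
        then show "Z \<in> {Z\<in>?L. X \<subseteq> Z}" unfolding intersection_lattice_def Z by blast
      qed
    qed (use J fL in auto)
    also have "\<dots> = 0" using sum_Pow_neg_one[OF J] \<open>J \<noteq> {}\<close> by auto
    finally have z: "(\<Sum>Z\<in>{Z\<in>?L. X \<subseteq> Z}. g Z) = 0" .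
    have "{Z\<in>?L. X \<subseteq> Z} = insert X ?Z" using less.prems ZL by auto
    with z have gX: "g X = - (\<Sum>Z\<in>?Z. g Z)" using fL by simp
    have "moebius ?L E X = - (\<Sum>Z\<in>?Z. moebius ?L E Z)"
      using False XE fL by (subst moebius.simps) auto
    also have "(\<Sum>Z\<in>?Z. moebius ?L E Z) = (\<Sum>Z\<in>?Z. g Z)"
    proof (rule sum.cong[OF refl])
      fix Z assume Z: "Z \<in> ?Z"
      then have "{W \<in> ?L. Z \<subset> W} \<subset> {W \<in> ?L. X \<subset> W}" by blast
      then have "card {W \<in> ?L. Z \<subset> W} < card {W \<in> ?L. X \<subset> W}" using fL by (intro psubset_card_mono) auto
      then show "moebius ?L E Z = g Z" unfolding g_def using Z by (intro less.hyps) auto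
    qed
    finally show ?thesis using gX unfolding g_def by simp
  qed
qed

theorem characteristic_polynomial_whitney:
  assumes I: "finite I" and proper: "\<And>i. i \<in> I \<Longrightarrow> H i \<subset> E"
  shows "characteristic_polynomial E (H ` I) = (\<Sum>B\<in>Pow I. monom ((-1) ^ card B) (dim (E \<inter> \<Inter>(H ` B))))"
proof -
  let ?L = "intersection_lattice E (H ` I)"
  have "characteristic_polynomial E (H ` I) =
    (\<Sum>X\<in>?L. sum (\<lambda>B. monom ((-1) ^ card B) (dim (E \<inter> \<Inter>(H ` B)))) {B. B \<in> Pow I \<and> E \<inter> \<Inter>(H ` B) = X})"
    unfolding characteristic_polynomial_def
  proof (rule sum.cong[OF refl])
    fix X assume X: "X \<in> ?L"
    have "monom (of_int (moebius ?L E X)) (dim X) =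
      (\<Sum>B | B \<subseteq> I \<and> E \<inter> \<Inter>(H ` B) = X. monom ((-1) ^ card B) (dim X) :: real poly)"
    proof -
      have "moebius ?L E X = (\<Sum>B | B \<subseteq> I \<and> E \<inter> \<Inter>(H ` B) = X. (-1) ^ card B)"
        by (rule moebius_whitney[OF I proper X])
      then have "real_of_int (moebius ?L E X) = (\<Sum>B | B \<subseteq> I \<and> E \<inter> \<Inter>(H ` B) = X. (-1) ^ card B)" by simp
      then show ?thesis by (simp only: monom_sum)
    qed
    then show "monom (of_int (moebius ?L E X)) (dim X) =
      sum (\<lambda>B. monom ((-1) ^ card B) (dim (E \<inter> \<Inter>(H ` B))) :: real poly) {B. B \<in> Pow I \<and> E \<inter> \<Inter>(H ` B) = X}"
      by simp
  qed
  also have "\<dots> = (\<Sum>B\<in>Pow I. monom ((-1) ^ card B) (dim (E \<inter> \<Inter>(H ` B))))"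
  proof (rule sum.group)
    show "(\<lambda>B. E \<inter> \<Inter>(H ` B)) ` Pow I \<subseteq> ?L"
      unfolding intersection_lattice_def by blast
  qed (use I finite_intersection_lattice[of "H ` I" E] in auto)
  finally show ?thesis .
qed

text \<open>Moebius inversion, with N built by peeling off a maximal member. For w X = q^(dim X), N
  Y stands for the virtual number of points of Y that lie in no smaller member.\<close>

lemma downset_decomposition:
  fixes w :: "'a set \<Rightarrow> 'b::ab_group_add"
  assumes "finite \<L>"
  shows "\<exists>N. \<forall>X\<in>\<L>. w X = (\<Sum>Y | Y \<in> \<L> \<and> Y \<subseteq> X. N Y)"
  using assms
proof (induction \<L> rule: finite_psubset_induct)
  case (psubset \<L>)
  show ?case
  proof (cases "\<L> = {}")
    case False
    then obtain M where M: "M \<in> \<L>" "\<And>Y. Y \<in> \<L> \<Longrightarrow> M \<subseteq> Y \<Longrightarrow> M = Y"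
      using finite_has_maximal[OF psubset.hyps] by blast
    obtain N where N: "\<forall>X\<in>\<L> - {M}. w X = (\<Sum>Y | Y \<in> \<L> - {M} \<and> Y \<subseteq> X. N Y)"
      using psubset.IH[of "\<L> - {M}"] M(1) by blast
    define N' where "N' = N(M := w M - (\<Sum>Y | Y \<in> \<L> - {M} \<and> Y \<subseteq> M. N Y))"
    have "w X = (\<Sum>Y | Y \<in> \<L> \<and> Y \<subseteq> X. N' Y)" if X: "X \<in> \<L>" for X
    proof (cases "X = M")
      case True
      have "{Y. Y \<in> \<L> \<and> Y \<subseteq> M} = insert M {Y. Y \<in> \<L> - {M} \<and> Y \<subseteq> M}" using M(1) by auto
      moreover have "finite {Y. Y \<in> \<L> - {M} \<and> Y \<subseteq> M}" using psubset.hyps by simp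
      moreover have "(\<Sum>Y | Y \<in> \<L> - {M} \<and> Y \<subseteq> M. N' Y) = (\<Sum>Y | Y \<in> \<L> - {M} \<and> Y \<subseteq> M. N Y)"
        by (rule sum.cong) (auto simp: N'_def)
      ultimately show ?thesis using True by (simp add: N'_def)
    next
      case False
      then have "{Y. Y \<in> \<L> \<and> Y \<subseteq> X} = {Y. Y \<in> \<L> - {M} \<and> Y \<subseteq> X}" using M(2) X by auto
      then show ?thesis using N False X by (auto simp: N'_def intro!: sum.cong)
    qed
    then show ?thesis by blast
  qed simp
qed

text \<open>Inclusion-exclusion for one fibre coordinate that must avoid the values g a: the empty
  subset contributes q, and the nonempty subsets of each level set of g contribute -1 in total, so
  coinciding values count once.\<close>

lemma sum_constant_subsets:
  fixes q :: "'b::comm_ring_1"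
  assumes T: "finite T"
  shows "(\<Sum>c | c \<subseteq> T \<and> (\<forall>a\<in>c. \<forall>b\<in>c. g a = g b). (-1) ^ card c * (if c = {} then q else 1)) = q - of_nat (card (g ` T))"
proof -
  let ?K = "\<lambda>v. {a \<in> T. g a = v}"
  let ?f = "\<lambda>c. (-1) ^ card c * (if c = {} then q else 1)"
  have set: "{c. c \<subseteq> T \<and> (\<forall>a\<in>c. \<forall>b\<in>c. g a = g b)} = insert {} (\<Union>v\<in>g ` T. Pow (?K v) - {{}})"
  proof (intro equalityI subsetI)
    fix c assume c: "c \<in> {c. c \<subseteq> T \<and> (\<forall>a\<in>c. \<forall>b\<in>c. g a = g b)}"
    show "c \<in> insert {} (\<Union>v\<in>g ` T. Pow (?K v) - {{}})"
    proof (cases "c = {}")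
      case False
      then obtain a where "a \<in> c" by blast
      then have "g a \<in> g ` T" "c \<in> Pow (?K (g a)) - {{}}" using c False by blast+
      then show ?thesis by blast
    qed simp
  next
    fix c assume "c \<in> insert {} (\<Union>v\<in>g ` T. Pow (?K v) - {{}})"
    then consider "c = {}" | v where "c \<subseteq> ?K v" by blast
    then show "c \<in> {c. c \<subseteq> T \<and> (\<forall>a\<in>c. \<forall>b\<in>c. g a = g b)}"
    proof cases
      case 2
      then have "c \<subseteq> T" "\<forall>a\<in>c. g a = v" by blast+
      then show ?thesis by simp
    qed simp
  qed
  have fin: "finite (\<Union>v\<in>g ` T. Pow (?K v) - {{}})" using T by simp
  have "(\<Sum>c\<in>(\<Union>v\<in>g ` T. Pow (?K v) - {{}}). ?f c) = (\<Sum>v\<in>g ` T. \<Sum>c\<in>Pow (?K v) - {{}}. ?f c)"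
  proof (rule sum.UNION_disjoint)
    show "\<forall>v\<in>g ` T. \<forall>v'\<in>g ` T. v \<noteq> v' \<longrightarrow> (Pow (?K v) - {{}}) \<inter> (Pow (?K v') - {{}}) = {}"
    proof (intro ballI impI equals0I)
      fix v v' c assume "v \<noteq> v'" and c: "c \<in> (Pow (?K v) - {{}}) \<inter> (Pow (?K v') - {{}})"
      then obtain a where "a \<in> c" by auto
      then have "g a = v" "g a = v'" using c by auto
      then show False using \<open>v \<noteq> v'\<close> by simp
    qed
  qed (use T in auto)
  also have "\<dots> = (\<Sum>v\<in>g ` T. -1)"
  proof (rule sum.cong[OF refl])
    fix v assume v: "v \<in> g ` T"
    have "(\<Sum>c\<in>Pow (?K v) - {{}}. ?f c) = (\<Sum>c\<in>Pow (?K v) - {{}}. (-1) ^ card c)" by (rule sum.cong) auto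
    also have "\<dots> = (\<Sum>c\<in>Pow (?K v). (-1) ^ card c) - 1" using T by (simp add: sum_diff1)
    also have "(\<Sum>c\<in>Pow (?K v). (-1) ^ card c :: 'b) = 0"
    proof -
      have "?K v \<noteq> {}" using v by blast
      then show ?thesis by (subst sum_Pow_neg_one) (use T in simp_all)
    qed
    finally show "(\<Sum>c\<in>Pow (?K v) - {{}}. ?f c) = -1" by simp
  qed
  finally have S: "(\<Sum>c\<in>(\<Union>v\<in>g ` T. Pow (?K v) - {{}}). ?f c) = - of_nat (card (g ` T))" by simp
  have "(\<Sum>c\<in>insert {} (\<Union>v\<in>g ` T. Pow (?K v) - {{}}). ?f c) = q + (\<Sum>c\<in>(\<Union>v\<in>g ` T. Pow (?K v) - {{}}). ?f c)"
    by (subst sum.insert[OF fin]) auto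
  then show ?thesis unfolding set S by simp
qed

lemma sum_Pow_Plus_Times:
  fixes h :: "('f + nat \<times> 't) set \<Rightarrow> 'b::comm_monoid_add"
  shows "(\<Sum>B\<in>Pow (F <+> {1..n} \<times> T). h B) = (\<Sum>(B0, C)\<in>Pow F \<times> PiE {1..n} (\<lambda>_. Pow T). h (B0 <+> Sigma {1..n} C))"
proof (rule sum.reindex_bij_witness[where i = "\<lambda>(B0, C). B0 <+> Sigma {1..n} C"
      and j = "\<lambda>B. (Inl -` B, \<lambda>j\<in>{1..n}. {a. Inr (j, a) \<in> B})"])
  fix B assume B: "B \<in> Pow (F <+> {1..n} \<times> T)"
  show e: "(case (Inl -` B, \<lambda>j\<in>{1..n}. {a. Inr (j, a) \<in> B}) of (B0, C) \<Rightarrow> B0 <+> Sigma {1..n} C) = B"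
    using B by (auto simp: Plus_def image_iff)
  show "(Inl -` B, \<lambda>j\<in>{1..n}. {a. Inr (j, a) \<in> B}) \<in> Pow F \<times> PiE {1..n} (\<lambda>_. Pow T)"
    using B by auto
  show "(case (Inl -` B, \<lambda>j\<in>{1..n}. {a. Inr (j, a) \<in> B}) of (B0, C) \<Rightarrow> h (B0 <+> Sigma {1..n} C)) = h B"
    using e by simp
next
  fix p assume p: "p \<in> Pow F \<times> PiE {1..n} (\<lambda>_. Pow T)"
  obtain B0 C where pC: "p = (B0, C)" by (cases p)
  have "Inl -` (B0 <+> Sigma {1..n} C) = B0" by auto
  moreover have "(\<lambda>j\<in>{1..n}. {a. Inr (j, a) \<in> B0 <+> Sigma {1..n} C}) = C"
    using p pC by (auto simp: fun_eq_iff restrict_def PiE_def extensional_def)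
  ultimately show "(Inl -` (case p of (B0, C) \<Rightarrow> B0 <+> Sigma {1..n} C),
      \<lambda>j\<in>{1..n}. {a. Inr (j, a) \<in> (case p of (B0, C) \<Rightarrow> B0 <+> Sigma {1..n} C)}) = p" by (simp add: pC)
  show "(case p of (B0, C) \<Rightarrow> B0 <+> Sigma {1..n} C) \<in> Pow (F <+> {1..n} \<times> T)"
    using p pC by (auto simp: PiE_iff)
qed

text \<open>
  The points of the base \<open>U\<close> are grouped into strata \<open>Y\<close> with virtual point count \<open>N Y\<close>; over a
  stratum, each of the \<open>n\<close> fibre coordinates must avoid as many values as there are distinct
  functions \<open>l a\<close> on it. This is the finite field method with the counting replaced by
  inclusion-exclusion.
\<close>

theorem characteristic_polynomial_fibred:
  fixes E :: "nat \<Rightarrow> 'e::real_vector set" and H :: "nat \<Rightarrow> 'f + nat \<times> 't \<Rightarrow> 'e set"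
    and U :: "'a set" and G :: "'f \<Rightarrow> 'a set" and l :: "'t \<Rightarrow> 'a \<Rightarrow> real" and d :: "'a set \<Rightarrow> nat"
  assumes F: "finite F" and T: "finite T" and t: "card T \<le> 2 * t"
    and pair: "\<And>a. a \<in> T \<Longrightarrow> \<exists>b\<in>T. b \<noteq> a \<and> (\<forall>u\<in>U. l a u = l b u)"
    and proper: "\<And>n i. n \<ge> 1 \<Longrightarrow> i \<in> F <+> {1..n} \<times> T \<Longrightarrow> H n i \<subset> E n"
    and dim: "\<And>n B0 C. n \<ge> 1 \<Longrightarrow> B0 \<subseteq> F \<Longrightarrow> (\<And>j. j \<in> {1..n} \<Longrightarrow> C j \<subseteq> T) \<Longrightarrow>
      dim (E n \<inter> \<Inter>(H n ` (B0 <+> Sigma {1..n} C))) =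
        d {u \<in> U. (\<forall>i\<in>B0. u \<in> G i) \<and> (\<forall>j\<in>{1..n}. \<forall>a\<in>C j. \<forall>b\<in>C j. l a u = l b u)} + card {j \<in> {1..n}. C j = {}}"
  shows "\<exists>p. \<forall>n\<ge>1. characteristic_polynomial (E n) (H n ` (F <+> {1..n} \<times> T)) =
    (\<Sum>k = 0..t. p k * [:- real k, 1:] ^ n)"
proof -
  define X where "X B0 Q = {u \<in> U. (\<forall>i\<in>B0. u \<in> G i) \<and> (\<forall>(a, b)\<in>Q. l a u = l b u)}" for B0 Q
  define \<L> where "\<L> = (\<lambda>(B0, Q). X B0 Q) ` (Pow F \<times> Pow (T \<times> T))"
  have fL: "finite \<L>" unfolding \<L>_def using F T by simp
  obtain N where N: "\<forall>Z\<in>\<L>. monom (1::real) (d Z) = (\<Sum>Y | Y \<in> \<L> \<and> Y \<subseteq> Z. N Y)"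
    using downset_decomposition[OF fL, of "\<lambda>Z. monom (1::real) (d Z)"] by blast
  \<comment> \<open>Extension by zero off the stratum makes agreement on \<open>Y\<close> an
    equality of functions, so distinct ones can be counted by a cardinality.\<close>
  define g where "g Y a = (\<lambda>u. if u \<in> Y then l a u else 0)" for Y a
  define k where "k Y = card (g Y ` T)" for Y
  define e where "e Y = (\<Sum>B0 | B0 \<subseteq> F \<and> (\<forall>i\<in>B0. Y \<subseteq> G i). (-1) ^ card B0 :: real poly)" for Y
  define q where "q = [:0, 1 :: real:]"
  have YU: "Y \<subseteq> U" if "Y \<in> \<L>" for Y using that by (auto simp: \<L>_def X_def)
  have gconst: "g Y a = g Y b \<longleftrightarrow> (\<forall>u\<in>Y. l a u = l b u)" for Y a b
    by (auto simp: g_def fun_eq_iff)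
  have main: "characteristic_polynomial (E n) (H n ` (F <+> {1..n} \<times> T)) = (\<Sum>Y\<in>\<L>. N Y * e Y * (q - of_nat (k Y)) ^ n)"
    if n: "n \<ge> 1" for n
  proof -
    let ?P = "PiE {1..n} (\<lambda>_. Pow T)"
    have fP: "finite ?P" using T by (intro finite_PiE) auto
    let ?f = "\<lambda>c. (-1) ^ card c * (if c = {} then q else 1)"
    define cn where "cn Y c \<longleftrightarrow> (\<forall>a\<in>c. \<forall>b\<in>c. g Y a = g Y b)" for Y c
    define io where "io Y B0 \<longleftrightarrow> (\<forall>i\<in>B0. Y \<subseteq> G i)" for Y B0
    \<comment> \<open>Two facts decouple the fibre coordinates: each unconstrained one contributes a
      factor q to the monomial, and a stratum lies in the base locus exactly if it satisfies the
      base conditions and the functions in each single \<open>C j\<close> agree on it.\<close>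
    have summand: "monom ((-1) ^ card (B0 <+> Sigma {1..n} C)) (dim (E n \<inter> \<Inter>(H n ` (B0 <+> Sigma {1..n} C))))
      = (\<Sum>Y\<in>\<L>. N Y * (if io Y B0 then (-1) ^ card B0 else 0) * (\<Prod>j\<in>{1..n}. if cn Y (C j) then ?f (C j) else 0))"
      if B0: "B0 \<in> Pow F" and C: "C \<in> ?P" for B0 C
    proof -
      have Cj: "C j \<subseteq> T" if "j \<in> {1..n}" for j using C that by (auto simp: PiE_iff)
      have fin: "finite B0" "finite (C j)" if "j \<in> {1..n}" for j
        using B0 F finite_subset[OF Cj[OF that] T] by (auto intro: finite_subset)
      let ?Q = "\<Union>j\<in>{1..n}. C j \<times> C j"
      have XX: "{u \<in> U. (\<forall>i\<in>B0. u \<in> G i) \<and> (\<forall>j\<in>{1..n}. \<forall>a\<in>C j. \<forall>b\<in>C j. l a u = l b u)} = X B0 ?Q"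
        unfolding X_def by blast
      have XL: "X B0 ?Q \<in> \<L>" unfolding \<L>_def using B0 Cj by (intro image_eqI[of _ _ "(B0, ?Q)"]) (simp, blast)
      have YX: "Y \<subseteq> X B0 ?Q \<longleftrightarrow> io Y B0 \<and> (\<forall>j\<in>{1..n}. cn Y (C j))" if "Y \<in> \<L>" for Y
        using YU[OF that] unfolding X_def cn_def io_def gconst by blast
      have "card (B0 <+> Sigma {1..n} C) = card B0 + (\<Sum>j\<in>{1..n}. card (C j))"
        using fin n B0 F by (subst card_Plus) (auto intro: finite_subset simp: card_SigmaI)
      then have sgn: "(-1) ^ card (B0 <+> Sigma {1..n} C) = ((-1) ^ card B0 * (\<Prod>j\<in>{1..n}. (-1) ^ card (C j)) :: real poly)"
        by (simp add: power_add power_sum)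
      have qp: "monom 1 (card {j \<in> {1..n}. C j = {}}) = (\<Prod>j\<in>{1..n}. if C j = {} then q else 1)"
        by (simp add: prod.If_cases monom_altdef q_def Int_def)
      have "monom ((-1) ^ card (B0 <+> Sigma {1..n} C)) (dim (E n \<inter> \<Inter>(H n ` (B0 <+> Sigma {1..n} C))))
        = (-1) ^ card (B0 <+> Sigma {1..n} C) * (monom 1 (d (X B0 ?Q)) * monom (1::real) (card {j \<in> {1..n}. C j = {}}))"
      proof -
        have m: "monom ((-1) ^ a) b = (-1) ^ a * monom (1::real) b" for a b :: nat
          by (cases "even a") (auto simp: minus_monom)
        have "dim (E n \<inter> \<Inter>(H n ` (B0 <+> Sigma {1..n} C))) = d (X B0 ?Q) + card {j \<in> {1..n}. C j = {}}"
          using dim[OF n, of B0 C] B0 Cj unfolding XX by blast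
        then show ?thesis unfolding m by (simp add: mult_monom)
      qed
      also have "\<dots> = monom 1 (d (X B0 ?Q)) * ((-1) ^ card B0 * (\<Prod>j\<in>{1..n}. ?f (C j)))"
        unfolding sgn qp prod.distrib by (simp add: algebra_simps)
      also have "monom 1 (d (X B0 ?Q)) = (\<Sum>Y\<in>\<L>. if Y \<subseteq> X B0 ?Q then N Y else 0)"
        using N XL fL by (simp add: sum.inter_filter)
      also have "\<dots> * ((-1) ^ card B0 * (\<Prod>j\<in>{1..n}. ?f (C j))) =
        (\<Sum>Y\<in>\<L>. N Y * (if io Y B0 then (-1) ^ card B0 else 0) * (\<Prod>j\<in>{1..n}. if cn Y (C j) then ?f (C j) else 0))"
        unfolding sum_distrib_right
      proof (rule sum.cong[OF refl])
        fix Y assume Y: "Y \<in> \<L>"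
        show "(if Y \<subseteq> X B0 ?Q then N Y else 0) * ((-1) ^ card B0 * (\<Prod>j\<in>{1..n}. ?f (C j))) =
          N Y * (if io Y B0 then (-1) ^ card B0 else 0) * (\<Prod>j\<in>{1..n}. if cn Y (C j) then ?f (C j) else 0)"
        proof (cases "io Y B0 \<and> (\<forall>j\<in>{1..n}. cn Y (C j))")
          case True
          then have "(\<Prod>j\<in>{1..n}. if cn Y (C j) then ?f (C j) else 0) = (\<Prod>j\<in>{1..n}. ?f (C j))"
            by (intro prod.cong) auto
          moreover have "Y \<subseteq> X B0 ?Q" "io Y B0" using True YX[OF Y] by blast+
          ultimately show ?thesis by (simp only: if_True mult.assoc)
        next
          case False
          then consider "\<not> io Y B0" | j where "j \<in> {1..n}" "\<not> cn Y (C j)" by blast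
          then have "(if io Y B0 then (-1) ^ card B0 else 0) * (\<Prod>j\<in>{1..n}. if cn Y (C j) then ?f (C j) else 0) = 0"
          proof cases
            case 2
            then have "(\<Prod>j\<in>{1..n}. if cn Y (C j) then ?f (C j) else 0) = 0"
              by (intro prod_zero bexI[of _ j]) auto
            then show ?thesis by simp
          qed auto
          moreover have "\<not> Y \<subseteq> X B0 ?Q" using False YX[OF Y] by blast
          ultimately show ?thesis by (simp only: if_False mult.assoc mult_zero_left mult_zero_right)
        qed
      qed
      finally show ?thesis .
    qed
    have "characteristic_polynomial (E n) (H n ` (F <+> {1..n} \<times> T)) =
      (\<Sum>B\<in>Pow (F <+> {1..n} \<times> T). monom ((-1) ^ card B) (dim (E n \<inter> \<Inter>(H n ` B))))"
      by (rule characteristic_polynomial_whitney) (use F T proper[OF n] in auto)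
    also have "\<dots> = (\<Sum>(B0, C)\<in>Pow F \<times> ?P. monom ((-1) ^ card (B0 <+> Sigma {1..n} C)) (dim (E n \<inter> \<Inter>(H n ` (B0 <+> Sigma {1..n} C)))))"
      by (rule sum_Pow_Plus_Times)
    also have "\<dots> = (\<Sum>(B0, C)\<in>Pow F \<times> ?P. \<Sum>Y\<in>\<L>. N Y * (if io Y B0 then (-1) ^ card B0 else 0) *
        (\<Prod>j\<in>{1..n}. if cn Y (C j) then ?f (C j) else 0))"
      by (rule sum.cong[OF refl]) (use summand in auto)
    also have "\<dots> = (\<Sum>B0\<in>Pow F. \<Sum>C\<in>?P. \<Sum>Y\<in>\<L>. N Y * (if io Y B0 then (-1) ^ card B0 else 0) *
        (\<Prod>j\<in>{1..n}. if cn Y (C j) then ?f (C j) else 0))"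
      by (rule sum.cartesian_product[symmetric])
    also have "\<dots> = (\<Sum>Y\<in>\<L>. \<Sum>B0\<in>Pow F. \<Sum>C\<in>?P. N Y * (if io Y B0 then (-1) ^ card B0 else 0) *
        (\<Prod>j\<in>{1..n}. if cn Y (C j) then ?f (C j) else 0))"
      by (subst (2) sum.swap, subst sum.swap) (rule refl)
    also have "\<dots> = (\<Sum>Y\<in>\<L>. N Y * (\<Sum>B0\<in>Pow F. if io Y B0 then (-1) ^ card B0 else 0) *
        (\<Sum>C\<in>?P. \<Prod>j\<in>{1..n}. if cn Y (C j) then ?f (C j) else 0))"
      by (simp only: sum_distrib_left[symmetric] sum_distrib_right[symmetric])
    also have "\<dots> = (\<Sum>Y\<in>\<L>. N Y * e Y * (q - of_nat (k Y)) ^ n)"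
    proof (rule sum.cong[OF refl])
      fix Y
      have "(\<Sum>C\<in>?P. \<Prod>j\<in>{1..n}. if cn Y (C j) then ?f (C j) else 0) =
        (\<Prod>j\<in>{1..n}. \<Sum>c\<in>Pow T. if cn Y c then ?f c else 0)"
        by (rule prod_sum_PiE[symmetric]) (use T in auto)
      also have "(\<Sum>c\<in>Pow T. if cn Y c then ?f c else 0) = (\<Sum>c | c \<subseteq> T \<and> cn Y c. ?f c)"
        using T by (simp add: sum.inter_filter[symmetric] Pow_def)
      also have "\<dots> = q - of_nat (k Y)" unfolding k_def cn_def by (rule sum_constant_subsets[OF T])
      finally have "(\<Sum>C\<in>?P. \<Prod>j\<in>{1..n}. if cn Y (C j) then ?f (C j) else 0) = (q - of_nat (k Y)) ^ n" by simp
      moreover have "(\<Sum>B0\<in>Pow F. if io Y B0 then (-1) ^ card B0 else 0) = e Y"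
        unfolding e_def io_def[symmetric] using F by (simp add: sum.inter_filter[symmetric] Pow_def)
      ultimately show "N Y * (\<Sum>B0\<in>Pow F. if io Y B0 then (-1) ^ card B0 else 0) *
        (\<Sum>C\<in>?P. \<Prod>j\<in>{1..n}. if cn Y (C j) then ?f (C j) else 0) = N Y * e Y * (q - of_nat (k Y)) ^ n" by simp
    qed
    finally show ?thesis .
  qed
  have kt: "k Y \<in> {0..t}" if Y: "Y \<in> \<L>" for Y
  proof -
    \<comment> \<open>The twin of an index lies in the same level set, so every level set has at
      least two elements.\<close>
    have "2 * k Y = (\<Sum>v\<in>g Y ` T. 2)" by (simp add: k_def)
    also have "\<dots> \<le> (\<Sum>v\<in>g Y ` T. card {a. a \<in> T \<and> g Y a = v})"
    proof (rule sum_mono)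
      fix v assume "v \<in> g Y ` T"
      then obtain a where a: "a \<in> T" "v = g Y a" by blast
      then obtain b where b: "b \<in> T" "b \<noteq> a" "\<forall>u\<in>U. l a u = l b u" using pair by blast
      have "g Y b = v" unfolding a(2) gconst using b(3) YU[OF Y] by auto
      then have "{a, b} \<subseteq> {a. a \<in> T \<and> g Y a = v}" using a b by auto
      from card_mono[OF _ this] show "2 \<le> card {a. a \<in> T \<and> g Y a = v}" using T b(2) by simp
    qed
    also have "\<dots> = card T"
      using sum.group[OF T, of "g Y ` T" "g Y" "\<lambda>_. 1::nat"] T by simp
    finally show ?thesis using t by simp
  qed
  define p where "p j = (\<Sum>Y | Y \<in> \<L> \<and> k Y = j. N Y * e Y)" for j
  have "characteristic_polynomial (E n) (H n ` (F <+> {1..n} \<times> T)) = (\<Sum>k = 0..t. p k * [:- real k, 1:] ^ n)"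
    if n: "n \<ge> 1" for n
  proof -
    have qk: "q - of_nat j = [:- real j, 1:]" for j by (simp add: q_def of_nat_poly)
    have "(\<Sum>Y\<in>\<L>. N Y * e Y * (q - of_nat (k Y)) ^ n) = (\<Sum>j\<in>{0..t}. \<Sum>Y | Y \<in> \<L> \<and> k Y = j. N Y * e Y * (q - of_nat (k Y)) ^ n)"
      by (rule sum.group[symmetric]) (use fL kt in auto)
    also have "\<dots> = (\<Sum>j = 0..t. p j * [:- real j, 1:] ^ n)"
      unfolding p_def sum_distrib_right qk by (intro sum.cong) auto
    finally show ?thesis using main[OF n] by simp
  qed
  then show ?thesis by blast
qed

section \<open>Inversions of stretched roots\<close>

text \<open>These are the positive type A roots carried by the path.\<close>

fun path_interval :: "nat \<Rightarrow> nat \<Rightarrow> 'v stretched \<Rightarrow> int" where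
  "path_interval a b (Old y) = 0"
| "path_interval a b (Path i) = (if a \<le> i \<and> i \<le> b then 1 else 0)"

text \<open>The palindromic word of the reflection in \<open>path_interval a b\<close>; for a = 0
  and b = n it takes over the role of the letter x.\<close>

definition interval_word :: "nat \<Rightarrow> nat \<Rightarrow> 'v stretched list" where
  "interval_word a b = map Path [a..<b] @ Path b # rev (map Path [a..<b])"

text \<open>Transports vectors from the path x_0, x_1 to the path x_0, ..., x_n, with the cut
  directly in front of x_j. The default beyond n keeps the path support within the vertex
  set.\<close>

fun split_vector :: "nat \<Rightarrow> nat \<Rightarrow> ('v stretched \<Rightarrow> int) \<Rightarrow> 'v stretched \<Rightarrow> int" where
  "split_vector n j h (Old y) = h (Old y)"
| "split_vector n j h (Path i) = (if n < i then 0 else if i < j then h (Path 0) else h (Path 1))"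

definition stretch_word :: "'v \<Rightarrow> nat \<Rightarrow> 'v list \<Rightarrow> 'v stretched list" where
  "stretch_word x n ys = concat (map (\<lambda>y. if y = x then interval_word 0 n else [Old y]) ys)"

section \<open>Identities for stretched words, split vectors and stretched vectors\<close>

lemma rev_interval_word: "rev (interval_word a b) = interval_word a b"
  by (simp add: interval_word_def)

lemma rev_stretch_word: "rev (stretch_word x n ys) = stretch_word x n (rev ys)"
  by (simp add: stretch_word_def rev_concat rev_map[symmetric] comp_def if_distrib rev_interval_word cong: if_cong)

lemma stretch_word_append: "stretch_word x n (ys @ zs) = stretch_word x n ys @ stretch_word x n zs"
  by (simp add: stretch_word_def)

lemma split_vector_sub:
  "split_vector n j (\<lambda>v. f v - c * g v) = (\<lambda>v. split_vector n j f v - c * split_vector n j g v)"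
proof
  show "split_vector n j (\<lambda>v. f v - c * g v) v = split_vector n j f v - c * split_vector n j g v" for v
    by (cases v) auto
qed

lemma split_vector_simple_Old: "split_vector n j (simple_root (Old y)) = simple_root (Old y)"
proof
  show "split_vector n j (simple_root (Old y)) v = simple_root (Old y) v" for v
    by (cases v) (auto simp: simple_root_def)
qed

lemma split_vector_simple_Path_0:
  assumes "1 \<le> j" "j \<le> n"
  shows "split_vector n j (simple_root (Path 0)) = path_interval 0 (j - 1)"
proof
  show "split_vector n j (simple_root (Path 0)) v = path_interval 0 (j - 1) v" for v
    using assms by (cases v) (auto simp: simple_root_def)
qed

lemma split_vector_simple_Path_1:
  assumes "1 \<le> j" "j \<le> n"
  shows "split_vector n j (simple_root (Path 1)) = path_interval j n"
proof
  show "split_vector n j (simple_root (Path 1)) v = path_interval j n v" for v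
    using assms by (cases v) (auto simp: simple_root_def)
qed

lemma split_vector_path_interval: "split_vector n j (path_interval 0 1) = path_interval 0 n"
proof
  show "split_vector n j (path_interval 0 1) v = path_interval 0 n v" for v
    by (cases v) auto
qed

lemma split_vector_st_vector: "split_vector n j (st_vector x 1 f) = st_vector x n f"
proof
  show "split_vector n j (st_vector x 1 f) v = st_vector x n f v" for v
    by (cases v) auto
qed

lemma st_vector_sub: "st_vector x n (\<lambda>v. f v - c * g v) = (\<lambda>v. st_vector x n f v - c * st_vector x n g v)"
proof
  show "st_vector x n (\<lambda>v. f v - c * g v) v = st_vector x n f v - c * st_vector x n g v" for v
    by (cases v) auto
qed

lemma st_vector_simple: "y \<noteq> x \<Longrightarrow> st_vector x n (simple_root y) = simple_root (Old y)"
proof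
  show "st_vector x n (simple_root y) v = simple_root (Old y) v" if "y \<noteq> x" for v
    using that by (cases v) (auto simp: simple_root_def)
qed

lemma st_vector_simple_x: "st_vector x n (simple_root x) = path_interval 0 n"
proof
  show "st_vector x n (simple_root x) v = path_interval 0 n v" for v
    by (cases v) (auto simp: simple_root_def)
qed

text \<open>Telescoping; neighbours beyond either end of the path count as 0, so for the full path
  only the two end values remain.\<close>

lemma sum_second_difference:
  fixes g :: "nat \<Rightarrow> int"
  assumes "a \<le> b" "b \<le> n"
  shows "(\<Sum>k = a..b. 2 * g k - (if k = 0 then 0 else g (k - 1)) - (if k = n then 0 else g (Suc k))) =
    g a - (if a = 0 then 0 else g (a - 1)) + g b - (if b = n then 0 else g (Suc b))"
  using assms
proof (induction b rule: dec_induct)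
  case base
  then show ?case by simp
next
  case (step b)
  then show ?case by simp
qed

lemma path_row_sum:
  fixes g :: "nat \<Rightarrow> int"
  assumes "k \<le> n"
  shows "(\<Sum>l = 0..n. (if k = l then 2 else if k = Suc l \<or> l = Suc k then - 1 else 0) * g l) =
    2 * g k - (if k = 0 then 0 else g (k - 1)) - (if k = n then 0 else g (Suc k))"
proof -
  have "(\<Sum>l = 0..n. (if k = l then 2 else if k = Suc l \<or> l = Suc k then - 1 else 0) * g l) =
    (\<Sum>l = 0..n. (if l = k then 2 * g l else 0) - (if l = k - 1 \<and> k \<noteq> 0 then g l else 0) - (if l = Suc k then g l else 0))"
    by (rule sum.cong) auto
  also have "\<dots> = (\<Sum>l = 0..n. if l = k then 2 * g l else 0) - (\<Sum>l = 0..n. if l = k - 1 \<and> k \<noteq> 0 then g l else 0)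
     - (\<Sum>l = 0..n. if l = Suc k then g l else 0)"
    by (simp only: sum_subtractf)
  also have "(\<Sum>l = 0..n. if l = k - 1 \<and> k \<noteq> 0 then g l else 0) = (if k = 0 then 0 else g (k - 1))"
    using assms by (cases "k = 0") auto
  finally show ?thesis using assms by simp
qed

context gcm
begin

text \<open>Reading from the right, where the image of \<gamma> turns from positive to negative it
  must be the simple root of the letter being applied.\<close>

lemma inversion_of_word:
  assumes "set zs \<subseteq> V" "\<gamma> \<in> \<Phi>" "nonneg \<gamma>" "nonpos (act V A zs \<gamma>)"
  obtains pre z suf where "zs = pre @ z # suf" "act V A suf \<gamma> = simple_root z"
proof -
  have "\<exists>pre z suf. zs = pre @ z # suf \<and> act V A suf \<gamma> = simple_root z"
    using assms
  proof (induction zs)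
    case Nil
    then show ?case using nonneg_nonpos_root[OF Nil.prems(2,3)] by simp
  next
    case (Cons z zs)
    have z: "z \<in> V" "set zs \<subseteq> V" using Cons.prems(1) by auto
    have r: "act V A zs \<gamma> \<in> \<Phi>" by (rule act_root[OF z(2) Cons.prems(2)])
    show ?case
    proof (cases "nonpos (act V A zs \<gamma>)")
      case True
      then obtain pre z' suf where "zs = pre @ z' # suf" "act V A suf \<gamma> = simple_root z'"
        using Cons.IH[OF z(2) Cons.prems(2,3)] by blast
      then show ?thesis by (intro exI[of _ "z # pre"] exI[of _ z'] exI[of _ suf]) simp
    next
      case False
      then have n: "nonneg (act V A zs \<gamma>)" using root_sign[OF r] by blast
      have np: "nonpos (simple_reflection V A z (act V A zs \<gamma>))" using Cons.prems(4) by simp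
      have "act V A zs \<gamma> = simple_root z"
        using nonneg_refl[OF r n z(1)] np nonneg_nonpos_root[OF root_system.reflect[OF r z(1)]] by blast
      then show ?thesis by (intro exI[of _ "[]"] exI[of _ z] exI[of _ zs]) simp
    qed
  qed
  then show thesis using that by blast
qed

end

text \<open>The neighbours of x are read off \<open>A\<close>; for a crystallographic Cartan matrix
  of the diagram they are the same as those given by the edge labels.\<close>

locale stretching = gcm V A for V :: "'v set" and A :: "'v \<Rightarrow> 'v \<Rightarrow> int" +
  fixes x :: 'v and L R :: "'v set"
  assumes x: "x \<in> V" and LR: "L \<union> R = {y \<in> V. y \<noteq> x \<and> A x y \<noteq> 0}" "L \<inter> R = {}"
begin

context
  notes One_nat_def [simp del]
begin

abbreviation "V' \<equiv> st_vertices V x"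
abbreviation "A' \<equiv> st_cartan A x L R"
abbreviation "\<phi>' n \<equiv> cform (V' n) (A' n)"
abbreviation "\<Phi>' n \<equiv> root_system (V' n) (A' n)"

lemma A_zero: "y \<in> V \<Longrightarrow> y \<noteq> x \<Longrightarrow> y \<notin> L \<union> R \<Longrightarrow> A x y = 0 \<and> A y x = 0"
  using LR zero_sym[OF x, of y] by blast

lemma LR_subset: "L \<subseteq> V - {x}" "R \<subseteq> V - {x}"
  using LR by blast+

lemma gcm_stretch: "gcm (V' n) (A' n)"
proof
  show "finite (V' n)" by (simp add: st_vertices_def)
  show "A' n y y = 2" if "y \<in> V' n" for y
    using that diag by (auto simp: st_vertices_def)
  show "A' n y z \<le> 0" if "y \<in> V' n" "z \<in> V' n" "y \<noteq> z" for y z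
    using that offdiag x by (cases y; cases z) (auto simp: st_vertices_def)
  show "A' n z y = 0" if "y \<in> V' n" "z \<in> V' n" "A' n y z = 0" for y z
    using that zero_sym x by (cases y; cases z) (auto simp: st_vertices_def split: if_splits)
qed

lemma Old_mem [simp]: "Old y \<in> V' n \<longleftrightarrow> y \<in> V \<and> y \<noteq> x"
  by (auto simp: st_vertices_def)

lemma Path_mem [simp]: "Path i \<in> V' n \<longleftrightarrow> i \<le> n"
  by (auto simp: st_vertices_def)

lemma sum_stretched: "(\<Sum>v\<in>V' n. f v) = (\<Sum>y\<in>V - {x}. f (Old y)) + (\<Sum>i = 0..n. f (Path i))"
proof -
  have "(\<Sum>v\<in>V' n. f v) = (\<Sum>v\<in>Old ` (V - {x}). f v) + (\<Sum>v\<in>Path ` {0..n}. f v)"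
    unfolding st_vertices_def by (rule sum.union_disjoint) auto
  then show ?thesis by (simp add: sum.reindex inj_on_def)
qed

section \<open>Coroots of the stretched system and reflections in path intervals\<close>

lemma cform_Old:
  assumes "y \<in> V" "y \<noteq> x"
  shows "\<phi>' n (Old y) g = (\<Sum>z\<in>V - {x}. A y z * g (Old z)) + (if y \<in> L then A y x * g (Path 0) else 0)
    + (if y \<in> R then A y x * g (Path n) else 0)"
proof -
  have "(\<Sum>i = 0..n. A' n (Old y) (Path i) * g (Path i)) =
    (\<Sum>i = 0..n. (if i = 0 then if y \<in> L then A y x * g (Path i) else 0 else 0) + (if i = n then if y \<in> R then A y x * g (Path i) else 0 else 0))"
    using LR(2) by (intro sum.cong) auto
  also have "\<dots> = (if y \<in> L then A y x * g (Path 0) else 0) + (if y \<in> R then A y x * g (Path n) else 0)"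
    by (simp only: sum.distrib) simp
  finally show ?thesis by (simp add: cform_def sum_stretched)
qed

lemma cform_Path:
  assumes "k \<le> n"
  shows "\<phi>' n (Path k) g = 2 * g (Path k) - (if k = 0 then 0 else g (Path (k - 1))) - (if k = n then 0 else g (Path (Suc k)))
    + (if k = 0 then \<Sum>z\<in>L. A x z * g (Old z) else 0) + (if k = n then \<Sum>z\<in>R. A x z * g (Old z) else 0)"
proof -
  have "(\<Sum>z\<in>V - {x}. A' n (Path k) (Old z) * g (Old z)) =
    (\<Sum>z\<in>V - {x}. (if z \<in> L then (if k = 0 then A x z * g (Old z) else 0) else 0) + (if z \<in> R then (if k = n then A x z * g (Old z) else 0) else 0))"
    using LR(2) by (intro sum.cong) auto
  also have "\<dots> = (\<Sum>z\<in>L. if k = 0 then A x z * g (Old z) else 0) + (\<Sum>z\<in>R. if k = n then A x z * g (Old z) else 0)"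
    unfolding sum.distrib using LR_subset by (simp add: sum.inter_restrict[symmetric] Int_absorb1)
  also have "\<dots> = (if k = 0 then \<Sum>z\<in>L. A x z * g (Old z) else 0) + (if k = n then \<Sum>z\<in>R. A x z * g (Old z) else 0)"
    by auto
  finally show ?thesis
    using path_row_sum[OF assms, of "\<lambda>l. g (Path l)"] by (simp add: cform_def sum_stretched)
qed

text \<open>The path is simply laced, so the coroot of \<open>path_interval a b\<close> is the sum
  of the simple coroots along it. The sum telescopes to the ends of the interval, their outer
  neighbours and the old neighbours at the ends of the path.\<close>

lemma sum_cform_Path:
  assumes "a \<le> b" "b \<le> n"
  shows "(\<Sum>k = a..b. \<phi>' n (Path k) g) =
    g (Path a) - (if a = 0 then 0 else g (Path (a - 1))) + g (Path b) - (if b = n then 0 else g (Path (Suc b)))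
    + (if a = 0 then \<Sum>z\<in>L. A x z * g (Old z) else 0) + (if b = n then \<Sum>z\<in>R. A x z * g (Old z) else 0)"
proof -
  have "(\<Sum>k = a..b. \<phi>' n (Path k) g) =
    (\<Sum>k = a..b. (2 * g (Path k) - (if k = 0 then 0 else g (Path (k - 1))) - (if k = n then 0 else g (Path (Suc k))))
    + (if k = 0 then \<Sum>z\<in>L. A x z * g (Old z) else 0) + (if k = n then \<Sum>z\<in>R. A x z * g (Old z) else 0))"
    by (rule sum.cong) (use assms in \<open>auto simp: cform_Path\<close>)
  also have "\<dots> = (\<Sum>k = a..b. 2 * g (Path k) - (if k = 0 then 0 else g (Path (k - 1))) - (if k = n then 0 else g (Path (Suc k))))
    + (\<Sum>k = a..b. if k = 0 then \<Sum>z\<in>L. A x z * g (Old z) else 0) + (\<Sum>k = a..b. if k = n then \<Sum>z\<in>R. A x z * g (Old z) else 0)"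
    by (simp only: sum.distrib)
  also have "(\<Sum>k = a..b. if k = 0 then \<Sum>z\<in>L. A x z * g (Old z) else 0) = (if a = 0 then \<Sum>z\<in>L. A x z * g (Old z) else 0)"
    using assms by (simp add: sum.delta)
  also have "(\<Sum>k = a..b. if k = n then \<Sum>z\<in>R. A x z * g (Old z) else 0) = (if b = n then \<Sum>z\<in>R. A x z * g (Old z) else 0)"
    using assms by (auto simp: sum.delta)
  finally show ?thesis using sum_second_difference[OF assms, of "\<lambda>k. g (Path k)"] by simp
qed

lemma path_interval_word:
  assumes "a \<le> b" "b \<le> n"
  shows "act (V' n) (A' n) (map Path [a..<b]) (simple_root (Path b)) = path_interval a b"
  using assms
proof (induction a rule: inc_induct)
  case base
  have "simple_root (Path b) v = path_interval b b v" for v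
    by (cases v) (auto simp: simple_root_def)
  then show ?case by auto
next
  case (step a)
  interpret n: gcm "V' n" "A' n" by (rule gcm_stretch)
  have "[a..<b] = a # [Suc a..<b]" using step by (simp add: upt_rec)
  then have "act (V' n) (A' n) (map Path [a..<b]) (simple_root (Path b)) = simple_reflection (V' n) (A' n) (Path a) (path_interval (Suc a) b)"
    using step by simp
  also have "\<dots> = (\<lambda>v. path_interval (Suc a) b v - \<phi>' n (Path a) (path_interval (Suc a) b) * simple_root (Path a) v)"
    using step by (simp add: n.refl_eq)
  also have "\<phi>' n (Path a) (path_interval (Suc a) b) = -1"
    using step by (cases a) (auto simp: cform_Path)
  also have "(\<lambda>v. path_interval (Suc a) b v - -1 * simple_root (Path a) v) = path_interval a b"
  proof
    show "path_interval (Suc a) b v - -1 * simple_root (Path a) v = path_interval a b v" for v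
      using step by (cases v) (auto simp: simple_root_def)
  qed
  finally show ?case .
qed

text \<open>Conjugation replaces the coroot of x_b by that of the interval: reflecting in x_a adds
  the value at x_a to the value at the next vertex and leaves the later ones alone.\<close>

lemma interval_word_sum:
  assumes "a \<le> b" "b \<le> n"
  shows "\<phi>' n (Path b) (act (V' n) (A' n) (rev (map Path [a..<b])) f) = (\<Sum>k = a..b. \<phi>' n (Path k) f)"
  using assms
proof (induction a arbitrary: f rule: inc_induct)
  case (step a)
  interpret n: gcm "V' n" "A' n" by (rule gcm_stretch)
  let ?f = "simple_reflection (V' n) (A' n) (Path a) f"
  have "[a..<b] = a # [Suc a..<b]" using step by (simp add: upt_rec)
  then have "\<phi>' n (Path b) (act (V' n) (A' n) (rev (map Path [a..<b])) f) = (\<Sum>k = Suc a..b. \<phi>' n (Path k) ?f)"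
    using step by simp
  also have "\<dots> = (\<Sum>k = Suc a..b. \<phi>' n (Path k) f + (if k = Suc a then \<phi>' n (Path a) f else 0))"
    by (rule sum.cong) (use step in \<open>auto simp: n.refl_eq n.cform_sub n.cform_simple\<close>)
  also have "\<dots> = (\<Sum>k = Suc a..b. \<phi>' n (Path k) f) + \<phi>' n (Path a) f"
    unfolding sum.distrib using step by simp
  also have "\<dots> = (\<Sum>k = a..b. \<phi>' n (Path k) f)"
    using step by (simp add: sum.atLeast_Suc_atMost)
  finally show ?case .
qed simp

lemma set_interval_word: "b \<le> n \<Longrightarrow> set (interval_word a b) \<subseteq> V' n"
  by (auto simp: interval_word_def)

lemma act_interval_word:
  assumes "a \<le> b" "b \<le> n"
  shows "act (V' n) (A' n) (interval_word a b) f = (\<lambda>v. f v - (\<Sum>k = a..b. \<phi>' n (Path k) f) * path_interval a b v)"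
proof -
  interpret n: gcm "V' n" "A' n" by (rule gcm_stretch)
  have "set (map Path [a..<b]) \<subseteq> V' n" "Path b \<in> V' n" using assms by auto
  from n.reflection_word[OF this, of f] show ?thesis
    unfolding interval_word_def path_interval_word[OF assms] interval_word_sum[OF assms] .
qed

lemma path_interval_root:
  assumes "a \<le> b" "b \<le> n"
  shows "path_interval a b \<in> \<Phi>' n"
proof -
  interpret n: gcm "V' n" "A' n" by (rule gcm_stretch)
  show ?thesis unfolding path_interval_word[OF assms, symmetric]
    by (rule n.act_root) (use assms in \<open>auto intro: root_system.simple\<close>)
qed

lemma set_stretch_word: "set ys \<subseteq> V \<Longrightarrow> set (stretch_word x n ys) \<subseteq> V' n"
  using set_interval_word[of n n 0] by (auto simp: stretch_word_def split: if_splits)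

text \<open>Old vertices see only the two ends of the path, and 1 \<le> j \<le> n puts x_0 before
  the cut and x_n behind it.\<close>

lemma split_reflect_Old:
  assumes "y \<in> V" "y \<noteq> x" "1 \<le> j" "j \<le> n"
  shows "simple_reflection (V' n) (A' n) (Old y) (split_vector n j h) = split_vector n j (simple_reflection (V' 1) (A' 1) (Old y) h)"
proof -
  interpret n: gcm "V' n" "A' n" by (rule gcm_stretch)
  interpret one: gcm "V' 1" "A' 1" by (rule gcm_stretch)
  have "\<phi>' n (Old y) (split_vector n j h) = \<phi>' 1 (Old y) h"
    using assms by (simp add: cform_Old)
  then show ?thesis using assms by (simp add: n.refl_eq one.refl_eq split_vector_sub split_vector_simple_Old)
qed

text \<open>The simple root of x_0 in the short path becomes the root of the segment before the cut.
  The coroot of that segment sees the old neighbours in \<open>L\<close> and the jump at the cut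
  exactly as in the short path; the constant values inside the segment drop out.\<close>

lemma split_reflect_Path_0:
  assumes "1 \<le> j" "j \<le> n"
  shows "act (V' n) (A' n) (interval_word 0 (j - 1)) (split_vector n j h) = split_vector n j (simple_reflection (V' 1) (A' 1) (Path 0) h)"
proof -
  interpret one: gcm "V' 1" "A' 1" by (rule gcm_stretch)
  have "(\<Sum>k = 0..j - 1. \<phi>' n (Path k) (split_vector n j h)) = \<phi>' 1 (Path 0) h"
    using assms by (subst sum_cform_Path) (auto simp: cform_Path One_nat_def)
  then show ?thesis using assms
    by (simp add: act_interval_word one.refl_eq split_vector_sub split_vector_simple_Path_0)
qed

lemma split_reflect_Path_1:
  assumes "1 \<le> j" "j \<le> n"
  shows "act (V' n) (A' n) (interval_word j n) (split_vector n j h) = split_vector n j (simple_reflection (V' 1) (A' 1) (Path 1) h)"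
proof -
  interpret one: gcm "V' 1" "A' 1" by (rule gcm_stretch)
  have "(\<Sum>k = j..n. \<phi>' n (Path k) (split_vector n j h)) = \<phi>' 1 (Path 1) h"
    using assms by (subst sum_cform_Path) (auto simp: cform_Path)
  then show ?thesis using assms
    by (simp add: act_interval_word one.refl_eq split_vector_sub split_vector_simple_Path_1)
qed

text \<open>For the full path the cut is interior and disappears from the telescoped sum, so the
  stretched letter x is compatible with every cut at once.\<close>

lemma split_reflect_path:
  assumes "1 \<le> j" "j \<le> n"
  shows "act (V' n) (A' n) (interval_word 0 n) (split_vector n j h) = split_vector n j (act (V' 1) (A' 1) (interval_word 0 1) h)"
proof -
  have "(\<Sum>k = 0..n. \<phi>' n (Path k) (split_vector n j h)) = (\<Sum>k = 0..1. \<phi>' 1 (Path k) h)"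
    using assms sum_cform_Path[of 0 n n] sum_cform_Path[of 0 1 1] by simp
  then show ?thesis using act_interval_word[of 0 n n] act_interval_word[of 0 1 1]
    by (simp add: split_vector_sub split_vector_path_interval)
qed

text \<open>Induction along reflections, where a reflection in x_0 or x_1 is realized by the
  interval word of the segment before or behind the cut.\<close>

lemma split_vector_root:
  assumes j: "1 \<le> j" "j \<le> n" and h: "h \<in> \<Phi>' 1"
  shows "split_vector n j h \<in> \<Phi>' n"
proof -
  interpret n: gcm "V' n" "A' n" by (rule gcm_stretch)
  show ?thesis using h
  proof induction
    case (simple v)
    then consider y where "v = Old y" "y \<in> V" "y \<noteq> x" | "v = Path 0" | "v = Path 1"
      by (cases v) (auto simp: le_Suc_eq One_nat_def)
    then show ?case
    proof cases
      case 1
      then show ?thesis using root_system.simple[of "Old y" "V' n" "A' n"] by (simp add: split_vector_simple_Old)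
    next
      case 2
      then show ?thesis using path_interval_root[of 0 "j - 1" n] j by (simp add: split_vector_simple_Path_0)
    next
      case 3
      then show ?thesis using path_interval_root[of j n n] j by (simp add: split_vector_simple_Path_1)
    qed
  next
    case (reflect h v)
    then consider y where "v = Old y" "y \<in> V" "y \<noteq> x" | "v = Path 0" | "v = Path 1"
      by (cases v) (auto simp: le_Suc_eq One_nat_def)
    then show ?case
    proof cases
      case 1
      then show ?thesis using split_reflect_Old[OF 1(2,3) j, of h] root_system.reflect[OF reflect.IH, of "Old y"] by simp
    next
      case 2
      then show ?thesis using split_reflect_Path_0[OF j, of h] n.act_root[OF set_interval_word reflect.IH, of "j - 1" 0] j by simp
    next
      case 3
      then show ?thesis using split_reflect_Path_1[OF j, of h] n.act_root[OF set_interval_word reflect.IH, of n j] by simp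
    qed
  qed
qed

lemma split_stretch_word:
  assumes j: "1 \<le> j" "j \<le> n" and "set ys \<subseteq> V"
  shows "act (V' n) (A' n) (stretch_word x n ys) (split_vector n j h) = split_vector n j (act (V' 1) (A' 1) (stretch_word x 1 ys) h)"
  using assms(3)
proof (induction ys)
  case Nil
  then show ?case by (simp add: stretch_word_def)
next
  case (Cons y ys)
  let ?h = "act (V' 1) (A' 1) (stretch_word x 1 ys) h"
  have e: "stretch_word x k (y # ys) = (if y = x then interval_word 0 k else [Old y]) @ stretch_word x k ys" for k
    by (simp add: stretch_word_def)
  have "act (V' n) (A' n) (stretch_word x n (y # ys)) (split_vector n j h) =
    act (V' n) (A' n) (if y = x then interval_word 0 n else [Old y]) (split_vector n j ?h)"
    using Cons by (simp only: e foldr_append) simp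
  also have "\<dots> = split_vector n j (act (V' 1) (A' 1) (if y = x then interval_word 0 1 else [Old y]) ?h)"
    using split_reflect_path[OF j] split_reflect_Old[OF _ _ j] Cons.prems by simp
  also have "\<dots> = split_vector n j (act (V' 1) (A' 1) (stretch_word x 1 (y # ys)) h)"
    by (simp only: e foldr_append)
  finally show ?case .
qed

text \<open>A stretched vector is constant along the path, so for the letter x the telescoped sum is
  2 f(x) plus the contributions of \<open>L\<close> and \<open>R\<close>, which is the value of the
  coroot of x on f.\<close>

lemma stretch_reflect:
  assumes "y \<in> V"
  shows "act (V' n) (A' n) (if y = x then interval_word 0 n else [Old y]) (st_vector x n f) = st_vector x n (simple_reflection V A y f)"
proof (cases "y = x")
  case True
  have "\<phi> x f = (\<Sum>z\<in>V - {x}. A x z * f z) + 2 * f x"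
    unfolding cform_def using x diag by (subst sum.remove[of V x]) auto
  also have "(\<Sum>z\<in>V - {x}. A x z * f z) = (\<Sum>z\<in>L \<union> R. A x z * f z)"
    using LR_subset A_zero by (intro sum.mono_neutral_right) auto
  also have "\<dots> = (\<Sum>z\<in>L. A x z * f z) + (\<Sum>z\<in>R. A x z * f z)"
    using LR(2) LR_subset by (intro sum.union_disjoint) (auto intro: finite_subset[of _ "V - {x}"])
  also have "(\<Sum>z\<in>L. A x z * f z) = (\<Sum>z\<in>L. A x z * st_vector x n f (Old z))" using LR_subset by (intro sum.cong) auto
  also have "(\<Sum>z\<in>R. A x z * f z) = (\<Sum>z\<in>R. A x z * st_vector x n f (Old z))" using LR_subset by (intro sum.cong) auto
  finally have "(\<Sum>k = 0..n. \<phi>' n (Path k) (st_vector x n f)) = \<phi> x f"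
    by (subst sum_cform_Path) auto
  then show ?thesis using True x by (simp add: act_interval_word refl_eq st_vector_sub st_vector_simple_x)
next
  case False
  interpret n: gcm "V' n" "A' n" by (rule gcm_stretch)
  have "\<phi> y f = (\<Sum>z\<in>V - {x}. A y z * f z) + A y x * f x"
    unfolding cform_def using x by (subst sum.remove[of V x]) auto
  also have "(\<Sum>z\<in>V - {x}. A y z * f z) = (\<Sum>z\<in>V - {x}. A y z * st_vector x n f (Old z))" by (intro sum.cong) auto
  finally have "\<phi>' n (Old y) (st_vector x n f) = \<phi> y f"
    using A_zero[of y] LR(2) False assms by (auto simp: cform_Old)
  then show ?thesis using False assms by (simp add: n.refl_eq refl_eq st_vector_sub st_vector_simple)
qed

lemma stretch_act:
  "set ys \<subseteq> V \<Longrightarrow> act (V' n) (A' n) (stretch_word x n ys) (st_vector x n f) = st_vector x n (act V A ys f)"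
proof (induction ys)
  case Nil
  then show ?case by (simp add: stretch_word_def)
next
  case (Cons y ys)
  have "stretch_word x n (y # ys) = (if y = x then interval_word 0 n else [Old y]) @ stretch_word x n ys"
    by (simp add: stretch_word_def)
  then show ?case using Cons stretch_reflect[of y n] by (simp only: foldr_append) simp
qed

text \<open>Stretching a palindromic word gives a palindromic word. If its centre is x, the new
  centre is x_n, because the full path root is an image of the simple root of x_n.\<close>

lemma stretched_reflection:
  assumes ys: "set ys \<subseteq> V" "y \<in> V" and \<gamma>: "\<gamma> \<in> \<Phi>' n"
  shows "root_reflection (V' n) (A' n) (st_vector x n (act V A ys (simple_root y))) \<gamma> =
    act (V' n) (A' n) (stretch_word x n (ys @ y # rev ys)) \<gamma>"
    "st_vector x n (act V A ys (simple_root y)) \<in> \<Phi>' n"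
proof -
  interpret n: gcm "V' n" "A' n" by (rule gcm_stretch)
  obtain w c where w: "set w \<subseteq> V' n" "c \<in> V' n" "st_vector x n (act V A ys (simple_root y)) = act (V' n) (A' n) w (simple_root c)"
    "stretch_word x n (ys @ y # rev ys) = w @ c # rev w"
  proof (cases "y = x")
    case True
    show ?thesis
    proof (rule that[of "stretch_word x n ys @ map Path [0..<n]" "Path n"])
      show "set (stretch_word x n ys @ map Path [0..<n]) \<subseteq> V' n" using set_stretch_word[OF ys(1)] by auto
      show "stretch_word x n (ys @ y # rev ys) = (stretch_word x n ys @ map Path [0..<n]) @ Path n # rev (stretch_word x n ys @ map Path [0..<n])"
        using True by (simp add: stretch_word_append rev_stretch_word) (simp add: stretch_word_def interval_word_def)
      show "st_vector x n (act V A ys (simple_root y)) = act (V' n) (A' n) (stretch_word x n ys @ map Path [0..<n]) (simple_root (Path n))"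
        using stretch_act[OF ys(1), of n "simple_root y"] True by (simp add: path_interval_word st_vector_simple_x)
    qed simp
  next
    case False
    show ?thesis
    proof (rule that[of "stretch_word x n ys" "Old y"])
      show "stretch_word x n (ys @ y # rev ys) = stretch_word x n ys @ Old y # rev (stretch_word x n ys)"
        using False by (simp add: stretch_word_append rev_stretch_word) (simp add: stretch_word_def)
      show "st_vector x n (act V A ys (simple_root y)) = act (V' n) (A' n) (stretch_word x n ys) (simple_root (Old y))"
        using stretch_act[OF ys(1), of n "simple_root y"] False by (simp add: st_vector_simple)
    qed (use False ys set_stretch_word in auto)
  qed
  show "root_reflection (V' n) (A' n) (st_vector x n (act V A ys (simple_root y))) \<gamma> =
    act (V' n) (A' n) (stretch_word x n (ys @ y # rev ys)) \<gamma>"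
    unfolding w(3,4) by (rule n.root_reflection_eq[OF w(1,2) \<gamma>])
  show "st_vector x n (act V A ys (simple_root y)) \<in> \<Phi>' n"
    unfolding w(3) by (rule n.act_root[OF w(1) root_system.simple[OF w(2)]])
qed

text \<open>The letter x stretches to 2n + 1 letters. A sign change within the right part x_n, ...,
  x_0 happens for an initial segment of the path, a split vector with its cut just behind the
  segment (for the full path any cut will do). If the sign changes in the left part, the image under
  the whole word is the negative of a proper initial segment, and applying the same reflection again
  recovers the root without moving the cut.\<close>

lemma letter_inversion:
  assumes n: "1 \<le> n" and y: "y \<in> V" and \<gamma>: "\<gamma> \<in> \<Phi>' n" "nonneg \<gamma>"
    and np: "nonpos (act (V' n) (A' n) (if y = x then interval_word 0 n else [Old y]) \<gamma>)"
  shows "\<exists>j\<in>{1..n}. \<exists>h\<in>\<Phi>' 1. \<gamma> = split_vector n j h"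
proof -
  interpret n: gcm "V' n" "A' n" by (rule gcm_stretch)
  interpret one: gcm "V' 1" "A' 1" by (rule gcm_stretch)
  show ?thesis
  proof (cases "y = x")
    case False
    then have "\<gamma> = simple_root (Old y)"
      using n.nonneg_refl[OF \<gamma>, of "Old y"] n.nonneg_nonpos_root[OF root_system.reflect[OF \<gamma>(1), of "Old y"]] np y by auto
    then have "\<gamma> = split_vector n 1 (simple_root (Old y))" by (simp add: split_vector_simple_Old)
    moreover have "simple_root (Old y) \<in> \<Phi>' 1" using False y by (intro root_system.simple) simp
    ultimately show ?thesis using n by (intro bexI[of _ 1] bexI[of _ "simple_root (Old y)"]) auto
  next
    case True
    define W :: "'v stretched list" where "W = map Path [0..<Suc n]"
    define B :: "'v stretched list" where "B = map Path [0..<n]"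
    have WV: "set W \<subseteq> V' n" "set B \<subseteq> V' n" by (auto simp: W_def B_def)
    have iw: "interval_word 0 n = B @ rev W" by (simp add: interval_word_def W_def B_def)
    show ?thesis
    proof (cases "nonpos (act (V' n) (A' n) (rev W) \<gamma>)")
      case True
      obtain pre z suf where s: "rev W = pre @ z # suf" "act (V' n) (A' n) suf \<gamma> = simple_root z"
        using n.inversion_of_word[OF _ \<gamma> True] WV by auto
      have W: "W = rev suf @ z # rev pre" using arg_cong[OF s(1), of rev] by simp
      define i where "i = length suf"
      have i: "i < Suc n" using arg_cong[OF W, of length] by (simp add: W_def i_def)
      have "rev suf = take i W" using W by (simp add: i_def)
      also have "\<dots> = map Path [0..<i]" using i by (simp add: W_def take_map)
      finally have suf: "rev suf = map Path [0..<i]" .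
      have "z = W ! i" using W by (simp add: i_def nth_append)
      then have z: "z = Path i" using i by (simp add: W_def del: upt_Suc)
      have "set suf \<subseteq> V' n" using WV W by auto
      then have "\<gamma> = act (V' n) (A' n) (rev suf) (simple_root z)" using s(2) n.act_rev by metis
      then have g: "\<gamma> = path_interval 0 i" unfolding suf z using path_interval_word[of 0 i n] i by simp
      show ?thesis
      proof (cases "i = n")
        case True
        then have "\<gamma> = split_vector n 1 (path_interval 0 1)" using g by (simp only: split_vector_path_interval)
        then show ?thesis using n path_interval_root[of 0 1 1]
          by (intro bexI[of _ 1] bexI[of _ "path_interval 0 1"]) auto
      next
        case False
        then have "\<gamma> = split_vector n (Suc i) (simple_root (Path 0))" using g i by (simp add: split_vector_simple_Path_0)
        then show ?thesis using i False by (intro bexI[of _ "Suc i"] bexI[of _ "simple_root (Path 0)"] root_system.simple) auto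
      qed
    next
      case False
      let ?g = "act (V' n) (A' n) (rev W) \<gamma>"
      have gr: "?g \<in> \<Phi>' n" by (rule n.act_root) (use WV \<gamma> in auto)
      have gn: "nonneg ?g" using False n.root_sign[OF gr] by blast
      have "nonpos (act (V' n) (A' n) B ?g)" using np True iw by simp
      then obtain pre z suf where s: "B = pre @ z # suf" "act (V' n) (A' n) suf ?g = simple_root z"
        using n.inversion_of_word[OF WV(2) gr gn] by blast
      define i where "i = length pre"
      have i: "i < n" using arg_cong[OF s(1), of length] by (simp add: B_def i_def)
      have "pre = take i B" using s(1) by (simp add: i_def)
      then have pre: "pre = map Path [0..<i]" using i by (simp add: B_def take_map)
      have "z = B ! i" using s(1) by (simp add: i_def nth_append)
      then have z: "z = Path i" using i by (simp add: B_def)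
      have preV: "set pre \<subseteq> V' n" using s(1) WV by auto
      have "act (V' n) (A' n) (interval_word 0 n) \<gamma> = act (V' n) (A' n) pre (\<lambda>v. - simple_root z v)"
        unfolding iw s(1) using s(2) z i n.refl_simple[of "Path i"] by simp
      also have "\<dots> = (\<lambda>v. - path_interval 0 i v)"
        using n.act_uminus[OF preV] path_interval_word[of 0 i n] i unfolding pre z by simp
      also have "path_interval 0 i = split_vector n (Suc i) (simple_root (Path 0))"
        using i by (simp add: split_vector_simple_Path_0)
      also have "(\<lambda>v. - split_vector n (Suc i) (simple_root (Path 0)) v) = split_vector n (Suc i) (\<lambda>v. - simple_root (Path 0) v)"
      proof
        show "- split_vector n (Suc i) (simple_root (Path 0)) v = split_vector n (Suc i) (\<lambda>v. - simple_root (Path 0) v) v" for v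
          by (cases v) auto
      qed
      finally have e: "act (V' n) (A' n) (interval_word 0 n) \<gamma> = split_vector n (Suc i) (\<lambda>v. - simple_root (Path 0) v)" .
      have "\<gamma> = act (V' n) (A' n) (interval_word 0 n) (act (V' n) (A' n) (interval_word 0 n) \<gamma>)"
        using n.act_rev[OF set_interval_word, of n 0 \<gamma>] by (simp add: rev_interval_word)
      also have "\<dots> = split_vector n (Suc i) (act (V' 1) (A' 1) (interval_word 0 1) (\<lambda>v. - simple_root (Path 0) v))"
        unfolding e using i by (intro split_reflect_path) auto
      finally have g: "\<gamma> = split_vector n (Suc i) (act (V' 1) (A' 1) (interval_word 0 1) (\<lambda>v. - simple_root (Path 0) v))" .
      have "act (V' 1) (A' 1) (interval_word 0 1) (\<lambda>v. - simple_root (Path 0) v) \<in> \<Phi>' 1"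
        by (intro one.act_root set_interval_word one.root_uminus root_system.simple) auto
      with g i show ?thesis by (intro bexI[of _ "Suc i"]) auto
    qed
  qed
qed

text \<open>At the letter where the sign changes, the image of \<gamma> is a split vector by
  \<open>letter_inversion\<close>; undoing the letters to its right changes only the short-path
  vector and never the cut.\<close>

lemma word_inversion:
  assumes n: "1 \<le> n" and zs: "set zs \<subseteq> V" and \<gamma>: "\<gamma> \<in> \<Phi>' n" "nonneg \<gamma>"
    and np: "nonpos (act (V' n) (A' n) (stretch_word x n zs) \<gamma>)"
  shows "\<exists>j\<in>{1..n}. \<exists>h\<in>\<Phi>' 1. \<gamma> = split_vector n j h"
  using zs np
proof (induction zs)
  case Nil
  interpret n: gcm "V' n" "A' n" by (rule gcm_stretch)
  show ?case using Nil n.nonneg_nonpos_root[OF \<gamma>] by (simp add: stretch_word_def)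
next
  case (Cons z zs)
  interpret n: gcm "V' n" "A' n" by (rule gcm_stretch)
  interpret one: gcm "V' 1" "A' 1" by (rule gcm_stretch)
  have z: "z \<in> V" "set zs \<subseteq> V" using Cons.prems(1) by auto
  let ?g = "act (V' n) (A' n) (stretch_word x n zs) \<gamma>"
  have gr: "?g \<in> \<Phi>' n" by (rule n.act_root[OF set_stretch_word[OF z(2)] \<gamma>(1)])
  show ?case
  proof (cases "nonpos ?g")
    case False
    then have gn: "nonneg ?g" using n.root_sign[OF gr] by blast
    have "stretch_word x n (z # zs) = (if z = x then interval_word 0 n else [Old z]) @ stretch_word x n zs"
      by (simp add: stretch_word_def)
    then have "nonpos (act (V' n) (A' n) (if z = x then interval_word 0 n else [Old z]) ?g)"
      using Cons.prems(2) by (simp only: foldr_append)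
    then obtain j h where jh: "j \<in> {1..n}" "h \<in> \<Phi>' 1" "?g = split_vector n j h"
      using letter_inversion[OF n z(1) gr gn] by blast
    have "\<gamma> = act (V' n) (A' n) (stretch_word x n (rev zs)) ?g"
      using n.act_rev[OF set_stretch_word[OF z(2), of n], of \<gamma>] by (simp add: rev_stretch_word)
    also have "\<dots> = split_vector n j (act (V' 1) (A' 1) (stretch_word x 1 (rev zs)) h)"
      unfolding jh(3) using jh(1) z(2) by (intro split_stretch_word) auto
    finally have "\<gamma> = split_vector n j (act (V' 1) (A' 1) (stretch_word x 1 (rev zs)) h)" .
    moreover have "act (V' 1) (A' 1) (stretch_word x 1 (rev zs)) h \<in> \<Phi>' 1"
      by (rule one.act_root[OF set_stretch_word jh(2)]) (use z in auto)
    ultimately show ?thesis using jh(1) by blast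
  qed (rule Cons.IH[OF z(2)])
qed

text \<open>Up to the value 0 both vectors take the same values, so no sign is gained or
  lost.\<close>

lemma split_vector_signs:
  assumes "1 \<le> j" "j \<le> n" "h \<in> \<Phi>' 1"
  shows "nonneg (split_vector n j h) \<longleftrightarrow> nonneg h" "nonpos (split_vector n j h) \<longleftrightarrow> nonpos h"
proof -
  interpret one: gcm "V' 1" "A' 1" by (rule gcm_stretch)
  have r: "range (split_vector n j h) \<subseteq> insert 0 (range h)"
  proof (intro subsetI, elim rangeE)
    show "c \<in> insert 0 (range h)" if "c = split_vector n j h v" for c v using that by (cases v) auto
  qed
  have "h v \<in> insert 0 (range (split_vector n j h))" for v
  proof (cases v)
    case (Old y)
    have "h v = split_vector n j h (Old y)" using Old by simp
    then show ?thesis by blast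
  next
    case (Path i)
    consider "i = 0" | "i = 1" | "i > 1" by linarith
    then show ?thesis
    proof cases
      case 1
      have "h v = split_vector n j h (Path 0)" using 1 Path assms by simp
      then show ?thesis by blast
    next
      case 2
      have "h v = split_vector n j h (Path n)" using 2 Path assms by simp
      then show ?thesis by blast
    next
      case 3
      then show ?thesis using one.root_support[OF assms(3), of v] Path by simp
    qed
  qed
  then have r': "range h \<subseteq> insert 0 (range (split_vector n j h))" by blast
  show "nonneg (split_vector n j h) \<longleftrightarrow> nonneg h" unfolding nonneg_def
  proof (intro iffI allI)
    show "0 \<le> h z" if "\<forall>z. 0 \<le> split_vector n j h z" for z
      using r'[THEN subsetD, of "h z"] that by auto
    show "0 \<le> split_vector n j h z" if "\<forall>z. 0 \<le> h z" for z
      using r[THEN subsetD, of "split_vector n j h z"] that by auto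
  qed
  show "nonpos (split_vector n j h) \<longleftrightarrow> nonpos h" unfolding nonpos_def
  proof (intro iffI allI)
    show "h z \<le> 0" if "\<forall>z. split_vector n j h z \<le> 0" for z
      using r'[THEN subsetD, of "h z"] that by auto
    show "split_vector n j h z \<le> 0" if "\<forall>z. h z \<le> 0" for z
      using r[THEN subsetD, of "split_vector n j h z"] that by auto
  qed
qed

lemma split_vector_inj:
  assumes "1 \<le> j" "j \<le> n" "h \<in> \<Phi>' 1" "h' \<in> \<Phi>' 1" "split_vector n j h = split_vector n j h'"
  shows "h = h'"
proof
  interpret one: gcm "V' 1" "A' 1" by (rule gcm_stretch)
  fix v
  show "h v = h' v"
  proof (cases v)
    case (Old y)
    then show ?thesis using fun_cong[OF assms(5), of "Old y"] by simp
  next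
    case (Path i)
    consider "i = 0" | "i = 1" | "i > 1" by linarith
    then show ?thesis
    proof cases
      case 1
      then show ?thesis using Path assms(1,2) fun_cong[OF assms(5), of "Path 0"] by simp
    next
      case 2
      then show ?thesis using Path assms(1,2) fun_cong[OF assms(5), of "Path n"] by simp
    next
      case 3
      then show ?thesis using one.root_support[OF assms(3), of v] one.root_support[OF assms(4), of v] Path by simp
    qed
  qed
qed

text \<open>For a fixed cut, both sign conditions and being different from the stretched root pass
  through \<open>split_vector\<close>, which also preserves roots; this decides which split vectors
  are inversions, and \<open>word_inversion\<close> shows that there are no other
  inversions.\<close>

theorem inversions_stretch:
  assumes n: "1 \<le> n" and \<alpha>: "\<alpha> \<in> \<Phi>"
  shows "inversions (V' n) (A' n) (st_vector x n \<alpha>) =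
    (\<Union>j\<in>{1..n}. split_vector n j ` inversions (V' 1) (A' 1) (st_vector x 1 \<alpha>))"
proof -
  interpret n: gcm "V' n" "A' n" by (rule gcm_stretch)
  interpret one: gcm "V' 1" "A' 1" by (rule gcm_stretch)
  obtain ys y where w: "set ys \<subseteq> V" "y \<in> V" "\<alpha> = act V A ys (simple_root y)"
    using root_word[OF \<alpha>] .
  define zs where "zs = ys @ y # rev ys"
  have zs: "set zs \<subseteq> V" using w by (auto simp: zs_def)
  have refl: "root_reflection (V' k) (A' k) (st_vector x k \<alpha>) \<gamma> = act (V' k) (A' k) (stretch_word x k zs) \<gamma>"
    if "\<gamma> \<in> \<Phi>' k" for k \<gamma>
    unfolding zs_def w(3) by (rule stretched_reflection(1)[OF w(1,2) that])
  have b1: "st_vector x 1 \<alpha> \<in> \<Phi>' 1"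
    unfolding w(3) by (rule stretched_reflection(2)[OF w(1,2) root_system.simple[of "Path 0"]]) simp
  have key: "split_vector n j h \<in> inversions (V' n) (A' n) (st_vector x n \<alpha>) \<longleftrightarrow> h \<in> inversions (V' 1) (A' 1) (st_vector x 1 \<alpha>)"
    if j: "1 \<le> j" "j \<le> n" and h: "h \<in> \<Phi>' 1" for j h
  proof -
    have r: "split_vector n j h \<in> \<Phi>' n" by (rule split_vector_root[OF j h])
    have t: "act (V' 1) (A' 1) (stretch_word x 1 zs) h \<in> \<Phi>' 1" by (rule one.act_root[OF set_stretch_word[OF zs] h])
    have "split_vector n j h = st_vector x n \<alpha> \<longleftrightarrow> h = st_vector x 1 \<alpha>"
      using split_vector_inj[OF j h b1] split_vector_st_vector[of n j x \<alpha>] by auto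
    then show ?thesis unfolding inversions_def
      using r h split_vector_signs[OF j h] split_vector_signs(2)[OF j t] split_stretch_word[OF j zs, of h]
      by (simp add: refl)
  qed
  show ?thesis
  proof (intro equalityI subsetI)
    fix \<gamma> assume g: "\<gamma> \<in> inversions (V' n) (A' n) (st_vector x n \<alpha>)"
    then have gr: "\<gamma> \<in> \<Phi>' n" "nonneg \<gamma>" "nonpos (act (V' n) (A' n) (stretch_word x n zs) \<gamma>)"
      using refl[of \<gamma> n] by (auto simp: inversions_def)
    obtain j h where jh: "j \<in> {1..n}" "h \<in> \<Phi>' 1" "\<gamma> = split_vector n j h"
      using word_inversion[OF n zs gr] by blast
    then show "\<gamma> \<in> (\<Union>j\<in>{1..n}. split_vector n j ` inversions (V' 1) (A' 1) (st_vector x 1 \<alpha>))"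
      using key[of j h] g by auto
  next
    fix \<gamma> assume "\<gamma> \<in> (\<Union>j\<in>{1..n}. split_vector n j ` inversions (V' 1) (A' 1) (st_vector x 1 \<alpha>))"
    then obtain j h where "j \<in> {1..n}" "h \<in> inversions (V' 1) (A' 1) (st_vector x 1 \<alpha>)" "\<gamma> = split_vector n j h" by blast
    then show "\<gamma> \<in> inversions (V' n) (A' n) (st_vector x n \<alpha>)" using key[of j h] by (auto simp: inversions_def)
  qed
qed

end

end

section \<open>The arrangement of fractures of a stretched root\<close>

text \<open>Functionals for all n live in one infinite dimensional space, so dimensions are computed
  from bases of the subspaces themselves.\<close>

lemma dim_image_inj:
  fixes f :: "'a::real_vector \<Rightarrow> 'b::real_vector"
  assumes f: "linear f" and S: "subspace S" and inj: "inj_on f S"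
  shows "dim (f ` S) = dim S"
proof -
  obtain B where B: "B \<subseteq> S" "independent B" "S \<subseteq> span B" "card B = dim S" using basis_exists by blast
  have sB: "span B = S" using B(1,3) S by (simp add: span_subspace)
  have "independent (f ` B)" by (rule linear_independent_injective_image[OF f B(2)]) (use inj sB in simp)
  moreover have "f ` S = span (f ` B)" using linear_span_image[OF f, of B] sB by simp
  moreover have "card (f ` B) = card B" using B(1) inj by (intro card_image) (rule inj_on_subset)
  ultimately show ?thesis using B(4) by (simp add: dim_eq_card_independent)
qed

lemma dim_add_line:
  fixes S :: "'a::real_vector set"
  assumes S: "subspace S" "S \<subseteq> span K" "finite K" and e: "e \<notin> S"
  shows "dim {s + c *\<^sub>R e | s c. s \<in> S} = dim S + 1"
proof -
  obtain B where B: "B \<subseteq> S" "independent B" "S \<subseteq> span B" "card B = dim S" using basis_exists by blast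
  have sB: "span B = S" using B(1,3) S by (simp add: span_subspace)
  have "finite B" using independent_span_bound[OF S(3) B(2)] B(1) S(2) by blast
  have "{s + c *\<^sub>R e | s c. s \<in> S} = span (insert e B)"
  proof -
    have "f \<in> {s + c *\<^sub>R e | s c. s \<in> S} \<longleftrightarrow> (\<exists>c. f - c *\<^sub>R e \<in> S)" for f
      by (auto, metis add_diff_cancel_right', metis diff_add_cancel)
    then show ?thesis unfolding span_insert sB by blast
  qed
  moreover have "independent (insert e B)" using B(2) e sB by (simp add: independent_insert)
  moreover have "card (insert e B) = card B + 1" using \<open>finite B\<close> e B(1) by (subst card_insert_disjoint) auto
  ultimately show ?thesis using B(4) by (simp add: dim_eq_card_independent)
qed

text \<open>One direction e_j is added at a time. A free coefficient raises the dimension by 1; a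
  prescribed one replaces the space by a graph over it, of the same dimension. The functionals y_j
  witness that e_j is a new direction, and l_j kills the fibre directions, so that its value depends
  on s alone.\<close>

lemma dim_fibred_space:
  fixes Q :: "'a::real_vector set" and e :: "nat \<Rightarrow> 'a" and y l :: "nat \<Rightarrow> 'a \<Rightarrow> real"
  assumes Q: "subspace Q" "Q \<subseteq> span K" "finite K"
    and y: "\<And>j. linear (y j)" "\<And>i j. i \<in> {1..n} \<Longrightarrow> j \<in> {1..n} \<Longrightarrow> y i (e j) = (if i = j then 1 else 0)"
      "\<And>j s. j \<in> {1..n} \<Longrightarrow> s \<in> Q \<Longrightarrow> y j s = 0"
    and l: "\<And>j. linear (l j)" "\<And>i j. i \<in> {1..n} \<Longrightarrow> j \<in> {1..n} \<Longrightarrow> l i (e j) = 0"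
  shows "dim {s + (\<Sum>j = 1..n. c j *\<^sub>R e j) | s c. s \<in> Q \<and> (\<forall>j\<in>{1..n}. j \<in> M \<longrightarrow> c j = l j s)} = dim Q + card ({1..n} - M)"
proof -
  define D where "D k = {s + (\<Sum>j = 1..k. c j *\<^sub>R e j) | s c. s \<in> Q \<and> (\<forall>j\<in>{1..k}. j \<in> M \<longrightarrow> c j = l j s)}" for k
  have "k \<le> n \<Longrightarrow> subspace (D k) \<and> (\<exists>K. finite K \<and> D k \<subseteq> span K) \<and> dim (D k) = dim Q + card ({1..k} - M)" for k
  proof (induction k)
    case 0
    have "D 0 = Q" by (auto simp: D_def)
    then show ?case using Q by auto
  next
    case (Suc k)
    then have IH: "subspace (D k)" "dim (D k) = dim Q + card ({1..k} - M)" by auto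
    obtain K where K: "finite K" "D k \<subseteq> span K" using Suc by auto
    let ?e = "e (Suc k)" and ?l = "l (Suc k)" and ?y = "y (Suc k)"
    have kn: "Suc k \<in> {1..n}" using Suc.prems by simp
    have yD: "?y f = 0" and lD: "\<And>s c. f = s + (\<Sum>j = 1..k. c j *\<^sub>R e j) \<Longrightarrow> ?l f = ?l s" if fD: "f \<in> D k" for f
    proof -
      obtain s c where f: "f = s + (\<Sum>j = 1..k. c j *\<^sub>R e j)" "s \<in> Q" using fD unfolding D_def by blast
      have "?y f = ?y s + (\<Sum>j = 1..k. c j * ?y (e j))"
        unfolding f(1) by (simp add: linear_add[OF y(1)] linear_sum[OF y(1)] linear_cmul[OF y(1)])
      also have "\<dots> = 0" using y(2)[OF kn] y(3)[OF kn f(2)] Suc.prems by simp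
      finally show "?y f = 0" .
      show "?l f = ?l s" if "f = s + (\<Sum>j = 1..k. c j *\<^sub>R e j)" for s c
        unfolding that using l(2)[OF kn] Suc.prems
        by (simp add: linear_add[OF l(1)] linear_sum[OF l(1)] linear_cmul[OF l(1)])
    qed
    have ye: "?y ?e = 1" using y(2)[OF kn kn] by simp
    show ?case
    proof (cases "Suc k \<in> M")
      case True
      define g where "g f = f + ?l f *\<^sub>R ?e" for f
      have lin: "linear g" unfolding g_def
        by (intro linearI) (simp_all add: linear_add[OF l(1)] linear_cmul[OF l(1)] algebra_simps)
      have D: "D (Suc k) = g ` D k"
      proof (intro equalityI subsetI)
        fix f assume "f \<in> D (Suc k)"
        then obtain s c where f: "f = s + (\<Sum>j = 1..Suc k. c j *\<^sub>R e j)" "s \<in> Q" "\<forall>j\<in>{1..Suc k}. j \<in> M \<longrightarrow> c j = l j s"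
          unfolding D_def by blast
        let ?f = "s + (\<Sum>j = 1..k. c j *\<^sub>R e j)"
        have "\<forall>j\<in>{1..k}. j \<in> M \<longrightarrow> c j = l j s" using f(3) by simp
        then have "?f \<in> D k" unfolding D_def using f(2) by blast
        moreover have "f = g ?f" unfolding g_def using lD[OF \<open>?f \<in> D k\<close>, OF refl] f(1,3) True by (simp add: add.assoc)
        ultimately show "f \<in> g ` D k" by blast
      next
        fix f assume "f \<in> g ` D k"
        then obtain s c where s: "s \<in> Q" "\<forall>j\<in>{1..k}. j \<in> M \<longrightarrow> c j = l j s"
          and f: "f = g (s + (\<Sum>j = 1..k. c j *\<^sub>R e j))" "s + (\<Sum>j = 1..k. c j *\<^sub>R e j) \<in> D k" unfolding D_def by blast
        let ?c = "c(Suc k := ?l s)"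
        have "f = s + (\<Sum>j = 1..Suc k. ?c j *\<^sub>R e j)"
          using f(1) lD[OF f(2) refl] by (simp add: g_def add.assoc)
        moreover have "\<forall>j\<in>{1..Suc k}. j \<in> M \<longrightarrow> ?c j = l j s" using s(2) by (auto simp: le_Suc_eq)
        ultimately show "f \<in> D (Suc k)" unfolding D_def using s(1) by blast
      qed
      have "inj_on g (D k)"
      proof (rule inj_onI)
        fix f f' assume ff: "f \<in> D k" "f' \<in> D k" "g f = g f'"
        have "?y (g f) = ?l f" "?y (g f') = ?l f'"
          using yD[OF ff(1)] yD[OF ff(2)] ye by (simp_all add: g_def linear_add[OF y(1)] linear_cmul[OF y(1)])
        then have "?l f = ?l f'" using ff(3) by simp
        then show "f = f'" using ff(3) by (simp add: g_def)
      qed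
      then have "dim (D (Suc k)) = dim (D k)" unfolding D by (rule dim_image_inj[OF lin IH(1)])
      moreover have "subspace (D (Suc k))" unfolding D by (rule linear_subspace_image[OF lin IH(1)])
      moreover have "D (Suc k) \<subseteq> span (g ` K)" unfolding D linear_span_image[OF lin] using K(2) by blast
      moreover have "{1..Suc k} - M = {1..k} - M" using True by (auto simp: le_Suc_eq)
      ultimately show ?thesis using IH(2) K(1) by auto
    next
      case False
      have D: "D (Suc k) = {s + c *\<^sub>R ?e | s c. s \<in> D k}"
      proof (intro equalityI subsetI)
        fix f assume "f \<in> D (Suc k)"
        then obtain s c where f: "f = s + (\<Sum>j = 1..Suc k. c j *\<^sub>R e j)" "s \<in> Q" "\<forall>j\<in>{1..Suc k}. j \<in> M \<longrightarrow> c j = l j s"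
          unfolding D_def by blast
        let ?f = "s + (\<Sum>j = 1..k. c j *\<^sub>R e j)"
        have "\<forall>j\<in>{1..k}. j \<in> M \<longrightarrow> c j = l j s" using f(3) by simp
        then have "?f \<in> D k" unfolding D_def using f(2) by blast
        moreover have "f = ?f + c (Suc k) *\<^sub>R ?e" using f(1) by (simp add: add.assoc)
        ultimately show "f \<in> {s + c *\<^sub>R ?e | s c. s \<in> D k}" by blast
      next
        fix f assume "f \<in> {s + c *\<^sub>R ?e | s c. s \<in> D k}"
        then obtain s c d where s: "s \<in> Q" "\<forall>j\<in>{1..k}. j \<in> M \<longrightarrow> c j = l j s"
          and f: "f = s + (\<Sum>j = 1..k. c j *\<^sub>R e j) + d *\<^sub>R ?e" unfolding D_def by blast
        let ?c = "c(Suc k := d)"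
        have "f = s + (\<Sum>j = 1..Suc k. ?c j *\<^sub>R e j)" using f by (simp add: add.assoc)
        moreover have "\<forall>j\<in>{1..Suc k}. j \<in> M \<longrightarrow> ?c j = l j s" using s(2) False by (auto simp: le_Suc_eq)
        ultimately show "f \<in> D (Suc k)" unfolding D_def using s(1) by blast
      qed
      have "?e \<notin> D k" using yD ye by force
      then have "dim (D (Suc k)) = dim (D k) + 1" unfolding D by (rule dim_add_line[OF IH(1) K(2,1)])
      moreover have "{1..Suc k} - M = insert (Suc k) ({1..k} - M)" using False by (auto simp: le_Suc_eq)
      moreover have "D (Suc k) \<subseteq> span (insert ?e K)"
      proof
        fix f assume "f \<in> D (Suc k)"
        then obtain s c where "s \<in> D k" "f = s + c *\<^sub>R ?e" unfolding D by blast
        moreover have "D k \<subseteq> span (insert ?e K)" using K(2) span_mono[of K "insert ?e K"] by blast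
        ultimately show "f \<in> span (insert ?e K)" by (auto intro: span_add span_scale span_base)
      qed
      moreover have "subspace (D (Suc k))"
      proof -
        have "D (Suc k) = {a + b | a b. a \<in> D k \<and> b \<in> span {?e}}" unfolding D span_singleton by auto
        then show ?thesis using subspace_sums[OF IH(1) subspace_span[of "{?e}"]] by simp
      qed
      ultimately show ?thesis using IH(2) K(1) by (auto intro!: exI[of _ "insert ?e K"])
    qed
  qed
  from this[of n] show ?thesis by (simp add: D_def)
qed

lemma dual_space_subset_span: "finite V \<Longrightarrow> dual_space V \<subseteq> span ((\<lambda>v. Poly_Mapping.single v 1) ` V)"
proof
  fix f assume V: "finite V" and f: "f \<in> dual_space V"
  have "f = (\<Sum>v\<in>V. Poly_Mapping.lookup f v *\<^sub>R Poly_Mapping.single v 1)"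
    using f V by (intro poly_mapping_eqI) (auto simp: lookup_sum lookup_single when_def dual_space_iff if_distrib cong: if_cong)
  also have "\<dots> \<in> span ((\<lambda>v. Poly_Mapping.single v 1) ` V)" by (intro span_sum span_scale span_base) blast
  finally show "f \<in> span ((\<lambda>v. Poly_Mapping.single v 1) ` V)" .
qed

lemma pairing_sum: "pairing V (\<Sum>i\<in>I. f i) \<beta> = (\<Sum>i\<in>I. pairing V (f i) \<beta>)"
  by (induction I rule: infinite_finite_induct) (simp_all add: pairing_add, simp_all add: pairing_def)

context stretching
begin

text \<open>Dual to the coordinates y_j = f(x_j) + ... + f(x_n) with 1 \<le> j \<le> n. The
  complementary base consists of the functionals supported on the old vertices and x_0, that is
  \<open>dual_space (V' 0)\<close>.\<close>

definition step_vector :: "nat \<Rightarrow> 'v stretched functional" where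
  "step_vector i = Poly_Mapping.single (Path i) 1 - Poly_Mapping.single (Path (i - 1)) 1"

lemma st_vertices_mono: "k \<le> n \<Longrightarrow> V' k \<subseteq> V' n"
  by (auto simp: st_vertices_def)

lemma pairing_base:
  assumes s: "s \<in> dual_space (V' 0)" and g: "\<And>v. v \<in> V' 0 \<Longrightarrow> g v = g' v"
  shows "pairing (V' n) s g = pairing (V' k) s g'"
proof -
  have "pairing (V' n) s g = (\<Sum>v\<in>V' 0. Poly_Mapping.lookup s v * real_of_int (g v))" for n g
    unfolding pairing_def using s st_vertices_mono[of 0 n] gcm.finite_V[OF gcm_stretch]
    by (intro sum.mono_neutral_right) (auto simp: dual_space_iff)
  moreover have "(\<Sum>v\<in>V' 0. Poly_Mapping.lookup s v * real_of_int (g v)) = (\<Sum>v\<in>V' 0. Poly_Mapping.lookup s v * real_of_int (g' v))"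
    using g by (intro sum.cong) auto
  ultimately show ?thesis by simp
qed

lemma pairing_split_base:
  assumes "s \<in> dual_space (V' 0)" "1 \<le> j" "j \<le> n"
  shows "pairing (V' n) s (split_vector n j \<gamma>) = pairing (V' 1) s \<gamma>"
  using assms by (intro pairing_base) (auto simp: st_vertices_def)

lemma pairing_step_vector:
  assumes "1 \<le> i" "i \<le> n"
  shows "pairing (V' n) (step_vector i) g = g (Path i) - g (Path (i - 1))"
  using assms gcm.finite_V[OF gcm_stretch]
  by (simp add: step_vector_def pairing_diff pairing_single)

text \<open>The i-th step vector measures the jump of a vector between x_(i-1) and x_i, and a split
  vector jumps at most at its cut. Hence only the coordinate c_j enters.\<close>

lemma pairing_split:
  assumes s: "s \<in> dual_space (V' 0)" and j: "1 \<le> j" "j \<le> n"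
  shows "pairing (V' n) (s + (\<Sum>i = 1..n. c i *\<^sub>R step_vector i)) (split_vector n j \<gamma>) =
    pairing (V' 1) s \<gamma> + (\<gamma> (Path 1) - \<gamma> (Path 0)) * c j"
proof -
  have "pairing (V' n) (\<Sum>i = 1..n. c i *\<^sub>R step_vector i) (split_vector n j \<gamma>) =
    (\<Sum>i = 1..n. if i = j then c i * real_of_int (\<gamma> (Path 1) - \<gamma> (Path 0)) else 0)"
    unfolding pairing_sum pairing_scaleR using j by (intro sum.cong) (auto simp: pairing_step_vector)
  also have "\<dots> = c j * real_of_int (\<gamma> (Path 1) - \<gamma> (Path 0))" using j by simp
  finally show ?thesis using pairing_split_base[OF s j] by (simp add: pairing_add)
qed

lemma dual_space_decompose:
  assumes "f \<in> dual_space (V' n)"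
  obtains s c where "s \<in> dual_space (V' 0)" "f = s + (\<Sum>i = 1..n. c i *\<^sub>R step_vector i)"
proof -
  \<comment> \<open>Tail sums: subtracting these multiples of the step vectors removes the values at
    x_1, ..., x_n and accumulates them at x_0.\<close>
  define c where "c j = (\<Sum>k = j..n. Poly_Mapping.lookup f (Path k))" for j
  define s where "s = f - (\<Sum>i = 1..n. c i *\<^sub>R step_vector i)"
  have lk: "Poly_Mapping.lookup (\<Sum>i = 1..n. c i *\<^sub>R step_vector i) v =
     (\<Sum>i = 1..n. c i * ((if v = Path i then 1 else 0) - (if v = Path (i - 1) then 1 else 0)))" for v
    unfolding lookup_sum by (rule sum.cong) (auto simp: step_vector_def lookup_minus lookup_single when_def)
  have "Poly_Mapping.lookup s v = 0" if v: "v \<notin> V' 0" for v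
  proof (cases v)
    case (Old y)
    then show ?thesis using v assms lk[of v] by (simp add: s_def lookup_minus dual_space_iff)
  next
    case (Path k)
    then have k: "k \<ge> 1" using v by (cases k) auto
    have "Poly_Mapping.lookup (\<Sum>i = 1..n. c i *\<^sub>R step_vector i) v =
      (\<Sum>i = 1..n. (if i = k then c i else 0) - (if i = Suc k then c i else 0))"
      unfolding lk Path by (intro sum.cong) auto
    also have "\<dots> = (if k \<le> n then c k else 0) - (if Suc k \<le> n then c (Suc k) else 0)"
      unfolding sum_subtractf using k by simp
    also have "\<dots> = (if k \<le> n then Poly_Mapping.lookup f (Path k) else 0)"
      by (auto simp: c_def sum.atLeast_Suc_atMost not_less_eq_eq)
    also have "\<dots> = Poly_Mapping.lookup f v" using assms Path by (simp add: dual_space_iff)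
    finally show ?thesis by (simp add: s_def lookup_minus)
  qed
  then have "s \<in> dual_space (V' 0)" by (simp add: dual_space_iff)
  moreover have "f = s + (\<Sum>i = 1..n. c i *\<^sub>R step_vector i)" by (simp add: s_def)
  ultimately show thesis by (rule that)
qed

lemma dual_space_compose:
  assumes "s \<in> dual_space (V' 0)"
  shows "s + (\<Sum>i = 1..n. c i *\<^sub>R step_vector i) \<in> dual_space (V' n)"
proof -
  have "s \<in> dual_space (V' n)" using assms st_vertices_mono[of 0 n] by (auto simp: dual_space_iff)
  moreover have "step_vector i \<in> dual_space (V' n)" if "i \<in> {1..n}" for i
    using that by (auto simp: dual_space_iff step_vector_def lookup_minus lookup_single when_def)
  ultimately show ?thesis by (intro subspace_add subspace_sum subspace_scale subspace_dual_space)
qed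

text \<open>The stretched root has no jump at any cut, so its hyperplane is the product of a base
  \<open>U\<close>, which is the same for all n, with the full fibre. This is the shape required by
  \<open>characteristic_polynomial_fibred\<close>.\<close>

theorem characteristic_polynomial_stretch:
  assumes \<alpha>: "\<alpha> \<in> \<Phi>" "nonneg \<alpha>" and growth: "has_depth_growth_rate V A x L R \<alpha> t"
  shows "\<exists>p. \<forall>n\<ge>1. fracture_polynomial (V' n) (A' n) (st_vector x n \<alpha>) = (\<Sum>k = 0..t. p k * [:- real k, 1:] ^ n)"
proof -
  define \<beta> where "\<beta> n = st_vector x n \<alpha>" for n
  define I where "I = inversions (V' 1) (A' 1) (\<beta> 1)"
  \<comment> \<open>Inversions without a jump give the same split vector for every cut and constrain
    only the base; the others, collected in \<open>T\<close>, give one graph for each cut.\<close>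
  define F where "F = {\<gamma> \<in> I. \<gamma> (Path 1) = \<gamma> (Path 0)}"
  define T where "T = {\<gamma> \<in> I. \<gamma> (Path 1) \<noteq> \<gamma> (Path 0)}"
  obtain ys y where w: "set ys \<subseteq> V" "y \<in> V" "\<alpha> = act V A ys (simple_root y)"
    using root_word[OF \<alpha>(1)] .
  have \<beta>: "\<beta> n \<in> \<Phi>' n" for n
    unfolding \<beta>_def w(3) by (rule stretched_reflection(2)[OF w(1,2) root_system.simple[of "Path 0"]]) simp
  have \<beta>n: "nonneg (\<beta> n)" for n
    unfolding \<beta>_def nonneg_def
  proof
    show "0 \<le> st_vector x n \<alpha> z" for z using \<alpha>(2) by (cases z) (auto simp: nonneg_def)
  qed
  have inv: "inversions (V' n) (A' n) (\<beta> n) = (\<Union>j\<in>{1..n}. split_vector n j ` I)" if "1 \<le> n" for n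
    unfolding \<beta>_def I_def by (rule inversions_stretch[OF that \<alpha>(1)])
  have fI: "finite I" unfolding I_def by (rule gcm.inversions_bound(1)[OF gcm_stretch \<beta> \<beta>n])
  have fin: "finite F" "finite T" using fI by (auto simp: F_def T_def)
  have Ir: "\<gamma> \<in> \<Phi>' 1" if "\<gamma> \<in> I" for \<gamma> using that by (auto simp: I_def inversions_def)
  define U where "U = {s \<in> dual_space (V' 0). pairing (V' 1) s (\<beta> 1) = 0}"
  define G where "G \<gamma> = {s. pairing (V' 1) s \<gamma> = 0}" for \<gamma>
  \<comment> \<open>The solution for c_j of the equation that the pairing in
    \<open>pairing_split\<close> vanishes.\<close>
  define l where "l \<gamma> s = - pairing (V' 1) s \<gamma> / real_of_int (\<gamma> (Path 1) - \<gamma> (Path 0))" for \<gamma> s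
  define E where "E n = perp (V' n) (\<beta> n)" for n
  define H where "H n i = (case i of Inl \<gamma> \<Rightarrow> perp (V' n) (split_vector n 1 \<gamma>) | Inr (j, \<gamma>) \<Rightarrow> perp (V' n) (split_vector n j \<gamma>)) \<inter> E n"
    for n and i :: "('v stretched \<Rightarrow> int) + nat \<times> ('v stretched \<Rightarrow> int)"
  have frac: "fractures (V' n) (A' n) (E n) = H n ` (F <+> {1..n} \<times> T)" if n: "1 \<le> n" for n
  proof -
    have Fj: "split_vector n j \<gamma> = split_vector n 1 \<gamma>" if "\<gamma> \<in> F" for j \<gamma>
    proof
      show "split_vector n j \<gamma> v = split_vector n 1 \<gamma> v" for v using that by (cases v) (auto simp: F_def)
    qed
    have "fractures (V' n) (A' n) (E n) = (\<Union>j\<in>{1..n}. (\<lambda>\<gamma>. perp (V' n) (split_vector n j \<gamma>) \<inter> E n) ` I)"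
      unfolding E_def gcm.fractures_eq[OF gcm_stretch \<beta> \<beta>n] inv[OF n] by blast
    also have "\<dots> = (\<Union>j\<in>{1..n}. (\<lambda>\<gamma>. perp (V' n) (split_vector n j \<gamma>) \<inter> E n) ` F) \<union> (\<Union>j\<in>{1..n}. (\<lambda>\<gamma>. perp (V' n) (split_vector n j \<gamma>) \<inter> E n) ` T)"
      unfolding F_def T_def by blast
    also have "(\<Union>j\<in>{1..n}. (\<lambda>\<gamma>. perp (V' n) (split_vector n j \<gamma>) \<inter> E n) ` F) = (\<lambda>\<gamma>. H n (Inl \<gamma>)) ` F"
    proof -
      have "(\<lambda>\<gamma>. perp (V' n) (split_vector n j \<gamma>) \<inter> E n) ` F = (\<lambda>\<gamma>. H n (Inl \<gamma>)) ` F" for j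
        using Fj[of _ j] by (intro image_cong refl) (simp add: H_def)
      then show ?thesis using n by auto
    qed
    also have "(\<Union>j\<in>{1..n}. (\<lambda>\<gamma>. perp (V' n) (split_vector n j \<gamma>) \<inter> E n) ` T) = (\<lambda>p. H n (Inr p)) ` ({1..n} \<times> T)"
      unfolding H_def by force
    finally show ?thesis by (simp add: Plus_def image_Un image_image)
  qed
  have proper: "H n i \<subset> E n" if n: "1 \<le> n" and i: "i \<in> F <+> {1..n} \<times> T" for n i
  proof -
    obtain j \<gamma> where jg: "j \<in> {1..n}" "\<gamma> \<in> I" "H n i = perp (V' n) (split_vector n j \<gamma>) \<inter> E n"
    proof (cases i)
      case (Inl \<gamma>)
      then show ?thesis using that[of 1 \<gamma>] i n by (auto simp: H_def F_def)
    next
      case (Inr p)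
      then show ?thesis using that[of "fst p" "snd p"] i by (auto simp: H_def T_def split: prod.splits)
    qed
    then have "split_vector n j \<gamma> \<in> inversions (V' n) (A' n) (\<beta> n)" using inv[OF n] by blast
    then have g: "split_vector n j \<gamma> \<in> \<Phi>' n" "nonneg (split_vector n j \<gamma>)" "split_vector n j \<gamma> \<noteq> \<beta> n"
      by (auto simp: inversions_def)
    then have "\<not> perp (V' n) (\<beta> n) \<subseteq> perp (V' n) (split_vector n j \<gamma>)"
      using gcm.perp_subset_imp_eq[OF gcm_stretch \<beta> g(1) \<beta>n g(2)] by blast
    then show ?thesis unfolding jg(3) E_def by blast
  qed
  have dims: "dim (E n \<inter> \<Inter>(H n ` (B0 <+> Sigma {1..n} C))) =
        dim {u \<in> U. (\<forall>i\<in>B0. u \<in> G i) \<and> (\<forall>j\<in>{1..n}. \<forall>a\<in>C j. \<forall>b\<in>C j. l a u = l b u)} + card {j \<in> {1..n}. C j = {}}"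
    if n: "1 \<le> n" and B0: "B0 \<subseteq> F" and C: "\<And>j. j \<in> {1..n} \<Longrightarrow> C j \<subseteq> T" for n B0 C
  proof -
    define Q where "Q = {u \<in> U. (\<forall>i\<in>B0. u \<in> G i) \<and> (\<forall>j\<in>{1..n}. \<forall>a\<in>C j. \<forall>b\<in>C j. l a u = l b u)}"
    define M where "M = {j. C j \<noteq> {}}"
    define y where "y j f = (\<Sum>k = j..n. Poly_Mapping.lookup f (Path k))" for j and f :: "'v stretched functional"
    \<comment> \<open>All functions indexed by \<open>C j\<close> agree on Q, so one representative
      prescribes the coordinate.\<close>
    define a where "a j = (SOME a. a \<in> C j)" for j
    define da where "da j = real_of_int (a j (Path 1) - a j (Path 0))" for j
    \<comment> \<open>agrees with \<open>l (a j)\<close> on the base, but kills the fibre directions\<close>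
    define lj where "lj j f = - (pairing (V' n) f (split_vector n j (a j)) - da j * y j f) / da j" for j f
    have liny: "linear (y j)" for j
      unfolding y_def by (intro linearI) (simp_all add: lookup_add sum.distrib sum_distrib_left)
    have ye: "y i (step_vector j) = (if i = j then 1 else 0)" if "i \<in> {1..n}" "j \<in> {1..n}" for i j
    proof -
      have "y i (step_vector j) = (\<Sum>k = i..n. (if k = j then 1 else 0) - (if k = j - 1 then 1 else 0))"
        unfolding y_def step_vector_def by (intro sum.cong) (auto simp: lookup_minus lookup_single when_def)
      also have "\<dots> = (if i = j then 1 else 0)" unfolding sum_subtractf using that by auto
      finally show ?thesis .
    qed
    have ys: "y j s = 0" if "j \<in> {1..n}" "s \<in> dual_space (V' 0)" for j s
      using that unfolding y_def by (intro sum.neutral) (auto simp: dual_space_iff)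
    have lj: "lj j s = l (a j) s" if "j \<in> {1..n}" "s \<in> dual_space (V' 0)" for j s
      using ys[OF that] pairing_split_base[OF that(2), of j n "a j"] that(1) by (simp add: lj_def l_def da_def)
    have Lin: "linear (\<lambda>s. pairing (V' 1) s \<gamma>)" for \<gamma>
      by (intro linearI) (simp_all add: pairing_add pairing_scaleR)
    have linl: "linear (l \<gamma>)" for \<gamma>
      by (intro linearI) (simp_all add: l_def pairing_add pairing_scaleR diff_divide_distrib)
    have pe: "pairing (V' n) (s + (\<Sum>i = 1..n. c i *\<^sub>R step_vector i)) (\<beta> n) = pairing (V' 1) s (\<beta> 1)"
      if "s \<in> dual_space (V' 0)" for s c
      using pairing_split[OF that, of 1 n c "\<beta> 1"] n split_vector_st_vector[of n 1 x \<alpha>] by (simp add: \<beta>_def)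
    have sl: "pairing (V' n) (s + (\<Sum>i = 1..n. c i *\<^sub>R step_vector i)) (split_vector n j \<gamma>) = 0 \<longleftrightarrow> c j = l \<gamma> s"
      if "s \<in> dual_space (V' 0)" "j \<in> {1..n}" "\<gamma> \<in> T" for s c j \<gamma>
    proof -
      have nz: "real_of_int (\<gamma> (Path 1) - \<gamma> (Path 0)) \<noteq> 0" using that(3) by (simp add: T_def)
      have "pairing (V' n) (s + (\<Sum>i = 1..n. c i *\<^sub>R step_vector i)) (split_vector n j \<gamma>) =
        pairing (V' 1) s \<gamma> + real_of_int (\<gamma> (Path 1) - \<gamma> (Path 0)) * c j"
        using pairing_split[OF that(1), of j n c \<gamma>] that(2) by simp
      then show ?thesis unfolding l_def using nz by (auto simp: field_simps)
    qed
    have sF: "pairing (V' n) (s + (\<Sum>i = 1..n. c i *\<^sub>R step_vector i)) (split_vector n 1 \<gamma>) = pairing (V' 1) s \<gamma>"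
      if "s \<in> dual_space (V' 0)" "\<gamma> \<in> F" for s c \<gamma>
      using pairing_split[OF that(1), of 1 n c \<gamma>] n that(2) by (simp add: F_def)
    have mem: "s + (\<Sum>i = 1..n. c i *\<^sub>R step_vector i) \<in> E n \<inter> \<Inter>(H n ` (B0 <+> Sigma {1..n} C)) \<longleftrightarrow>
      s \<in> U \<and> (\<forall>\<gamma>\<in>B0. s \<in> G \<gamma>) \<and> (\<forall>j\<in>{1..n}. \<forall>\<gamma>\<in>C j. c j = l \<gamma> s)" (is "?f \<in> _ \<longleftrightarrow> _")
      if s: "s \<in> dual_space (V' 0)" for s c
    proof -
      have E: "?f \<in> E n \<longleftrightarrow> s \<in> U"
        unfolding E_def perp_def U_def using dual_space_compose[OF s, of c n] pe[OF s, of c] s by simp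
      have HF: "?f \<in> H n (Inl \<gamma>) \<longleftrightarrow> s \<in> G \<gamma>" if "?f \<in> E n" "\<gamma> \<in> B0" for \<gamma>
        using that B0 sF[OF s, of \<gamma> c] dual_space_compose[OF s, of c n] by (auto simp: H_def perp_def G_def)
      have HT: "?f \<in> H n (Inr (j, \<gamma>)) \<longleftrightarrow> c j = l \<gamma> s" if "?f \<in> E n" "j \<in> {1..n}" "\<gamma> \<in> C j" for j \<gamma>
        using that C[OF that(2)] sl[OF s that(2), of \<gamma> c] dual_space_compose[OF s, of c n] by (auto simp: H_def perp_def)
      have "?f \<in> E n \<inter> \<Inter>(H n ` (B0 <+> Sigma {1..n} C)) \<longleftrightarrow>
        ?f \<in> E n \<and> (\<forall>\<gamma>\<in>B0. ?f \<in> H n (Inl \<gamma>)) \<and> (\<forall>j\<in>{1..n}. \<forall>\<gamma>\<in>C j. ?f \<in> H n (Inr (j, \<gamma>)))"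
        unfolding Plus_def by blast
      also have "\<dots> \<longleftrightarrow> s \<in> U \<and> (\<forall>\<gamma>\<in>B0. s \<in> G \<gamma>) \<and> (\<forall>j\<in>{1..n}. \<forall>\<gamma>\<in>C j. c j = l \<gamma> s)"
        using E HF HT by blast
      finally show ?thesis .
    qed
    have eqD: "E n \<inter> \<Inter>(H n ` (B0 <+> Sigma {1..n} C)) =
      {s + (\<Sum>j = 1..n. c j *\<^sub>R step_vector j) | s c. s \<in> Q \<and> (\<forall>j\<in>{1..n}. j \<in> M \<longrightarrow> c j = lj j s)}"
    proof (intro equalityI subsetI)
      fix f assume f: "f \<in> E n \<inter> \<Inter>(H n ` (B0 <+> Sigma {1..n} C))"
      then have "f \<in> dual_space (V' n)" by (simp add: E_def perp_def)
      then obtain s c where s: "s \<in> dual_space (V' 0)" "f = s + (\<Sum>i = 1..n. c i *\<^sub>R step_vector i)"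
        by (rule dual_space_decompose)
      have m: "s \<in> U" "\<forall>\<gamma>\<in>B0. s \<in> G \<gamma>" "\<forall>j\<in>{1..n}. \<forall>\<gamma>\<in>C j. c j = l \<gamma> s"
        using mem[OF s(1), of c] f unfolding s(2) by blast+
      have "l b s = l b' s" if "j \<in> {1..n}" "b \<in> C j" "b' \<in> C j" for j b b'
      proof -
        have "c j = l b s" "c j = l b' s" using m(3) that by blast+
        then show ?thesis by simp
      qed
      then have "s \<in> Q" unfolding Q_def using m(1,2) by blast
      moreover have "\<forall>j\<in>{1..n}. j \<in> M \<longrightarrow> c j = lj j s"
      proof (intro ballI impI)
        fix j assume j: "j \<in> {1..n}" "j \<in> M"
        then have "a j \<in> C j" unfolding a_def M_def by (simp add: some_in_eq)
        then show "c j = lj j s" using m(3) j(1) lj[OF j(1) s(1)] by simp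
      qed
      ultimately show "f \<in> {s + (\<Sum>j = 1..n. c j *\<^sub>R step_vector j) | s c. s \<in> Q \<and> (\<forall>j\<in>{1..n}. j \<in> M \<longrightarrow> c j = lj j s)}"
        using s(2) by blast
    next
      fix f assume "f \<in> {s + (\<Sum>j = 1..n. c j *\<^sub>R step_vector j) | s c. s \<in> Q \<and> (\<forall>j\<in>{1..n}. j \<in> M \<longrightarrow> c j = lj j s)}"
      then obtain s c where f: "f = s + (\<Sum>j = 1..n. c j *\<^sub>R step_vector j)" "s \<in> Q" "\<forall>j\<in>{1..n}. j \<in> M \<longrightarrow> c j = lj j s"
        by blast
      have s: "s \<in> dual_space (V' 0)" "s \<in> U" "\<forall>\<gamma>\<in>B0. s \<in> G \<gamma>" "\<forall>j\<in>{1..n}. \<forall>a\<in>C j. \<forall>b\<in>C j. l a s = l b s"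
        using f(2) unfolding Q_def U_def by blast+
      have "c j = l \<gamma> s" if "j \<in> {1..n}" "\<gamma> \<in> C j" for j \<gamma>
      proof -
        have "a j \<in> C j" unfolding a_def using that(2) by (auto simp: some_in_eq)
        then have "lj j s = l \<gamma> s" unfolding lj[OF that(1) s(1)] using s(4) that by blast
        then show ?thesis using f(3) that by (auto simp: M_def)
      qed
      then show "f \<in> E n \<inter> \<Inter>(H n ` (B0 <+> Sigma {1..n} C))"
        unfolding f(1) using mem[OF s(1), of c] s(2,3) by blast
    qed
    have "subspace Q"
    proof (rule subspaceI)
      show "0 \<in> Q" unfolding Q_def U_def G_def
        using subspace_0[OF subspace_dual_space] linear_0[OF linl] linear_0[OF Lin] by simp
      show "f + g \<in> Q" if "f \<in> Q" "g \<in> Q" for f g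
        unfolding Q_def U_def G_def mem_Collect_eq linear_add[OF linl] pairing_add
      proof (intro conjI ballI)
        show "f + g \<in> dual_space (V' 0)" using that subspace_add[OF subspace_dual_space] unfolding Q_def U_def by blast
        show "pairing (V' 1) f (\<beta> 1) + pairing (V' 1) g (\<beta> 1) = 0" using that unfolding Q_def U_def by simp
        show "pairing (V' 1) f i + pairing (V' 1) g i = 0" if "i \<in> B0" for i
          using \<open>f \<in> Q\<close> \<open>g \<in> Q\<close> that unfolding Q_def G_def by simp
        show "l b f + l b g = l b' f + l b' g" if "j \<in> {1..n}" "b \<in> C j" "b' \<in> C j" for j b b'
        proof -
          have "l b f = l b' f" "l b g = l b' g" using \<open>f \<in> Q\<close> \<open>g \<in> Q\<close> that unfolding Q_def by blast+
          then show ?thesis by simp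
        qed
      qed
      show "r *\<^sub>R f \<in> Q" if "f \<in> Q" for r f
        unfolding Q_def U_def G_def mem_Collect_eq linear_cmul[OF linl] pairing_scaleR
      proof (intro conjI ballI)
        show "r *\<^sub>R f \<in> dual_space (V' 0)" using that subspace_scale[OF subspace_dual_space] unfolding Q_def U_def by blast
        show "r * pairing (V' 1) f (\<beta> 1) = 0" using that unfolding Q_def U_def by simp
        show "r * pairing (V' 1) f i = 0" if "i \<in> B0" for i
          using \<open>f \<in> Q\<close> that unfolding Q_def G_def by simp
        show "r *\<^sub>R l b f = r *\<^sub>R l b' f" if "j \<in> {1..n}" "b \<in> C j" "b' \<in> C j" for j b b'
        proof -
          have "l b f = l b' f" using \<open>f \<in> Q\<close> that unfolding Q_def by blast
          then show ?thesis by simp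
        qed
      qed
    qed
    moreover have "Q \<subseteq> span ((\<lambda>v. Poly_Mapping.single v 1) ` V' 0)"
      using dual_space_subset_span[OF gcm.finite_V[OF gcm_stretch, of 0]] unfolding Q_def U_def by blast
    moreover have "finite ((\<lambda>v. Poly_Mapping.single v (1::real)) ` V' 0)" using gcm.finite_V[OF gcm_stretch, of 0] by simp
    moreover have "y j s = 0" if "j \<in> {1..n}" "s \<in> Q" for j s
      using ys that unfolding Q_def U_def by blast
    moreover have "linear (lj j)" for j
      unfolding lj_def by (intro linearI)
        (simp_all add: linear_add[OF liny] linear_cmul[OF liny] pairing_add pairing_scaleR diff_divide_distrib add_divide_distrib algebra_simps)
    moreover have "lj i (step_vector j) = 0" if "i \<in> {1..n}" "j \<in> {1..n}" for i j
      using that pairing_step_vector[of j n "split_vector n i (a i)"] ye[OF that] by (auto simp: lj_def da_def)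
    ultimately have "dim (E n \<inter> \<Inter>(H n ` (B0 <+> Sigma {1..n} C))) = dim Q + card ({1..n} - M)"
      unfolding eqD by (intro dim_fibred_space[where y = y] liny ye)
    moreover have "{1..n} - M = {j \<in> {1..n}. C j = {}}" by (auto simp: M_def)
    ultimately show ?thesis by (simp add: Q_def)
  qed
  \<comment> \<open>The multiple of the stretched root has no jump, so the partner has the opposite
    jump, and on \<open>U\<close> it has the opposite pairing; the two signs cancel in
    \<open>l\<close>.\<close>
  have pair: "\<exists>b\<in>T. b \<noteq> \<gamma> \<and> (\<forall>u\<in>U. l \<gamma> u = l b u)" if g: "\<gamma> \<in> T" for \<gamma>
  proof -
    have "\<gamma> \<in> I" using g by (simp add: T_def)
    then obtain \<gamma>' k where g': "\<gamma>' \<in> I" "\<And>z. \<gamma> z + \<gamma>' z = k * \<beta> 1 z"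
      unfolding I_def by (rule gcm.inversion_partner[OF gcm_stretch \<beta> \<beta>n]) blast
    have e: "\<gamma>' z = k * \<beta> 1 z - \<gamma> z" for z using g'(2)[of z] by simp
    have d: "\<gamma>' (Path 1) - \<gamma>' (Path 0) = - (\<gamma> (Path 1) - \<gamma> (Path 0))" unfolding e by (simp add: \<beta>_def)
    have "\<gamma>' \<in> T" using g'(1) d g by (auto simp: T_def)
    moreover have "\<gamma>' \<noteq> \<gamma>" using d g by (auto simp: T_def)
    moreover have "l \<gamma> u = l \<gamma>' u" if "u \<in> U" for u
    proof -
      have "pairing (V' 1) u \<gamma>' = pairing (V' 1) u (\<lambda>z. k * \<beta> 1 z - \<gamma> z)" using e by (simp add: pairing_def)
      also have "\<dots> = k * pairing (V' 1) u (\<beta> 1) - pairing (V' 1) u \<gamma>"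
        by (simp add: pairing_def sum_distrib_left sum_subtractf algebra_simps)
      also have "\<dots> = - pairing (V' 1) u \<gamma>" using that by (simp add: U_def)
      finally have p: "pairing (V' 1) u \<gamma>' = - pairing (V' 1) u \<gamma>" .
      have "- P / D = - (- P) / (- D)" for P D :: real by simp
      then show ?thesis unfolding l_def d p of_int_minus by blast
    qed
    ultimately show ?thesis by blast
  qed
  have cardT: "card T \<le> 2 * t"
  proof (rule ccontr)
    assume "\<not> card T \<le> 2 * t"
    \<comment> \<open>Large enough to beat the constant term: with d the depth of \<alpha>, the
      inequality n(2t + 1) \<le> 2(tn + d - 1) would force n \<le> 2d - 2.\<close>
    define n where "n = 2 * depth V A \<alpha>"
    have n: "1 \<le> n" by (simp add: n_def depth_def)
    \<comment> \<open>A vector in \<open>T\<close> takes different values at x_0 and x_1, so its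
      split vector jumps exactly at the cut and determines j.\<close>
    have inj: "inj_on (\<lambda>(j, \<gamma>). split_vector n j \<gamma>) ({1..n} \<times> T)"
    proof (rule inj_onI, clarify)
      fix j \<gamma> j' \<gamma>' assume j: "j \<in> {1..n}" "j' \<in> {1..n}" and g: "\<gamma> \<in> T" "\<gamma>' \<in> T"
        and eq: "split_vector n j \<gamma> = split_vector n j' \<gamma>'"
      have v: "split_vector n j \<gamma> (Path i) = split_vector n j' \<gamma>' (Path i)" for i using eq by simp
      have "j = j'"
      proof (rule ccontr)
        assume "j \<noteq> j'"
        then consider "j < j'" | "j' < j" by linarith
        then have "\<gamma> (Path 1) = \<gamma>' (Path 0) \<or> \<gamma> (Path 0) = \<gamma>' (Path 1)"
        proof cases
          case 1
          then show ?thesis using v[of j] j by simp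
        next
          case 2
          then show ?thesis using v[of j'] j by simp
        qed
        moreover have "\<gamma> (Path 0) = \<gamma>' (Path 0)" using v[of 0] j by simp
        moreover have "\<gamma> (Path 1) = \<gamma>' (Path 1)" using v[of n] j by simp
        ultimately show False using g unfolding T_def by force
      qed
      moreover have "\<gamma> = \<gamma>'"
        by (rule split_vector_inj[of j n]) (use j g eq \<open>j = j'\<close> Ir in \<open>auto simp: T_def\<close>)
      ultimately show "j = j' \<and> \<gamma> = \<gamma>'" by simp
    qed
    have "n * card T = card ((\<lambda>(j, \<gamma>). split_vector n j \<gamma>) ` ({1..n} \<times> T))"
      using card_image[OF inj] by (simp add: card_cartesian_product)
    also have "\<dots> \<le> card (inversions (V' n) (A' n) (\<beta> n))"
    proof (rule card_mono)
      show "finite (inversions (V' n) (A' n) (\<beta> n))" by (rule gcm.inversions_bound(1)[OF gcm_stretch \<beta> \<beta>n])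
      show "(\<lambda>(j, \<gamma>). split_vector n j \<gamma>) ` ({1..n} \<times> T) \<subseteq> inversions (V' n) (A' n) (\<beta> n)"
        unfolding inv[OF n] T_def by auto
    qed
    also have "\<dots> \<le> 2 * (depth (V' n) (A' n) (\<beta> n) - 1)"
      by (rule gcm.inversions_bound(2)[OF gcm_stretch \<beta> \<beta>n])
    also have "depth (V' n) (A' n) (\<beta> n) = t * n + depth V A \<alpha>"
      using growth by (simp add: has_depth_growth_rate_def \<beta>_def)
    finally have 1: "n * card T \<le> 2 * (t * n + depth V A \<alpha> - 1)" .
    have "n * (2 * t + 1) \<le> n * card T" using \<open>\<not> card T \<le> 2 * t\<close> by (intro mult_left_mono) auto
    with 1 have "n * (2 * t + 1) \<le> 2 * (t * n + depth V A \<alpha> - 1)" by linarith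
    then have "2 * (t * n) + n \<le> 2 * (t * n + depth V A \<alpha> - 1)" by (simp add: algebra_simps)
    then show False unfolding n_def by (simp add: depth_def)
  qed
  have "\<exists>p. \<forall>n\<ge>1. characteristic_polynomial (E n) (H n ` (F <+> {1..n} \<times> T)) = (\<Sum>k = 0..t. p k * [:- real k, 1:] ^ n)"
    by (rule characteristic_polynomial_fibred[where U = U and G = G and l = l and d = dim])
      (use fin cardT pair proper dims in blast)+
  then show ?thesis unfolding fracture_polynomial_def using frac by (simp add: E_def \<beta>_def)
qed

end

theorem theorem4p11:
  fixes V :: "'v set" and m :: "'v \<Rightarrow> 'v \<Rightarrow> enat" and A :: "'v \<Rightarrow> 'v \<Rightarrow> int"
    and x :: 'v and L R :: "'v set" and \<alpha> :: "'v \<Rightarrow> int" and t :: nat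
  assumes "coxeter_diagram V m"
    and "crystallographic_cartan_matrix V m A"
    and "elastic_data V m x L R"
    and "\<alpha> \<in> positive_roots V A"
    and "has_depth_growth_rate V A x L R \<alpha> t"
  shows "\<exists>(p :: nat \<Rightarrow> real poly) (e :: int). \<forall>\<^sub>F n in sequentially.
           fracture_polynomial (st_vertices V x n) (st_cartan A x L R n) (st_vector x n \<alpha>) =
             (\<Sum>k = 0..t. p k * [:- real k, 1:] ^ nat (int n - e))"
proof -
  have x: "x \<in> V" using assms(3) by (simp add: elastic_data_def)
  have sym: "A z y = 0" if "y \<in> V" "z \<in> V" "A y z = 0" for y z
    using assms(2) that unfolding crystallographic_cartan_matrix_def by metis
  have gcm: "gcm V A"
  proof
    show "finite V" using assms(1) by (simp add: coxeter_diagram_def)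
    show "A y y = 2" if "y \<in> V" for y
      using assms(2) that unfolding crystallographic_cartan_matrix_def by blast
    show "A y z \<le> 0" if "y \<in> V" "z \<in> V" "y \<noteq> z" for y z
      using assms(2) that unfolding crystallographic_cartan_matrix_def by blast
  qed (rule sym)
  \<comment> \<open>Edges correspond to nonzero entries because, for k \<ge> 2, 4 cos^2(pi/k)
    vanishes exactly at k = 2.\<close>
  have "3 \<le> m x y \<longleftrightarrow> A x y \<noteq> 0" if y: "y \<in> V" "y \<noteq> x" for y
  proof -
    have m: "2 \<le> m x y" using assms(1) x y by (simp add: coxeter_diagram_def)
    have c: "case m x y of enat k \<Rightarrow> real_of_int (A x y * A y x) = 4 * (cos (pi / real k))\<^sup>2 | \<infinity> \<Rightarrow> 4 \<le> A x y * A y x"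
      using conjunct2[OF assms(2)[unfolded crystallographic_cartan_matrix_def], rule_format, OF x y(1) y(2)[symmetric]]
      by (elim conjE)
    have z: "A x y = 0 \<longleftrightarrow> A x y * A y x = 0" using sym[OF y(1) x] by auto
    show ?thesis
    proof (cases "m x y")
      case (enat k)
      have le: "numeral j \<le> enat k \<longleftrightarrow> numeral j \<le> k" for j
        by (metis enat_ord_simps(1) numeral_eq_enat)
      have k: "2 \<le> k" using m unfolding enat le .
      have p: "real_of_int (A x y * A y x) = 4 * (cos (pi / real k))\<^sup>2" using c enat by simp
      show ?thesis
      proof (cases "k = 2")
        case True
        then have "A x y * A y x = 0" using p by simp
        then have "A x y = 0" using z by blast
        then show ?thesis using True unfolding enat le by simp
      next
        case False
        then have k3: "3 \<le> k" using k by simp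
        have "0 < cos (pi / real k)" using k3 by (intro cos_gt_zero) (auto simp: field_simps)
        then have "real_of_int (A x y * A y x) \<noteq> 0" using p by simp
        then have "A x y \<noteq> 0" by auto
        then show ?thesis using k3 unfolding enat le by simp
      qed
    next
      case infinity
      then have "4 \<le> A x y * A y x" using c by simp
      then have "A x y \<noteq> 0" by auto
      then show ?thesis using infinity by simp
    qed
  qed
  then have "L \<union> R = {y \<in> V. y \<noteq> x \<and> A x y \<noteq> 0}" "L \<inter> R = {}"
    using assms(3) unfolding elastic_data_def neighbors_def by auto
  then interpret stretching V A x L R
    using gcm x by (simp add: stretching_def stretching_axioms_def)
  have root: "\<alpha> \<in> \<Phi>" using assms(4) by (simp add: positive_roots_def)
  then have "nonneg \<alpha>" using assms(4) root_support[OF root] unfolding positive_roots_def nonneg_def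
    by (metis (mono_tags, lifting) mem_Collect_eq order_refl)
  then obtain p where "\<forall>n\<ge>1. fracture_polynomial (V' n) (A' n) (st_vector x n \<alpha>) = (\<Sum>k = 0..t. p k * [:- real k, 1:] ^ n)"
    using characteristic_polynomial_stretch[OF root _ assms(5)] by blast
  \<comment> \<open>Here e = 0, and every n \<ge> 1 is large enough.\<close>
  then have "\<forall>\<^sub>F n in sequentially. fracture_polynomial (V' n) (A' n) (st_vector x n \<alpha>) =
    (\<Sum>k = 0..t. p k * [:- real k, 1:] ^ nat (int n - 0))"
    by (intro eventually_sequentiallyI[of 1]) simp
  then show ?thesis by blast
qed

end
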